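(* Let $F=(f,g)$ be a planar vector field satisfying assumptions (A1)–(A5) of the context, and let $\tilde{\mathcal{R}}$ be the set of river trajectories with zero Maslov index defined there. Then every trajectory in $\tilde{\mathcal{R}}$ is a local minimizer of the Freidlin–Wentzell action functional among the trajectories with the same boundary value $(x(0),y(0))\in\Gamma$.
   Context: **Setting.** Let $F=(f,g):\mathbb{R}^2\to\mathbb{R}^2$ be a vector field, as smooth as needed. It is the drift of the stochastic differential equation $dz=F(z)\,dt+\sqrt{\varepsilon}\,I\,dW$, where $z=(x,y)\in\mathbb{R}^2$, $I$ is the $2\times2$ identity and $W$ is a standard Wiener process. The underlying deterministic system is $\dot z=F(z)$. **Action functional.** The Freidlin–Wentzell action functional of a path $\varphi$ in $\mathbb{R}^2$ is $\frac12\int|\dot\varphi-F(\varphi)|^2\,dt$, the integral being over the time interval on which the path is defined. For the trajectories considered below this interval is $(-\infty,0]$, and the path is the $(x,y)$-component of the trajectory. The Euler–Lagrange equations of this functional, written as a Hamiltonian system on $\mathbb{R}^4$ with $p=\dot x-f$, $q=\dot y-g$, are $$\dot x=f+p,\quad \dot y=g+q,\quad \dot p=-f_xp-g_xq,\quad \dot q=-f_yp-g_yq,\qquad(\ast)$$ with Hamiltonian $H(x,y,p,q)=f(x,y)p+g(x,y)q+\frac{p^2+q^2}{2}$. The plane $p=q=0$ is invariant and carries the flow of $\dot z=F(z)$. **Assumptions (A1), (A2).** (A1) There is an (exponentially) attracting fixed point of $\dot z=F(z)$, located at $z=(0,0)$, and it is the only fixed point. (A2) $\dot z=F(z)$ has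 an (exponentially) repelling periodic orbit $\Gamma$ surrounding the attracting fixed point at the origin, and there are no periodic orbits inside $\Gamma$. The origin, as a fixed point of $(\ast)$, is denoted $O$, and $\Gamma$ also denotes the corresponding periodic orbit of $(\ast)$ in the plane $p=q=0$. For $(\ast)$, $O$ has a 2-dimensional unstable manifold $W^u(O)$ and $\Gamma$ has a 2-dimensional stable manifold $W^s(\Gamma)$ lying in the complement of the plane $p=q=0$ apart from $\Gamma$ itself. Both $W^u(O)$ and $W^s(\Gamma)$ lie in the 3-dimensional set $\{H=0\}$. **Conjugate points and Maslov index.** If $z(t)$ is a trajectory of $(\ast)$ on $W^u(O)$, then $\tau$ is a conjugate point if the projection of the tangent space $T_{z(\tau)}W^u(O)$ to $(x,y)$-space is not of full rank (i.e., not onto). The Maslov index $m(Z)$ of a trajectory $Z=\{z(t):t\in I\}$ on $W^u(O)$, where $I\subset\mathbb{R}$ is an interval that may be bounded, infinite or semi-infinite, is the number of conjugate points $t\in I$ along $z(t)$, counted with multiplicity (that of the degeneracy of the projection). **Assumptions (A3), (A4).** (A3) There are two heteroclinic orbits $\mathcal{H}_1$ and $\mathcal{H}_2$ of $(\ast)$, both from $O$ at $t=-\infty$ to $\Gamma$ at $t=+\infty$. Moreover $W^u(O)$ and $W^s(\Gamma)$ intersect transversely (inside $\{H=0\}$) along each of them. (A4) The Maslov index of $\mathcal{H}_1$ is $0$ and that of $\mathcal{H}_2$ is $1$. **Parameterization of orbits.** Let $\mathcal{K}\subset W^u(O)$ be a simple closed curve surrounding $O$ inside the local unstable manifold, parameterized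 by an angle $\theta\in[0,2\pi)$, with $\mathcal{K}(\theta)$ the point corresponding to $\theta$. The trajectories on $W^u(O)$ are parameterized by the angle $\theta$ at which they pass through $\mathcal{K}$. Let $\theta_1,\theta_2$ be the angles at which $\mathcal{H}_1,\mathcal{H}_2$ respectively pass through $\mathcal{K}$. These angles divide $\mathcal{K}$ into two parts. There are angles near $\theta_1$ whose trajectories cross $\Gamma$ in $(x,y)$-projection, and without loss of generality these are taken to lie between $\theta_1$ and $\theta_2$. **Assumption (A5).** Every trajectory associated with angles $\theta\in(\theta_1,\theta_2)$ crosses $\Gamma$ when projected on the $(x,y)$-space. **The River.** Let $\mathcal{T}_\Gamma=\{(x,y,p,q):H(x,y,p,q)=0,\ (x,y)\in\Gamma\}$, which is a torus. Here $Z$ denotes a trajectory $z(t)$, $t\in(-\infty,0]$, of $(\ast)$ on $W^u(O)$. The full River is $$\mathcal{R}=\{Z : z(\tau)=\mathcal{K}(\theta)\text{ for some }\theta_1<\theta<\theta_2\text{ and some }\tau<0,\text{ and }z(0)\in\mathcal{T}_\Gamma\},$$ so that trajectories are parameterized to cross $\mathcal{T}_\Gamma$ at $t=0$. The sub-river is $\tilde{\mathcal{R}}=\{Z\in\mathcal{R}:m(Z)=0\}$. *)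

theory Defs
  imports "HOL-Analysis.Analysis" "HOL-Library.Extended_Nat"
begin

type_synonym plane = "real^2"

text \<open>Points of the phase space are pairs of the position \<open>(x, y)\<close> and the momentum \<open>(p, q)\<close>.\<close>
type_synonym phase = "(real^2) \<times> (real^2)"

section \<open>Differential equations\<close>

text \<open>Between finite-dimensional spaces, being of class \<open>C\<^sup>k\<close> amounts to all iterated directional
  derivatives up to order \<open>k\<close> existing and being continuous.\<close>
primrec Ck :: "nat \<Rightarrow> ('a::real_normed_vector \<Rightarrow> 'b::real_normed_vector) \<Rightarrow> bool" where
  "Ck 0 f \<longleftrightarrow> continuous_on UNIV f"
| "Ck (Suc n) f \<longleftrightarrow>
     (\<forall>x. f differentiable at x) \<and> (\<forall>v. Ck n (\<lambda>x. frechet_derivative f (at x) v))"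

definition smooth :: "('a::real_normed_vector \<Rightarrow> 'b::real_normed_vector) \<Rightarrow> bool" where
  "smooth f \<longleftrightarrow> (\<forall>n. Ck n f)"

definition solves_on :: "('a::real_normed_vector \<Rightarrow> 'a) \<Rightarrow> (real \<Rightarrow> 'a) \<Rightarrow> real set \<Rightarrow> bool" where
  "solves_on X z S \<longleftrightarrow> (\<forall>t\<in>S. (z has_vector_derivative X (z t)) (at t within S))"

text \<open>Exponential attraction is used for a fixed point (as a singleton) and for a periodic orbit.
  A set is exponentially repelling for \<open>X\<close> if it is exponentially attracting for the
  time-reversed field \<open>- X\<close>.\<close>
definition exp_attracting :: "('a::euclidean_space \<Rightarrow> 'a) \<Rightarrow> 'a set \<Rightarrow> bool" where
  "exp_attracting X A \<longleftrightarrow>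
     (\<exists>C>0. \<exists>\<kappa>>0. \<exists>\<delta>>0. \<forall>T z. solves_on X z {0..T} \<and> infdist (z 0) A < \<delta> \<longrightarrow>
        (\<forall>t\<in>{0..T}. infdist (z t) A \<le> C * exp (- \<kappa> * t) * infdist (z 0) A))"

definition exp_repelling :: "('a::euclidean_space \<Rightarrow> 'a) \<Rightarrow> 'a set \<Rightarrow> bool" where
  "exp_repelling X A \<longleftrightarrow> exp_attracting (\<lambda>x. - X x) A"

definition periodic_orbit :: "('a::euclidean_space \<Rightarrow> 'a) \<Rightarrow> 'a set \<Rightarrow> bool" where
  "periodic_orbit X \<Gamma> \<longleftrightarrow>
     (\<exists>c T. T > 0 \<and> solves_on X c UNIV \<and> (\<forall>t. c (t + T) = c t) \<and> X (c 0) \<noteq> 0 \<and> \<Gamma> = range c)"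

section \<open>The Hamiltonian system\<close>

definition hamiltonian :: "(plane \<Rightarrow> plane) \<Rightarrow> phase \<Rightarrow> real" where
  "hamiltonian F = (\<lambda>(x, p). F x \<bullet> p + (norm p)\<^sup>2 / 2)"

text \<open>The row vector \<open>p\<close> times the Jacobian matrix has the entries \<open>f\<^sub>x p + g\<^sub>x q\<close>
  and \<open>f\<^sub>y p + g\<^sub>y q\<close>.\<close>
definition ham_field :: "(plane \<Rightarrow> plane) \<Rightarrow> phase \<Rightarrow> phase" where
  "ham_field F = (\<lambda>(x, p). (F x + p, - (p v* jacobian F (at x))))"

section \<open>Invariant manifolds and conjugate points\<close>

text \<open>A trajectory on \<open>W\<^sup>u(O)\<close>; \<open>I\<close> is meant to be an interval unbounded below.\<close>
definition unstable_orbit :: "(plane \<Rightarrow> plane) \<Rightarrow> real set \<Rightarrow> (real \<Rightarrow> phase) \<Rightarrow> bool" where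
  "unstable_orbit F I z \<longleftrightarrow> solves_on (ham_field F) z I \<and> (z \<longlongrightarrow> 0) at_bot"

definition Wu :: "(plane \<Rightarrow> plane) \<Rightarrow> phase set" where
  "Wu F = {z 0 | z. unstable_orbit F {..0} z}"

text \<open>A trajectory on \<open>W\<^sup>s(\<Gamma>)\<close>; \<open>I\<close> is meant to be an interval unbounded above. The periodic
  orbit \<open>\<Gamma>\<close> of the plane is \<open>\<Gamma> \<times> {0}\<close> in phase space.\<close>
definition stable_orbit :: "(plane \<Rightarrow> plane) \<Rightarrow> plane set \<Rightarrow> real set \<Rightarrow> (real \<Rightarrow> phase) \<Rightarrow> bool" where
  "stable_orbit F \<Gamma> I z \<longleftrightarrow>
     solves_on (ham_field F) z I \<and> ((\<lambda>t. infdist (z t) (\<Gamma> \<times> {0})) \<longlongrightarrow> 0) at_top"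

text \<open>Tangent spaces consist of the velocities \<open>\<xi>\<close> of differentiable curves \<open>s \<mapsto> Z s 0\<close> in the
  manifold through \<open>v\<close>. Since \<open>W\<^sup>u(O)\<close> and \<open>W\<^sup>s(\<Gamma>)\<close> are only immersed submanifolds, the curve has
  to be continuous at \<open>v\<close> in the topology of the manifold, not merely in that of the phase space,
  so that it cannot jump between sheets accumulating at \<open>v\<close>. The manifold topology is that of
  uniform convergence of the half-orbits \<open>Z s\<close>.\<close>
definition tangent_Wu :: "(plane \<Rightarrow> plane) \<Rightarrow> phase \<Rightarrow> phase set" where
  "tangent_Wu F v = {\<xi>. \<exists>Z. (\<forall>s::real. unstable_orbit F {..0} (Z s)) \<and> Z 0 0 = v \<and>
     uniform_limit {..0} Z (Z 0) (at 0) \<and> ((\<lambda>s. Z s 0) has_vector_derivative \<xi>) (at 0)}"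

definition tangent_Ws :: "(plane \<Rightarrow> plane) \<Rightarrow> plane set \<Rightarrow> phase \<Rightarrow> phase set" where
  "tangent_Ws F \<Gamma> v = {\<xi>. \<exists>Z. (\<forall>s::real. stable_orbit F \<Gamma> {0..} (Z s)) \<and> Z 0 0 = v \<and>
     uniform_limit {0..} Z (Z 0) (at 0) \<and> ((\<lambda>s. Z s 0) has_vector_derivative \<xi>) (at 0)}"

definition conjugate_point :: "(plane \<Rightarrow> plane) \<Rightarrow> (real \<Rightarrow> phase) \<Rightarrow> real \<Rightarrow> bool" where
  "conjugate_point F z \<tau> \<longleftrightarrow> fst ` tangent_Wu F (z \<tau>) \<noteq> UNIV"

definition degeneracy :: "(plane \<Rightarrow> plane) \<Rightarrow> (real \<Rightarrow> phase) \<Rightarrow> real \<Rightarrow> nat" where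
  "degeneracy F z \<tau> = 2 - dim (fst ` tangent_Wu F (z \<tau>))"

definition maslov_index :: "(plane \<Rightarrow> plane) \<Rightarrow> real set \<Rightarrow> (real \<Rightarrow> phase) \<Rightarrow> enat" where
  "maslov_index F I z =
     (let C = {\<tau>\<in>I. conjugate_point F z \<tau>}
      in if finite C then enat (\<Sum>\<tau>\<in>C. degeneracy F z \<tau>) else \<infinity>)"

section \<open>Heteroclinic orbits and the parameterization by angles\<close>

definition heteroclinic :: "(plane \<Rightarrow> plane) \<Rightarrow> plane set \<Rightarrow> (real \<Rightarrow> phase) \<Rightarrow> bool" where
  "heteroclinic F \<Gamma> h \<longleftrightarrow> unstable_orbit F UNIV h \<and> stable_orbit F \<Gamma> UNIV h"

text \<open>The kernel of the derivative of the Hamiltonian is the tangent space of \<open>{H = 0}\<close>: an orbit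
  from \<open>O\<close> to \<open>\<Gamma>\<close> contains no fixed point, hence no critical point of the Hamiltonian.\<close>
definition transversal_along :: "(plane \<Rightarrow> plane) \<Rightarrow> plane set \<Rightarrow> (real \<Rightarrow> phase) \<Rightarrow> bool" where
  "transversal_along F \<Gamma> h \<longleftrightarrow>
     (\<forall>t. {u + w | u w. u \<in> tangent_Wu F (h t) \<and> w \<in> tangent_Ws F \<Gamma> (h t)} =
          {\<xi>. frechet_derivative (hamiltonian F) (at (h t)) \<xi> = 0})"

text \<open>A local unstable manifold consists of the points whose backward orbit tends to \<open>O\<close> inside
  a neighbourhood \<open>U\<close>, where \<open>U\<close> is so small that these points form a graph over a part of
  the \<open>(x, y)\<close>-plane.\<close>
definition local_unstable_manifold :: "(plane \<Rightarrow> plane) \<Rightarrow> phase set \<Rightarrow> bool" where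
  "local_unstable_manifold F M \<longleftrightarrow>
     (\<exists>U. open U \<and> 0 \<in> U \<and>
        M = {z 0 | z. unstable_orbit F {..0} z \<and> (\<forall>t\<le>0. z t \<in> U)}) \<and>
     (\<exists>h. continuous_on (fst ` M) h \<and> M = (\<lambda>x. (x, h x)) ` fst ` M)"

text \<open>\<open>K\<close> surrounds \<open>O\<close> within \<open>M\<close>: in the chart of \<open>M\<close> given by the projection to the plane, it
  is a Jordan curve whose interior belongs to the chart and contains the origin.\<close>
definition surrounding_curve :: "phase set \<Rightarrow> (real \<Rightarrow> phase) \<Rightarrow> bool" where
  "surrounding_curve M K \<longleftrightarrow>
     continuous_on {0..2*pi} K \<and> K (2*pi) = K 0 \<and> inj_on K {0..<2*pi} \<and> K ` {0..2*pi} \<subseteq> M \<and>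
     0 \<in> inside (fst ` K ` {0..2*pi}) \<and> inside (fst ` K ` {0..2*pi}) \<subseteq> fst ` M"

text \<open>Every trajectory on \<open>W\<^sup>u(O)\<close> other than \<open>O\<close> passes through \<open>K\<close> at exactly one angle. The
  trajectory of \<open>v\<close> may reach \<open>K\<close> before or after \<open>v\<close>.\<close>
definition angle_param :: "(plane \<Rightarrow> plane) \<Rightarrow> (real \<Rightarrow> phase) \<Rightarrow> bool" where
  "angle_param F K \<longleftrightarrow>
     (\<forall>v \<in> Wu F - {0}. \<exists>!\<theta>. \<theta> \<in> {0..<2*pi} \<and>
        (\<exists>a z. unstable_orbit F {..a} z \<and> v \<in> z ` {..a} \<and> K \<theta> \<in> z ` {..a}))"

text \<open>The trajectory with angle \<open>\<theta>\<close> crosses \<open>\<Gamma>\<close> in projection, from its interior to its exterior.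
  Trajectories need not exist for all positive times.\<close>
definition crosses :: "(plane \<Rightarrow> plane) \<Rightarrow> plane set \<Rightarrow> (real \<Rightarrow> phase) \<Rightarrow> real \<Rightarrow> bool" where
  "crosses F \<Gamma> K \<theta> \<longleftrightarrow>
     (\<exists>a z. unstable_orbit F {..a} z \<and> K \<theta> \<in> z ` {..a} \<and>
        (\<exists>s u. s < u \<and> u \<le> a \<and> fst (z s) \<in> inside \<Gamma> \<and> fst (z u) \<in> outside \<Gamma>))"

section \<open>The River\<close>

definition torus :: "(plane \<Rightarrow> plane) \<Rightarrow> plane set \<Rightarrow> phase set" where
  "torus F \<Gamma> = {v. hamiltonian F v = 0 \<and> fst v \<in> \<Gamma>}"

text \<open>Trajectories on \<open>(-\<infinity>, 0]\<close> are total functions; their values at positive times are irrelevant.\<close>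
definition river ::
    "(plane \<Rightarrow> plane) \<Rightarrow> plane set \<Rightarrow> (real \<Rightarrow> phase) \<Rightarrow> real \<Rightarrow> real \<Rightarrow> (real \<Rightarrow> phase) set" where
  "river F \<Gamma> K \<theta>\<^sub>1 \<theta>\<^sub>2 =
     {z. unstable_orbit F {..0} z \<and>
         (\<exists>\<theta> \<tau>. \<theta>\<^sub>1 < \<theta> \<and> \<theta> < \<theta>\<^sub>2 \<and> \<tau> < 0 \<and> z \<tau> = K \<theta>) \<and> z 0 \<in> torus F \<Gamma>}"

definition sub_river ::
    "(plane \<Rightarrow> plane) \<Rightarrow> plane set \<Rightarrow> (real \<Rightarrow> phase) \<Rightarrow> real \<Rightarrow> real \<Rightarrow> (real \<Rightarrow> phase) set" where
  "sub_river F \<Gamma> K \<theta>\<^sub>1 \<theta>\<^sub>2 = {z \<in> river F \<Gamma> K \<theta>\<^sub>1 \<theta>\<^sub>2. maslov_index F {..0} z = 0}"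

section \<open>The action functional\<close>

text \<open>Absolute continuity on every compact subinterval of \<open>(-\<infinity>, 0]\<close>, in the form given by the
  fundamental theorem of calculus for the Lebesgue integral: the derivative is Lebesgue integrable
  and the path is its indefinite integral.\<close>
definition ac_path :: "(real \<Rightarrow> plane) \<Rightarrow> bool" where
  "ac_path \<phi> \<longleftrightarrow>
     (\<forall>a b. a \<le> b \<and> b \<le> 0 \<longrightarrow>
        (\<lambda>t. vector_derivative \<phi> (at t)) absolutely_integrable_on {a..b} \<and>
        integral {a..b} (\<lambda>t. vector_derivative \<phi> (at t)) = \<phi> b - \<phi> a)"

definition action :: "(plane \<Rightarrow> plane) \<Rightarrow> (real \<Rightarrow> plane) \<Rightarrow> ennreal" where
  "action F \<phi> =
     (\<integral>\<^sup>+t\<in>{..0}. ennreal ((norm (vector_derivative \<phi> (at t) - F (\<phi> t)))\<^sup>2 / 2) \<partial>lebesgue)"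

text \<open>A (strong) local minimizer: the competitors are the paths with the same end point at time
  \<open>0\<close> that are uniformly close. Competitors are not required to tend to the origin as
  \<open>t \<rightarrow> -\<infinity>\<close>.\<close>
definition local_minimizer :: "(plane \<Rightarrow> plane) \<Rightarrow> (real \<Rightarrow> plane) \<Rightarrow> bool" where
  "local_minimizer F \<phi> \<longleftrightarrow> ac_path \<phi> \<and>
     (\<exists>\<delta>>0. \<forall>\<psi>. ac_path \<psi> \<and> \<psi> 0 = \<phi> 0 \<and> (\<forall>t\<le>0. dist (\<psi> t) (\<phi> t) < \<delta>) \<longrightarrow>
        action F \<phi> \<le> action F \<psi>)"

end

theory Submission
  imports Defs
begin

text \<open>Along a trajectory \<open>(\<phi>, p)\<close> the tangent vectors of the unstable manifold of the origin are solutions of the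
  linearized Hamiltonian system that are bounded at \<open>-\<infinity>\<close>. Without conjugate points they have the form
  \<open>(y, R y)\<close>, where \<open>R\<close> is symmetric, bounded, and solves the matrix Riccati equation of the second
  variation. A small perturbation \<open>M\<close> of \<open>R\<close> satisfies the Riccati inequality strictly, and then
  \<open>W(t, y) = p \<bullet> y + y \<bullet> M y / 2\<close> is a verification function: for every path \<open>\<psi>\<close> close to \<open>\<phi>\<close>, the derivative
  of \<open>W(t, \<psi> - \<phi>)\<close> is at most the difference of the action densities of \<open>\<psi>\<close> and \<open>\<phi>\<close>. It remains to
  integrate from a time at which \<open>\<psi>\<close> is close to the origin up to time \<open>0\<close>. The
  quadratic expansion is carried out in time-dependent coordinates because the projected trajectory may
  intersect itself.\<close>

text \<open>The obstacle is the infinite time interval. \<open>R\<close> solves its Riccati equation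
  exactly, so nothing is left to absorb the Taylor error of the drift, and a margin has to be found
  that is uniform on the whole half line. It comes from hyperbolicity at the origin, which is
  extracted from exponential attraction as two quadratic forms: with A the Jacobian matrix at the
  origin, \<open>Q\<close> and \<open>X\<close> solve the Lyapunov equations of A and of its
  transpose. The plane u = X v is the unstable subspace of the linearization u' = A u + v, v' = -
  A^T v, and an invariant cone around it, described by \<open>Q\<close> and \<open>X\<close>, does
  the work of an unstable manifold theorem. The tangent vectors of the definition are mere
  velocities of curves of half-orbits; the same cone, applied to the difference of two nonlinear
  half-orbits, shows that they evolve by bounded solutions. The last obstacle is that competitors
  need not tend to the origin. Finite action only yields arbitrarily early times at which they are
  close to it, which suffices since the actions are compared on compact intervals.\<close>

section \<open>Growth estimates and existence for differential equations\<close>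

text \<open>The product of \<open>q\<close> with the integrating factor e^(-mt) is nonincreasing.
  The sign of \<open>m\<close> is free: the decay estimates use it with a negative value.\<close>

lemma gronwall_real:
  fixes q :: "real \<Rightarrow> real"
  assumes "a \<le> b" "continuous_on {a..b} q"
    and "\<And>t. a < t \<Longrightarrow> t < b \<Longrightarrow> (q has_real_derivative q' t) (at t)"
    and "\<And>t. a < t \<Longrightarrow> t < b \<Longrightarrow> q' t \<le> m * q t"
  shows "q b \<le> exp (m * (b - a)) * q a"
proof -
  have "- (exp (- m * a) * q a) \<le> - (exp (- m * b) * q b)"
  proof (rule DERIV_nonneg_imp_increasing_open[OF assms(1)])
    fix t assume t: "a < t" "t < b"
    have "((\<lambda>t. - (exp (- m * t) * q t)) has_real_derivative
            exp (- m * t) * (m * q t - q' t)) (at t)"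
      using assms(3)[OF t] by (auto intro!: derivative_eq_intros simp: algebra_simps)
    moreover have "0 \<le> exp (- m * t) * (m * q t - q' t)"
      using assms(4)[OF t] by simp
    ultimately show "\<exists>y. ((\<lambda>t. - (exp (- m * t) * q t)) has_real_derivative y) (at t) \<and> 0 \<le> y"
      by blast
  next
    show "continuous_on {a..b} (\<lambda>t. - (exp (- m * t) * q t))"
      by (intro continuous_intros assms(2))
  qed
  then have "exp (m * b) * (exp (- m * b) * q b) \<le> exp (m * b) * (exp (- m * a) * q a)"
    by simp
  moreover have "exp (m * b) * (exp (- m * b) * q b) = q b"
    by (simp add: exp_minus)
  moreover have "exp (m * b) * (exp (- m * a) * q a) = exp (m * (b - a)) * q a"
    by (simp add: right_diff_distrib exp_diff exp_minus divide_inverse)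
  ultimately show ?thesis by (simp only:)
qed

lemma gronwall_real_backward:
  fixes q :: "real \<Rightarrow> real"
  assumes "a \<le> b" "continuous_on {a..b} q"
    and "\<And>t. a < t \<Longrightarrow> t < b \<Longrightarrow> (q has_real_derivative q' t) (at t)"
    and "\<And>t. a < t \<Longrightarrow> t < b \<Longrightarrow> - m * q t \<le> q' t"
  shows "q a \<le> exp (m * (b - a)) * q b"
proof -
  have "- q b \<le> exp (- m * (b - a)) * - q a"
    using assms by (intro gronwall_real[where q' = "\<lambda>t. - q' t"])
      (auto intro!: continuous_intros derivative_eq_intros simp: minus_le_iff)
  then have "exp (m * (b - a)) * (exp (- m * (b - a)) * q a) \<le> exp (m * (b - a)) * q b"
    by simp
  moreover have "exp (m * (b - a)) * (exp (- m * (b - a)) * q a) = q a"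
    by (simp only: mult.assoc[symmetric] exp_add[symmetric]) simp
  ultimately show ?thesis by (simp only:)
qed

lemma has_vector_derivative_at_within_closed:
  assumes "(e has_vector_derivative D) (at t within {a..b})" "a < t" "t < b"
  shows "(e has_vector_derivative D) (at t)"
  using assms at_within_Icc_at[of a t b] by simp

lemma has_real_derivative_norm_square:
  fixes e :: "real \<Rightarrow> 'a::real_inner"
  assumes "(e has_vector_derivative D) (at t within S)"
  shows "((\<lambda>t. (norm (e t))\<^sup>2) has_real_derivative 2 * (e t \<bullet> D)) (at t within S)"
  unfolding power2_norm_eq_inner using assms
  by (auto simp: has_vector_derivative_def has_field_derivative_def inner_commute algebra_simps
      intro!: derivative_eq_intros)

lemma gronwall_norm_aux:
  fixes x y :: "'a::real_inner"
  assumes "norm y \<le> L * norm x + \<sigma>" "0 \<le> \<sigma>"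
  shows "\<bar>2 * (x \<bullet> y)\<bar> \<le> (2 * L + 1) * (norm x)\<^sup>2 + \<sigma>\<^sup>2"
proof -
  have "\<bar>2 * (x \<bullet> y)\<bar> \<le> 2 * (norm x * norm y)"
    using Cauchy_Schwarz_ineq2[of x y] by simp
  also have "\<dots> \<le> 2 * (norm x * (L * norm x + \<sigma>))"
    using assms by (intro mult_left_mono) auto
  also have "\<dots> \<le> (2 * L + 1) * (norm x)\<^sup>2 + \<sigma>\<^sup>2"
    using sum_squares_bound[of "norm x" \<sigma>] by (simp add: power2_eq_square algebra_simps)
  finally show ?thesis .
qed

text \<open>The norm itself may fail to be differentiable at zeros, so the scalar estimate is
  applied to its square. Adding \<open>\<sigma>\<^sup>2\<close> makes the inequality homogeneous,
  and since the absolute value of the derivative is bounded, both time directions follow.\<close>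

lemma gronwall_norm:
  fixes e :: "real \<Rightarrow> 'a::real_inner"
  assumes "a \<le> b" and "0 \<le> L" "0 \<le> \<sigma>"
    and der: "\<And>t. a \<le> t \<Longrightarrow> t \<le> b \<Longrightarrow> (e has_vector_derivative e' t) (at t within {a..b})"
    and le: "\<And>t. a \<le> t \<Longrightarrow> t \<le> b \<Longrightarrow> norm (e' t) \<le> L * norm (e t) + \<sigma>"
  shows "(norm (e b))\<^sup>2 + \<sigma>\<^sup>2 \<le> exp ((2 * L + 1) * (b - a)) * ((norm (e a))\<^sup>2 + \<sigma>\<^sup>2)"
    and "(norm (e a))\<^sup>2 + \<sigma>\<^sup>2 \<le> exp ((2 * L + 1) * (b - a)) * ((norm (e b))\<^sup>2 + \<sigma>\<^sup>2)"
proof -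
  let ?q = "\<lambda>t. (norm (e t))\<^sup>2 + \<sigma>\<^sup>2"
  have cont: "continuous_on {a..b} ?q"
    using der by (intro continuous_intros)
      (meson atLeastAtMost_iff continuous_on_eq_continuous_within has_vector_derivative_continuous)
  have D: "(?q has_real_derivative 2 * (e t \<bullet> e' t)) (at t)" if "a < t" "t < b" for t
  proof -
    have "((\<lambda>t. (norm (e t))\<^sup>2) has_real_derivative 2 * (e t \<bullet> e' t)) (at t)"
      using has_vector_derivative_at_within_closed[OF der that] that
      by (intro has_real_derivative_norm_square) auto
    from DERIV_add[OF this DERIV_const] show ?thesis by simp
  qed
  have B: "\<bar>2 * (e t \<bullet> e' t)\<bar> \<le> (2 * L + 1) * ?q t" if "a < t" "t < b" for t
  proof -
    have "\<bar>2 * (e t \<bullet> e' t)\<bar> \<le> (2 * L + 1) * (norm (e t))\<^sup>2 + 1 * \<sigma>\<^sup>2"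
      using gronwall_norm_aux[OF le \<open>0 \<le> \<sigma>\<close>, of t] that by simp
    also have "\<dots> \<le> (2 * L + 1) * (norm (e t))\<^sup>2 + (2 * L + 1) * \<sigma>\<^sup>2"
      using \<open>0 \<le> L\<close> by (intro add_left_mono mult_right_mono) auto
    finally show ?thesis by (simp add: algebra_simps)
  qed
  show "?q b \<le> exp ((2 * L + 1) * (b - a)) * ?q a"
    using B by (intro gronwall_real[OF \<open>a \<le> b\<close> cont D]) (auto dest: abs_le_D1)
  show "?q a \<le> exp ((2 * L + 1) * (b - a)) * ?q b"
    by (intro gronwall_real_backward[OF \<open>a \<le> b\<close> cont D])
      (use B in \<open>auto simp: abs_le_iff minus_le_iff simp del: minus_add_distrib\<close>)
qed

text \<open>In the norm weighted by \<open>e\<^sup>-\<^sup>2\<^sup>L\<^sup>t\<close> the Picard operator contracts with factor \<open>1/2\<close> on the whole half line,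
  so that no solutions have to be glued.\<close>
lemma picard_half_line:
  fixes f :: "real \<Rightarrow> 'a::euclidean_space \<Rightarrow> 'a"
  assumes cont: "continuous_on ({0..} \<times> UNIV) (\<lambda>(t, x). f t x)"
    and lip: "\<And>t x y. 0 \<le> t \<Longrightarrow> norm (f t x - f t y) \<le> L * norm (x - y)" and L: "L > 0"
    and bd: "\<And>t. 0 \<le> t \<Longrightarrow> norm (f t 0) \<le> B"
  obtains y where "y 0 = x\<^sub>0"
    "\<And>t. 0 \<le> t \<Longrightarrow> (y has_vector_derivative f t (y t)) (at t within {0..})"
proof -
  have B: "0 \<le> B" using bd[of 0] norm_ge_zero order_trans by blast
  \<comment> \<open>The unknown is the rescaled solution \<open>u\<close>, equal to e^(-2Lt) times
    \<open>y\<close>, which is bounded even though \<open>y\<close> may grow, and so lives in the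
    complete space of bounded continuous functions. These are defined on the whole line, hence the
    \<open>max 0 t\<close> in the Picard operator \<open>P\<close>.\<close>
  define g where "g u s = f s (exp (2 * L * s) *\<^sub>R apply_bcontfun u s)" for u s
  define P where "P u t = exp (- 2 * L * max 0 t) *\<^sub>R (x\<^sub>0 + integral {0..max 0 t} (g u))" for u t
  have gc: "continuous_on {0..} (g u)" for u
  proof -
    have "continuous_on {0..} ((\<lambda>(t, x). f t x) \<circ> (\<lambda>s. (s, exp (2 * L
        * s) *\<^sub>R apply_bcontfun u s)))"
      by (intro continuous_on_compose continuous_intros)
        (auto intro!: continuous_on_subset[OF cont])
    then show ?thesis by (simp add: g_def[abs_def] o_def)
  qed
  have gi: "g u integrable_on {0..t}" for u t
    by (intro integrable_continuous_interval continuous_on_subset[OF gc]) auto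
  have expi: "((\<lambda>s. c * exp (2 * L * s)) has_integral c * (exp (2 * L * t) - 1) / (2 * L)) {0..t}"
    if "0 \<le> t" for c t
  proof -
    have "((\<lambda>s. c * exp (2 * L * s)) has_integral
        (c * exp (2 * L * t) / (2 * L) - c * exp (2 * L * 0) / (2 * L))) {0..t}"
      using L that by (intro fundamental_theorem_of_calculus)
        (auto intro!: derivative_eq_intros simp flip: has_real_derivative_iff_has_vector_derivative)
    then show ?thesis by (simp add: algebra_simps diff_divide_distrib)
  qed
  \<comment> \<open>Integrating the weight gains the factor 1/(2L), which turns the Lipschitz
    constant \<open>L\<close> into the contraction factor 1/2.\<close>
  have intb: "norm (integral {0..t} h) \<le> c / (2 * L) * exp (2 * L * t)"
    if "0 \<le> t" "0 \<le> c" "h integrable_on {0..t}"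
      "\<And>s. 0 \<le> s \<Longrightarrow> s \<le> t \<Longrightarrow> norm (h s) \<le> c * exp (2 * L * s)" for h :: "real \<Rightarrow> 'a" and c t
  proof -
    have "norm (integral {0..t} h) \<le> integral {0..t} (\<lambda>s. c * exp (2 * L * s))"
      using that expi[of t c] by (intro integral_norm_bound_integral) auto
    also have "\<dots> = c * (exp (2 * L * t) - 1) / (2 * L)"
      using expi[of t c] that by (intro integral_unique) auto
    also have "\<dots> \<le> c / (2 * L) * exp (2 * L * t)"
      using L that by (simp add: divide_simps mult_left_mono)
    finally show ?thesis .
  qed
  have gn: "norm (g u s) \<le> (B + L * norm u) * exp (2 * L * s)" if "0 \<le> s" for u s
  proof -
    let ?v = "exp (2 * L * s) *\<^sub>R apply_bcontfun u s"
    have "norm ?v \<le> exp (2 * L * s) * norm u"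
      by (simp add: norm_bounded)
    then have "L * norm (?v - 0) \<le> L * (exp (2 * L * s) * norm u)"
      using L by (intro mult_left_mono) auto
    then have 1: "norm (f s ?v - f s 0) \<le> L * (exp (2 * L * s) * norm u)"
      using lip[OF that, of ?v 0] by linarith
    have "B * 1 \<le> B * exp (2 * L * s)"
      using B L that by (intro mult_left_mono) auto
    then have 2: "norm (f s 0) \<le> B * exp (2 * L * s)"
      using bd[OF that] by linarith
    have "norm (f s ?v) \<le> norm (f s ?v - f s 0) + norm (f s 0)"
      using norm_triangle_sub[of "f s ?v" "f s 0"] by (simp add: add.commute)
    then show ?thesis using 1 2 by (simp add: g_def algebra_simps)
  qed
  have Pb: "P u \<in> bcontfun" for u
  proof (rule bcontfun_normI)
    have "continuous (at t within {0..}) (\<lambda>t. integral {0..t} (g u))" if "0 \<le> t" for t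
    proof -
      have "continuous_on {0..t+1} (\<lambda>t. integral {0..t} (g u))"
        by (rule indefinite_integral_continuous_1[OF gi])
      then have "continuous (at t within {0..t+1}) (\<lambda>t. integral {0..t} (g u))"
        using that by (auto simp: continuous_on_eq_continuous_within)
      moreover have "at t within {0..t+1} = at t within {0..}"
        using that by (intro at_within_nhd[of _ "{..<t+1}"]) auto
      ultimately show ?thesis by simp
    qed
    then have I: "continuous_on {0..} (\<lambda>t. integral {0..t} (g u))"
      by (auto simp: continuous_on_eq_continuous_within)
    have "continuous_on UNIV (\<lambda>t. integral {0..max 0 t} (g u))"
      by (rule continuous_on_compose2[OF I]) (auto intro!: continuous_intros)
    then show "continuous_on UNIV (P u)"
      unfolding P_def[abs_def] by (intro continuous_intros)
    show "norm (P u t) \<le> norm x\<^sub>0 + (B + L * norm u) / (2 * L)" for t :: real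
    proof -
      let ?m = "max 0 t"
      have "norm (P u t) \<le> exp (- 2 * L * ?m) * (norm x\<^sub>0 + norm (integral {0..?m} (g u)))"
        unfolding P_def by (simp add: norm_triangle_ineq)
      also have "\<dots> \<le> exp (- 2 * L * ?m) * (norm x\<^sub>0 + (B + L * norm u) / (2 * L) * exp (2 * L
          * ?m))"
        using B L by (intro mult_left_mono add_left_mono intb gi gn) auto
      also have "\<dots> = exp (- 2 * L * ?m) * norm x\<^sub>0 + (B + L * norm u) / (2 * L)"
        by (simp add: distrib_left exp_minus)
      also have "\<dots> \<le> norm x\<^sub>0 + (B + L * norm u) / (2 * L)"
        using L by (simp add: mult_left_le_one_le)
      finally show ?thesis .
    qed
  qed
  define T where "T u = Bcontfun (P u)" for u
  have T: "apply_bcontfun (T u) = P u" for u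
    unfolding T_def using Pb by (rule Bcontfun_inverse)
  have "dist (T u) (T v) \<le> 1/2 * dist u v" for u v
  proof (rule dist_bound)
    fix t :: real
    let ?m = "max 0 t"
    have gd: "norm (g u s - g v s) \<le> (L * dist u v) * exp (2 * L * s)" if "0 \<le> s" for s
    proof -
      have "norm (g u s - g v s) \<le> L * norm (exp (2 * L * s) *\<^sub>R apply_bcontfun u s - exp (2 * L
          * s) *\<^sub>R apply_bcontfun v s)"
        unfolding g_def by (rule lip[OF that])
      also have "\<dots> = L * (exp (2 * L * s) * dist (apply_bcontfun u s) (apply_bcontfun v s))"
        by (simp add: dist_norm flip: scaleR_diff_right)
      also have "\<dots> \<le> L * (exp (2 * L * s) * dist u v)"
        using L by (intro mult_left_mono dist_bounded) auto
      finally show ?thesis by (simp add: algebra_simps)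
    qed
    have "dist (P u t) (P v t) = exp (- 2 * L * ?m) * norm (integral {0..?m} (\<lambda>s. g u s - g v s))"
      unfolding P_def dist_norm by (simp add: gi integral_diff flip: scaleR_diff_right)
    also have "\<dots> \<le> exp (- 2 * L * ?m) * (L * dist u v / (2 * L) * exp (2 * L * ?m))"
      using L by (intro mult_left_mono intb gd integrable_diff gi) auto
    also have "\<dots> = 1/2 * dist u v"
      using L by (simp add: exp_minus)
    finally show "dist (apply_bcontfun (T u) t) (apply_bcontfun (T v) t) \<le> 1/2 * dist u v"
      by (simp add: T)
  qed
  then obtain u where u: "T u = u"
    using banach_fix_type[of "1/2" T] by auto
  define y where "y t = exp (2 * L * t) *\<^sub>R apply_bcontfun u t" for t
  have y: "y t = x\<^sub>0 + integral {0..t} (\<lambda>s. f s (y s))" if "0 \<le> t" for t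
  proof -
    have "y t = exp (2 * L * t) *\<^sub>R P u t"
      unfolding y_def by (subst (1) u[symmetric]) (simp add: T)
    also have "\<dots> = (exp (2 * L * t) * exp (- 2 * L * t)) *\<^sub>R (x\<^sub>0 + integral {0..t} (g u))"
      using that by (simp add: P_def)
    also have "\<dots> = x\<^sub>0 + integral {0..t} (\<lambda>s. f s (y s))"
      by (simp add: g_def[abs_def] y_def flip: exp_add)
    finally show ?thesis .
  qed
  show ?thesis
  proof
    show "y 0 = x\<^sub>0" using y[of 0] by simp
    fix t :: real assume t: "0 \<le> t"
    have c: "continuous_on {0..t+1} (\<lambda>s. f s (y s))"
      using continuous_on_subset[OF gc, of "{0..t+1}" u] by (simp add: g_def[abs_def] y_def)
    have "((\<lambda>t. x\<^sub>0 + integral {0..t} (\<lambda>s. f s (y s))) has_vector_derivative f t (y t)) (at t within {0..t+1})"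
      using integral_has_vector_derivative[OF c, of t] t
      by (auto intro!: derivative_eq_intros)
    then have "(y has_vector_derivative f t (y t)) (at t within {0..t+1})"
      using t y by (elim has_vector_derivative_transform[rotated 2]) auto
    moreover have "at t within {0..t+1} = at t within {0..}"
      using t by (intro at_within_nhd[of _ "{..<t+1}"]) auto
    ultimately show "(y has_vector_derivative f t (y t)) (at t within {0..})" by simp
  qed
qed

section \<open>Twice differentiable vector fields\<close>

lemma bounded_bilinear_matrix_vector_mult:
  "bounded_bilinear ((*v) :: real^'n^'m \<Rightarrow> real^'n \<Rightarrow> real^'m)"
  by (subst bilinear_conv_bounded_bilinear[symmetric])
    (auto simp: bilinear_def intro!: linearI matrix_vector_mult_add_rdistrib
      simp: matrix_vector_right_distrib matrix_vector_mult_scaleR scaleR_matrix_vector_assoc)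

lemma bounded_bilinear_vector_matrix_mult:
  "bounded_bilinear ((v*) :: real^'m \<Rightarrow> real^'n^'m \<Rightarrow> real^'n)"
  by (subst bilinear_conv_bounded_bilinear[symmetric])
    (auto simp: bilinear_def vector_matrix_mult_def vec_eq_iff sum.distrib sum_distrib_left algebra_simps
      intro!: linearI)

lemmas vm_has_derivative = bounded_bilinear.FDERIV[OF bounded_bilinear_vector_matrix_mult]
lemmas mv_continuous_on [continuous_intros] =
  bounded_bilinear.continuous_on[OF bounded_bilinear_matrix_vector_mult]
lemmas vm_continuous_on [continuous_intros] =
  bounded_bilinear.continuous_on[OF bounded_bilinear_vector_matrix_mult]

lemma vm_inner: "(p v* A) \<bullet> (u :: real^'n) = p \<bullet> (A *v u)" for p :: "real^'m"
  by (rule dot_lmul_matrix)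

text \<open>Both \<open>a\<close> and \<open>b\<close> vary while the derivative stays frozen at
  \<open>x\<close>; this strict differentiability makes the difference of two orbits near a fixed
  point solve an almost linear equation. It is the mean value inequality on a ball where
  \<open>f'\<close> varies by at most \<sigma>.\<close>

lemma C1_linearization_at:
  fixes f :: "'a::euclidean_space \<Rightarrow> 'b::real_normed_vector" and f' :: "'a \<Rightarrow> 'a \<Rightarrow>\<^sub>L 'b"
  assumes der: "\<And>x. (f has_derivative f' x) (at x)" and cont: "continuous_on UNIV f'" and "\<sigma> > 0"
  obtains d where "d > 0" "\<And>a b. a \<in> ball x d \<Longrightarrow> b \<in> ball x d \<Longrightarrow>
    norm (f b - f a - f' x (b - a)) \<le> \<sigma> * norm (b - a)"
proof -
  obtain d where d: "d > 0" "\<And>y. dist y x < d \<Longrightarrow> dist (f' y) (f' x) < \<sigma>"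
    using cont \<open>\<sigma> > 0\<close> unfolding continuous_on_iff by fastforce
  show ?thesis
  proof (rule that[OF d(1)])
    fix a b :: 'a assume ab: "a \<in> ball x d" "b \<in> ball x d"
    have "norm (f b - f a - f' x (b - a)) \<le> norm (b - a) * \<sigma>"
    proof (rule differentiable_bound_linearization[where S = "ball x d" and f' = "\<lambda>x. blinfun_apply (f' x)"])
      fix t :: real assume t: "t \<in> {0..1}"
      have "(1 - t) *\<^sub>R a + t *\<^sub>R b \<in> ball x d"
        using ab t by (intro convexD[OF convex_ball]) auto
      then show "a + t *\<^sub>R (b - a) \<in> ball x d" by (simp add: algebra_simps)
    next
      fix y assume "y \<in> ball x d"
      then have "norm (f' y - f' x) \<le> \<sigma>"
        using d(2)[of y] by (simp add: dist_norm norm_minus_commute)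
      then show "onorm (blinfun_apply (f' y) - blinfun_apply (f' x)) \<le> \<sigma>"
        by (simp add: norm_blinfun.rep_eq minus_blinfun.rep_eq fun_diff_def)
    qed (use d in \<open>auto intro: has_derivative_at_withinI[OF der]\<close>)
    then show "norm (f b - f a - f' x (b - a)) \<le> \<sigma> * norm (b - a)" by (simp add: mult.commute)
  qed
qed

text \<open>Here the derivative is taken at the moving base point, with one \<open>d\<close> for all
  base points of a ball: \<open>f'\<close> is uniformly continuous on the compact ball of radius
  \<open>r + 1\<close>, and capping \<open>d\<close> at 1 keeps \<open>b\<close> inside it.\<close>

lemma C1_remainder_uniform:
  fixes f :: "'a::euclidean_space \<Rightarrow> 'b::real_normed_vector" and f' :: "'a \<Rightarrow> 'a \<Rightarrow>\<^sub>L 'b"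
  assumes der: "\<And>x. (f has_derivative f' x) (at x)" and cont: "continuous_on UNIV f'" and "\<sigma> > 0"
  obtains d where "d > 0" "\<And>a b. norm a \<le> r \<Longrightarrow> norm (b - a) < d \<Longrightarrow>
    norm (f b - f a - f' a (b - a)) \<le> \<sigma> * norm (b - a)"
proof -
  have "uniformly_continuous_on (cball 0 (r + 1)) f'"
    by (intro compact_uniformly_continuous continuous_on_subset[OF cont]) auto
  then obtain d where d: "d > 0"
    "\<And>x y. x \<in> cball 0 (r+1) \<Longrightarrow> y \<in> cball 0 (r+1) \<Longrightarrow> dist y x < d \<Longrightarrow> dist (f' y) (f' x) < \<sigma>"
    using \<open>\<sigma> > 0\<close> unfolding uniformly_continuous_on_def by meson
  show ?thesis
  proof (rule that[of "min d 1"])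
    fix a b :: 'a assume ab: "norm a \<le> r" "norm (b - a) < min d 1"
    have "norm (f b - f a - f' a (b - a)) \<le> norm (b - a) * \<sigma>"
    proof (rule differentiable_bound_linearization[where S = "ball a (min d 1)" and f' = "\<lambda>x. blinfun_apply (f' x)"])
      fix t :: real assume t: "t \<in> {0..1}"
      have "(1 - t) *\<^sub>R a + t *\<^sub>R b \<in> ball a (min d 1)"
        using ab t d(1) by (intro convexD[OF convex_ball]) (auto simp: dist_norm norm_minus_commute)
      then show "a + t *\<^sub>R (b - a) \<in> ball a (min d 1)" by (simp add: algebra_simps)
    next
      fix y assume y: "y \<in> ball a (min d 1)"
      then have "norm y \<le> norm a + 1"
        using norm_triangle_sub[of y a] by (simp add: dist_norm norm_minus_commute)
      then have "norm (f' y - f' a) \<le> \<sigma>"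
        using d(2)[of a y] y ab by (simp add: dist_norm norm_minus_commute)
      then show "onorm (blinfun_apply (f' y) - blinfun_apply (f' a)) \<le> \<sigma>"
        by (simp add: norm_blinfun.rep_eq minus_blinfun.rep_eq fun_diff_def)
    qed (use d in \<open>auto intro: has_derivative_at_withinI[OF der]\<close>)
    then show "norm (f b - f a - f' a (b - a)) \<le> \<sigma> * norm (b - a)" by (simp add: mult.commute)
  qed (use d in auto)
qed

lemma Ck_Suc_obtain_derivative:
  fixes f :: "'a::euclidean_space \<Rightarrow> 'b::euclidean_space"
  assumes "Ck (Suc n) f"
  obtains f' :: "'a \<Rightarrow> 'a \<Rightarrow>\<^sub>L 'b" where "\<And>x. (f has_derivative f' x) (at x)"
    "\<And>v. Ck n (\<lambda>x. f' x v)"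
proof
  have *: "(f has_derivative frechet_derivative f (at x)) (at x)" for x
    using assms by (simp add: frechet_derivative_works)
  have eq: "blinfun_apply (Blinfun (frechet_derivative f (at x))) = frechet_derivative f (at x)"
    for x
    using has_derivative_bounded_linear[OF *[of x]] by (rule bounded_linear_Blinfun_apply)
  show "(f has_derivative blinfun_apply (Blinfun (frechet_derivative f (at x)))) (at x)" for x
    using * by (simp add: eq)
  show "Ck n (\<lambda>x. blinfun_apply (Blinfun (frechet_derivative f (at x))) v)" for v
    using assms by (simp add: eq)
qed

text \<open>The second derivative of \<open>F\<close> at \<open>x\<close> in the directions u and w
  is \<open>J' x u *v w\<close>; as a derivative of the matrix field \<open>J\<close> it is not
  symmetric by construction.\<close>

locale C2_field =
  fixes F :: "real^'n \<Rightarrow> real^'n" and J :: "real^'n \<Rightarrow> real^'n^'n"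
    and J' :: "real^'n \<Rightarrow> (real^'n) \<Rightarrow>\<^sub>L (real^'n^'n)"
  assumes F_der: "(F has_derivative (*v) (J x)) (at x)"
    and J_der: "(J has_derivative J' x) (at x)"
    and J'_cont: "continuous_on UNIV J'"
begin

text \<open>Schwarz's theorem: the second difference of \<open>F\<close> over the parallelogram
  spanned by \<open>s *\<^sub>R u\<close> and \<open>s *\<^sub>R w\<close>, divided by s^2, tends to
  the left-hand side. Being symmetric in u and w, it also tends to the right-hand side.\<close>

lemma J'_symmetric: "J' x u *v w = J' x w *v u"
proof -
  interpret mv: bounded_bilinear "(*v) :: real^'n^'n \<Rightarrow> _"
    by (rule bounded_bilinear_matrix_vector_mult)
  obtain B where B: "B > 0" "\<And>A v. norm ((A :: real^'n^'n) *v v) \<le> norm A * norm v * B"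
    using mv.pos_bounded by blast
  have key: "\<exists>s0>0. \<forall>s. 0 < s \<and> s < s0 \<longrightarrow>
     norm (F (x + s *\<^sub>R u + s *\<^sub>R w) - F (x + s *\<^sub>R w) - F (x + s *\<^sub>R u) + F x - s\<^sup>2 *\<^sub>R (J' x u *v w))
       \<le> \<sigma> * norm u * norm w * B * s\<^sup>2" if "\<sigma> > 0" for \<sigma> u w
  proof -
    obtain d where d: "d > 0" "\<And>a b. a \<in> ball x d \<Longrightarrow> b \<in> ball x d \<Longrightarrow>
        norm (J b - J a - J' x (b - a)) \<le> \<sigma> * norm (b - a)"
      using C1_linearization_at[OF J_der J'_cont \<open>\<sigma> > 0\<close>] by metis
    define s0 where "s0 = d / (norm u + norm w + 1)"
    have pos: "norm u + norm w + 1 > 0" by (simp add: add_nonneg_pos)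
    have "s0 > 0" using d(1) pos by (simp add: s0_def)
    moreover
    {
      fix s assume s: "0 < s" "s < s0"
      have sd: "s * (norm u + norm w + 1) < d"
        using s pos by (simp add: s0_def pos_less_divide_eq)
      \<comment> \<open>The increment of \<open>F\<close> in direction u, as a function of the
        position \<open>t\<close> along w, less its expected value. Its increment from 0 to
        \<open>s\<close> is the second difference minus the limit term, so one mean value inequality
        suffices.\<close>
      define g where "g t = F (x + s *\<^sub>R u + t *\<^sub>R w) - F (x + t *\<^sub>R w) - (t
          * s) *\<^sub>R (J' x u *v w)" for t
      have der: "(g has_derivative (\<lambda>h. h *\<^sub>R ((J (x + s *\<^sub>R u + t *\<^sub>R w) - J (x + t *\<^sub>R w)
          - J' x (s *\<^sub>R u)) *v w)))
          (at t within {0..s})" for t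
      proof -
        have 1: "((\<lambda>t. F (c + t *\<^sub>R w)) has_derivative (\<lambda>h. J (c
            + t *\<^sub>R w) *v (h *\<^sub>R w))) (at t within {0..s})" for c
          by (rule has_derivative_compose[where f = "\<lambda>t. c + t *\<^sub>R w", OF _ F_der])
            (auto intro!: derivative_eq_intros)
        show ?thesis unfolding g_def
          by (rule derivative_eq_intros 1 refl)+
            (auto simp: algebra_simps matrix_vector_mult_scaleR blinfun.scaleR_right scaleR_matrix_vector_assoc)
      qed
      have bound: "norm ((J (x + s *\<^sub>R u + t *\<^sub>R w) - J (x + t *\<^sub>R w) - J' x (s *\<^sub>R u)) *v w) \<le> \<sigma>
          * norm u * norm w * B * s"
        if t: "t \<in> {0..s}" for t
      proof -
        have tw: "t * norm w \<le> s * norm w" using t by (intro mult_right_mono) auto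
        have "norm (s *\<^sub>R u + t *\<^sub>R w) \<le> s * norm u + t * norm w"
          using s t by (metis norm_triangle_le norm_scaleR abs_of_nonneg atLeastAtMost_iff less_imp_le order_refl)
        then have 1: "x + s *\<^sub>R u + t *\<^sub>R w \<in> ball x d"
          using sd s tw norm_minus_cancel[of "s *\<^sub>R u + t *\<^sub>R w"]
            by (simp add: dist_norm algebra_simps)
        have 2: "x + t *\<^sub>R w \<in> ball x d"
          using sd s t tw by (simp add: dist_norm algebra_simps) (smt (verit) mult_nonneg_nonneg norm_ge_zero)
        have "norm (J (x + s *\<^sub>R u + t *\<^sub>R w) - J (x + t *\<^sub>R w) - J' x (s *\<^sub>R u)) \<le> \<sigma> * (s
            * norm u)"
          using d(2)[OF 2 1] s by simp
        then have "norm (J (x + s *\<^sub>R u + t *\<^sub>R w) - J (x + t *\<^sub>R w) - J' x (s *\<^sub>R u)) * norm w * B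
          \<le> \<sigma> * (s * norm u) * norm w * B"
          using B by (intro mult_right_mono) auto
        then show ?thesis using B(2) by (smt (verit) mult.assoc mult.commute)
      qed
      have "norm (g s - g 0) \<le> (\<sigma> * norm u * norm w * B * s) * norm (s - 0)"
      proof (rule differentiable_bound[OF convex_real_interval(5) der])
        fix t assume t: "t \<in> {0..s}"
        show "onorm (\<lambda>h. h *\<^sub>R ((J (x + s *\<^sub>R u + t *\<^sub>R w) - J (x + t *\<^sub>R w)
            - J' x (s *\<^sub>R u)) *v w)) \<le> \<sigma> * norm u * norm w * B * s"
          by (rule onorm_le) (use mult_left_mono[OF bound[OF t], of "\<bar>_\<bar>"] in \<open>auto simp: ac_simps\<close>)
      qed (use s in auto)
      then have "norm (F (x + s *\<^sub>R u + s *\<^sub>R w) - F (x + s *\<^sub>R w) - F (x + s *\<^sub>R u) + F x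
          - s\<^sup>2 *\<^sub>R (J' x u *v w))
       \<le> \<sigma> * norm u * norm w * B * s\<^sup>2"
        using s by (simp add: g_def algebra_simps power2_eq_square)
    }
    ultimately show ?thesis by blast
  qed
  have "norm (J' x u *v w - J' x w *v u) \<le> \<epsilon>" if "\<epsilon> > 0" for \<epsilon>
  proof -
    define \<sigma> where "\<sigma> = \<epsilon> / (2 * (norm u * norm w * B + 1))"
    have p: "norm u * norm w * B + 1 > 0" using B by (simp add: add_nonneg_pos)
    then have \<sigma>: "\<sigma> > 0" using that by (simp add: \<sigma>_def)
    obtain s1 where s1: "s1 > 0" "\<And>s. 0 < s \<Longrightarrow> s < s1 \<Longrightarrow>
     norm (F (x + s *\<^sub>R u + s *\<^sub>R w) - F (x + s *\<^sub>R w) - F (x + s *\<^sub>R u) + F x - s\<^sup>2 *\<^sub>R (J' x u *v w))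
       \<le> \<sigma> * norm u * norm w * B * s\<^sup>2" using key[OF \<sigma>] by blast
    obtain s2 where s2: "s2 > 0" "\<And>s. 0 < s \<Longrightarrow> s < s2 \<Longrightarrow>
     norm (F (x + s *\<^sub>R w + s *\<^sub>R u) - F (x + s *\<^sub>R u) - F (x + s *\<^sub>R w) + F x - s\<^sup>2 *\<^sub>R (J' x w *v u))
       \<le> \<sigma> * norm w * norm u * B * s\<^sup>2" using key[OF \<sigma>] by blast
    define s where "s = min s1 s2 / 2"
    have s: "0 < s" "s < s1" "s < s2" using s1(1) s2(1) by (auto simp: s_def)
    let ?A = "F (x + s *\<^sub>R u + s *\<^sub>R w) - F (x + s *\<^sub>R w) - F (x + s *\<^sub>R u) + F x"
    have "norm (?A - s\<^sup>2 *\<^sub>R (J' x w *v u)) \<le> \<sigma> * norm w * norm u * B * s\<^sup>2"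
      using s2(2)[OF s(1,3)] by (simp add: algebra_simps)
    then have "norm ((?A - s\<^sup>2 *\<^sub>R (J' x w *v u)) - (?A - s\<^sup>2 *\<^sub>R (J' x u *v w)))
        \<le> \<sigma> * norm w * norm u * B * s\<^sup>2 + \<sigma> * norm u * norm w * B * s\<^sup>2"
      using s1(2)[OF s(1,2)] norm_triangle_ineq4 add_mono order_trans by blast
    moreover have "(?A - s\<^sup>2 *\<^sub>R (J' x w *v u)) - (?A - s\<^sup>2 *\<^sub>R (J' x u *v w))
        = s\<^sup>2 *\<^sub>R (J' x u *v w - J' x w *v u)"
      by (simp add: algebra_simps)
    ultimately have "norm (s\<^sup>2 *\<^sub>R (J' x u *v w - J' x w *v u)) \<le> s\<^sup>2 * (2 * (\<sigma> * norm u * norm w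
        * B))"
      by (simp only:) (simp add: algebra_simps)
    then have "s\<^sup>2 * norm (J' x u *v w - J' x w *v u) \<le> s\<^sup>2 * (2 * (\<sigma> * norm u * norm w * B))"
      by simp
    then have "norm (J' x u *v w - J' x w *v u) \<le> 2 * (\<sigma> * norm u * norm w * B)"
      using s(1) by simp
    also have "\<dots> = 2 * (\<sigma> * (norm u * norm w * B))"
      by (simp add: mult.assoc)
    also have "\<dots> = \<epsilon> * ((norm u * norm w * B) / (norm u * norm w * B + 1))"
      unfolding \<sigma>_def by (simp only: times_divide_eq_left times_divide_eq_right mult_divide_mult_cancel_left_if) simp
    also have "\<dots> \<le> \<epsilon> * 1"
      using that p by (intro mult_left_mono) (auto simp: divide_le_eq)
    finally show ?thesis by simp
  qed
  then have "norm (J' x u *v w - J' x w *v u) \<le> 0" by (rule field_le_epsilon) simp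
  then show ?thesis by simp
qed

text \<open>Along the segment from x to x + y the remainder has the derivative
  \<open>(J (x + t *\<^sub>R y) - J x - J' x (t *\<^sub>R y)) *v y\<close>, which the first-order
  remainder of \<open>J\<close> bounds. The radius \<open>d\<close> serves all base points of a ball
  at once, since the expansion is used along a whole trajectory.\<close>

lemma taylor2_uniform:
  assumes "\<sigma> > 0"
  obtains d where "d > 0" "\<And>x y. norm x \<le> r \<Longrightarrow> norm y < d \<Longrightarrow>
    norm (F (x + y) - F x - J x *v y - (1/2) *\<^sub>R (J' x y *v y)) \<le> \<sigma> * (norm y)\<^sup>2"
proof -
  interpret mv: bounded_bilinear "(*v) :: real^'n^'n \<Rightarrow> _"
    by (rule bounded_bilinear_matrix_vector_mult)
  obtain B where B: "B > 0" "\<And>A v. norm ((A :: real^'n^'n) *v v) \<le> norm A * norm v * B"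
    using mv.pos_bounded by blast
  have "\<sigma> / B > 0" using assms B by simp
  from C1_remainder_uniform[OF J_der J'_cont this, of r]
  obtain d where d: "d > 0" "\<And>a b. norm a \<le> r \<Longrightarrow> norm (b - a) < d \<Longrightarrow>
    norm (J b - J a - J' a (b - a)) \<le> \<sigma> / B * norm (b - a)" by metis
  show ?thesis
  proof (rule that[OF d(1)])
    fix x y :: "real^'n" assume xy: "norm x \<le> r" "norm y < d"
    define g where "g t = F (x + t *\<^sub>R y) - t *\<^sub>R (J x *v y) - (t\<^sup>2 / 2) *\<^sub>R (J' x y *v y)" for t
    have der: "(g has_derivative (\<lambda>h. h *\<^sub>R ((J (x + t *\<^sub>R y) - J x
        - J' x (t *\<^sub>R y)) *v y))) (at t within {0..1})" for t
    proof -
      have 1: "((\<lambda>t. F (c + t *\<^sub>R w)) has_derivative (\<lambda>h. J (c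
          + t *\<^sub>R w) *v (h *\<^sub>R w))) (at t within {0..1})" for c w
        by (rule has_derivative_compose[where f = "\<lambda>t. c + t *\<^sub>R w", OF _ F_der])
          (auto intro!: derivative_eq_intros)
      show ?thesis unfolding g_def
        by (rule derivative_eq_intros 1 refl)+
          (auto simp: algebra_simps matrix_vector_mult_scaleR blinfun.scaleR_right scaleR_matrix_vector_assoc)
    qed
    have "norm (g 1 - g 0) \<le> (\<sigma> * (norm y)\<^sup>2) * norm (1 - 0 :: real)"
    proof (rule differentiable_bound[OF convex_real_interval(5) der])
      fix t :: real assume t: "t \<in> {0..1}"
      have ty: "t * norm y \<le> 1 * norm y" using t by (intro mult_right_mono) auto
      have "norm (J (x + t *\<^sub>R y) - J x - J' x (t *\<^sub>R y)) \<le> \<sigma> / B * (t * norm y)"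
        using d(2)[OF xy(1), of "x + t *\<^sub>R y"] t xy ty by simp
      also have "\<dots> \<le> \<sigma> / B * norm y"
        using assms B ty by (intro mult_left_mono) auto
      finally have "norm (J (x + t *\<^sub>R y) - J x - J' x (t *\<^sub>R y)) * norm y * B \<le> \<sigma> / B * norm y
          * norm y * B"
        using B by (intro mult_right_mono) auto
      also have "\<dots> = \<sigma> * (norm y)\<^sup>2" using B by (simp add: power2_eq_square)
      finally have *: "norm ((J (x + t *\<^sub>R y) - J x - J' x (t *\<^sub>R y)) *v y) \<le> \<sigma> * (norm y)\<^sup>2"
        using B(2) order_trans by blast
      show "onorm (\<lambda>h. h *\<^sub>R ((J (x + t *\<^sub>R y) - J x - J' x (t *\<^sub>R y)) *v y)) \<le> \<sigma> * (norm y)\<^sup>2"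
        by (rule onorm_le) (use mult_left_mono[OF *, of "\<bar>_\<bar>"] in \<open>auto simp: ac_simps\<close>)
    qed auto
    then show "norm (F (x + y) - F x - J x *v y - (1/2) *\<^sub>R (J' x y *v y)) \<le> \<sigma> * (norm y)\<^sup>2"
      by (simp add: g_def algebra_simps)
  qed
qed

end

text \<open>Smoothness speaks of one direction at a time. The derivative of the Jacobian matrix is
  put together from the derivatives of its columns \<open>F' x (axis j 1)\<close>, and in finite
  dimension continuity in every fixed direction gives continuity in operator norm.\<close>

lemma smooth_imp_C2_field:
  fixes F :: "real^'n \<Rightarrow> real^'n"
  assumes "smooth F"
  obtains J' where "C2_field F (\<lambda>x. jacobian F (at x)) J'"
proof -
  have Ck: "Ck n F" for n using assms by (simp add: smooth_def)
  obtain F' :: "real^'n \<Rightarrow> (real^'n) \<Rightarrow>\<^sub>L (real^'n)"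
    where F': "\<And>x. (F has_derivative F' x) (at x)" "\<And>v. Ck (Suc 0) (\<lambda>x. F' x v)"
    using Ck_Suc_obtain_derivative[OF Ck] by metis
  have "\<exists>F2 :: real^'n \<Rightarrow> (real^'n) \<Rightarrow>\<^sub>L (real^'n). (\<forall>x. ((\<lambda>x. F' x v) has_derivative F2 x) (at x)) \<and>
      (\<forall>w. continuous_on UNIV (\<lambda>x. F2 x w))" for v
    using Ck_Suc_obtain_derivative[OF F'(2)[of v]] by (metis Ck.simps(1))
  then obtain F2 :: "real^'n \<Rightarrow> real^'n \<Rightarrow> (real^'n) \<Rightarrow>\<^sub>L (real^'n)"
    where F2: "\<And>v x. ((\<lambda>x. F' x v) has_derivative F2 v x) (at x)"
      "\<And>v w. continuous_on UNIV (\<lambda>x. F2 v x w)"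
    by metis
  define J where "J x = jacobian F (at x)" for x
  have J: "J x = matrix (F' x)" for x
    unfolding J_def jacobian_def by (simp add: frechet_derivative_at[OF F'(1), symmetric])
  have Jv: "J x *v h = F' x h" for x h
    unfolding J using has_derivative_linear[OF F'(1)[of x]]
    by (intro matrix_works) (simp add: linear_matrix_vector_mul_eq)
  define D where "D x h = (\<chi> i j. F2 (axis j 1) x h $ i)" for x h
  have Jder: "(J has_derivative D x) (at x)" for x
  proof -
    have "((\<lambda>x. J x $ i $ j) has_derivative (\<lambda>h. D x h $ i $ j)) (at x)" for i j
      by (simp add: J matrix_def D_def bounded_linear.has_derivative[OF bounded_linear_vec_nth] F2)
    then show ?thesis
      by (subst has_derivative_componentwise_within) (auto simp: Basis_vec_def inner_axis)
  qed
  have eq: "blinfun_apply (Blinfun (D x)) = D x" for x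
    using has_derivative_bounded_linear[OF Jder] by (rule bounded_linear_Blinfun_apply)
  have "C2_field F J (\<lambda>x. Blinfun (D x))"
  proof
    show "(F has_derivative (*v) (J x)) (at x)" for x
      using F'(1)[of x] by (simp add: Jv[abs_def])
    show "(J has_derivative blinfun_apply (Blinfun (D x))) (at x)" for x
      using Jder by (simp add: eq)
    show "continuous_on UNIV (\<lambda>x. Blinfun (D x))"
      by (rule continuous_on_blinfun_componentwise, simp only: eq)
        (auto simp: D_def intro!: continuous_intros F2)
  qed
  then show ?thesis using that unfolding J_def by blast
qed

section \<open>Linearization at an attracting fixed point\<close>

text \<open>The definition of exponential attraction says nothing about points from which no solution starts,
  so the nonlinear solutions, which shadow small multiples of the linear ones, have to be constructed.\<close>
lemma exp_attracting_linear_decay: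
  fixes f :: "'a::euclidean_space \<Rightarrow> 'a" and f' :: "'a \<Rightarrow> 'a \<Rightarrow>\<^sub>L 'a"
  assumes der: "\<And>x. (f has_derivative f' x) (at x)" and cont: "continuous_on UNIV f'"
    and f0: "f 0 = 0" and att: "exp_attracting f {0}"
  obtains C \<kappa> where "C > 0" "\<kappa> > 0"
    "\<And>l T. 0 \<le> T \<Longrightarrow> solves_on (f' 0) l {0..T} \<Longrightarrow> norm (l T) \<le> C * exp (- \<kappa> * T) * norm (l 0)"
proof -
  obtain C \<kappa> \<delta> where C: "C > 0" "\<kappa> > 0" "\<delta> > 0"
    and dec: "\<And>T z t. solves_on f z {0..T} \<Longrightarrow> norm (z 0) < \<delta> \<Longrightarrow> t \<in> {0..T} \<Longrightarrow>
       norm (z t) \<le> C * exp (- \<kappa> * t) * norm (z 0)"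
    using att unfolding exp_attracting_def by (force simp: infdist_singleton dist_norm)
  define A where "A = f' 0"
  define L where "L = norm A + 1"
  obtain d where d: "d > 0" "\<And>a b. a \<in> ball 0 d \<Longrightarrow> b \<in> ball 0 d \<Longrightarrow>
      norm (f b - f a - f' 0 (b - a)) \<le> 1 * norm (b - a)"
    using C1_linearization_at[OF der cont, of 1 0] by (metis zero_less_one)
  have L: "L > 0" by (simp add: L_def add_nonneg_pos)
  have fL: "norm (f b - f a) \<le> L * norm (b - a)" if "norm a < d" "norm b < d" for a b
  proof -
    have "norm (f b - f a) \<le> norm (f b - f a - f' 0 (b - a)) + norm (f' 0 (b - a))"
      using norm_triangle_sub[of "f b - f a" "f' 0 (b - a)"] by (simp add: add.commute)
    also have "\<dots> \<le> 1 * norm (b - a) + norm A * norm (b - a)"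
      unfolding A_def using that by (intro add_mono d norm_blinfun) auto
    finally show ?thesis by (simp add: L_def algebra_simps)
  qed
  \<comment> \<open>The field is composed with the nearest-point projection onto a small ball to
    become globally Lipschitz, as \<open>picard_half_line\<close> requires. The constructed orbit
    stays in the ball up to time \<open>T\<close>, where the truncation is invisible.\<close>
  define r where "r = d / 2"
  have r: "r > 0" "r < d" using d(1) by (auto simp: r_def)
  define cl where "cl = closest_point (cball (0::'a) r)"
  have cl: "norm (cl x) \<le> r" "norm x \<le> r \<Longrightarrow> cl x = x" "norm (cl x - cl y) \<le> norm (x - y)" for x y
    using closest_point_in_set[of "cball 0 r" x] closest_point_self[of x "cball 0 r"]
      closest_point_lipschitz[of "cball 0 r" x y] r
    by (auto simp: cl_def dist_norm)
  have gL: "norm (f (cl x) - f (cl y)) \<le> L * norm (x - y)" for x y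
  proof -
    have "norm (f (cl x) - f (cl y)) \<le> L * norm (cl x - cl y)"
      using cl(1) r(2) by (intro fL) (auto intro: le_less_trans)
    also have "\<dots> \<le> L * norm (x - y)" using L cl(3) by (intro mult_left_mono) auto
    finally show ?thesis .
  qed
  have fcl_cont: "continuous_on UNIV (\<lambda>x. f (cl x))"
  proof -
    have "L-lipschitz_on UNIV (\<lambda>x. f (cl x))"
      using gL L by (auto simp: lipschitz_on_def dist_norm)
    then show ?thesis by (rule lipschitz_on_continuous_on)
  qed
  show ?thesis
  proof (rule that[OF C(1,2)])
    fix l T assume T: "0 \<le> T" and l: "solves_on (blinfun_apply (f' 0)) l {0..T}"
    define K where "K = exp ((2 * L + 1) * T)"
    have K: "K \<ge> 1" using L T by (simp add: K_def)
    have bound: "norm (l T) \<le> C * exp (- \<kappa> * T) * norm (l 0) + \<sigma> * (K\<^sup>2 * norm (l 0))"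
      if \<sigma>: "\<sigma> > 0" for \<sigma>
    proof -
      obtain ds where ds: "ds > 0" "\<And>a b. a \<in> ball 0 ds \<Longrightarrow> b \<in> ball 0 ds \<Longrightarrow>
        norm (f b - f a - f' 0 (b - a)) \<le> \<sigma> * norm (b - a)"
        using C1_linearization_at[OF der cont \<sigma>, of 0] by metis
      define \<rho> where "\<rho> = min \<delta> (min r ds)"
      have \<rho>: "\<rho> > 0" "\<rho> \<le> \<delta>" "\<rho> \<le> r" "\<rho> \<le> ds" using C r ds by (auto simp: \<rho>_def)
      \<comment> \<open>Scaling the initial value by \<open>\<epsilon>\<close> keeps the nonlinear
        orbit inside the ball of radius \<open>\<rho>\<close> on the whole interval:
        \<open>K\<close> is the Gronwall factor, and the added 1 covers
        \<open>l 0 = 0\<close>.\<close>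
      define \<epsilon> where "\<epsilon> = \<rho> / (K * (norm (l 0) + 1))"
      have Kl: "K * (norm (l 0) + 1) > 0" using K by (simp add: add_nonneg_pos)
      have \<epsilon>: "\<epsilon> > 0" using Kl \<rho> by (simp add: \<epsilon>_def)
      have small: "K * (\<epsilon> * norm (l 0)) < \<rho>"
        using Kl \<rho>(1) K norm_ge_zero[of "l 0"] by (simp add: \<epsilon>_def divide_simps not_less)
      have "1 * (\<epsilon> * norm (l 0)) \<le> K * (\<epsilon> * norm (l 0))" using K \<epsilon> by (intro mult_right_mono) auto
      then have small0: "\<epsilon> * norm (l 0) < \<delta>" using small \<rho> by simp
      have "continuous_on ({0..} \<times> UNIV) (\<lambda>(t::real, x). f (cl x))"
        unfolding case_prod_beta
        by (rule continuous_on_compose2[OF fcl_cont]) (auto intro!: continuous_intros)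
      from picard_half_line[OF this gL L, of "norm (f (cl 0))" "\<epsilon> *\<^sub>R l 0"]
      obtain y where y: "y 0 = \<epsilon> *\<^sub>R l 0"
        "\<And>t. 0 \<le> t \<Longrightarrow> (y has_vector_derivative f (cl (y t))) (at t within {0..})"
        by auto
      have yT: "(y has_vector_derivative f (cl (y t))) (at t within {0..a})" if "0 \<le> t" for a t
        using y(2)[OF that] by (rule has_vector_derivative_within_subset) auto
      have yn: "norm (y t) \<le> K * (\<epsilon> * norm (l 0))" if t: "0 \<le> t" "t \<le> T" for t
      proof -
        have "norm (f (cl (y s))) \<le> L * norm (y s) + 0" for s
          using gL[of "y s" 0] f0 cl(2)[of 0] r by simp
        then have "(norm (y t))\<^sup>2 + 0\<^sup>2 \<le> exp ((2 * L + 1) * (t - 0)) * ((norm (y 0))\<^sup>2 + 0\<^sup>2)"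
          using t L by (intro gronwall_norm(1)[where e' = "\<lambda>s. f (cl (y s))"]) (auto intro: yT)
        also have "\<dots> \<le> K\<^sup>2 * (norm (y 0))\<^sup>2"
        proof -
          have "exp ((2 * L + 1) * (t - 0)) \<le> K" unfolding K_def using L t by simp
          also have "K \<le> K\<^sup>2" using K by (simp add: power2_eq_square)
          finally show ?thesis by (simp add: mult_right_mono)
        qed
        finally have "norm (y t) \<le> K * norm (y 0)"
          using K by (simp add: power_mult_distrib[symmetric])
        then show ?thesis using \<epsilon> by (simp add: y)
      qed
      have ycl: "cl (y t) = y t" if "0 \<le> t" "t \<le> T" for t
        using yn[OF that] small \<rho> by (intro cl) simp
      have "solves_on f y {0..T}"
        unfolding solves_on_def using yT ycl by (metis atLeastAtMost_iff)
      from dec[OF this, of T] have yd: "norm (y T) \<le> C * exp (- \<kappa> * T) * (\<epsilon> * norm (l 0))"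
        using small0 \<epsilon> T by (simp add: y)
      define e where "e t = y t - \<epsilon> *\<^sub>R l t" for t
      \<comment> \<open>\<open>e\<close> solves the linear equation up to a forcing of at most this
        size, which is \<sigma> times the bound for the orbit. The resulting error is \<epsilon>
        times a multiple of \<sigma>, so that dividing by \<epsilon> and letting \<sigma> tend to 0
        transfers \<open>C\<close> and \<open>\<kappa>\<close> unchanged.\<close>
      let ?s = "\<sigma> * (K * (\<epsilon> * norm (l 0)))"
      have "(norm (e T))\<^sup>2 + ?s\<^sup>2 \<le> exp ((2 * L + 1) * (T - 0)) * ((norm (e 0))\<^sup>2 + ?s\<^sup>2)"
      proof (rule gronwall_norm(1))
        fix t assume t: "0 \<le> t" "t \<le> T"
        show "(e has_vector_derivative f (y t) - \<epsilon> *\<^sub>R f' 0 (l t)) (at t within {0..T})"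
          unfolding e_def using yT[OF t(1), of T] ycl[OF t] l t
          by (auto intro!: derivative_eq_intros simp: solves_on_def)
        have "f (y t) - \<epsilon> *\<^sub>R f' 0 (l t) = (f (y t) - f 0 - f' 0 (y t - 0)) + A (e t)"
          by (simp add: f0 e_def A_def blinfun.diff_right blinfun.scaleR_right)
        also have "norm \<dots> \<le> \<sigma> * norm (y t - 0) + norm A * norm (e t)"
          using yn[OF t] small \<rho> ds(1)
          by (intro norm_triangle_mono ds norm_blinfun) auto
        also have "\<dots> \<le> \<sigma> * (K * (\<epsilon> * norm (l 0))) + L * norm (e t)"
          using yn[OF t] \<sigma> by (intro add_mono mult_left_mono mult_right_mono) (auto simp: L_def)
        finally show "norm (f (y t) - \<epsilon> *\<^sub>R f' 0 (l t)) \<le> L * norm (e t) + ?s" by simp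
      qed (use T L \<sigma> K \<epsilon> in auto)
      also have "e 0 = 0" by (simp add: e_def y)
      finally have "(norm (e T))\<^sup>2 \<le> K * ?s\<^sup>2"
        by (simp add: K_def) (smt (verit) zero_le_power2)
      also have "\<dots> \<le> K\<^sup>2 * ?s\<^sup>2"
        using K by (intro mult_right_mono) (auto simp: power2_eq_square)
      finally have "norm (e T) \<le> K * ?s"
        using K \<sigma> \<epsilon> by (simp only: power_mult_distrib[symmetric]) (rule power2_le_imp_le, auto)
      moreover have "\<epsilon> * norm (l T) \<le> norm (y T) + norm (e T)"
        using norm_triangle_ineq4[of "y T" "e T"] \<epsilon> by (simp add: e_def)
      ultimately have "\<epsilon> * norm (l T) \<le> \<epsilon> * (C * exp (- \<kappa> * T) * norm (l 0) + \<sigma> * (K\<^sup>2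
          * norm (l 0)))"
        using yd by (simp add: algebra_simps power2_eq_square)
      then show ?thesis using \<epsilon> by simp
    qed
    show "norm (l T) \<le> C * exp (- \<kappa> * T) * norm (l 0)"
    proof (rule field_le_epsilon)
      fix e :: real assume e: "e > 0"
      define \<sigma> where "\<sigma> = e / (K\<^sup>2 * norm (l 0) + 1)"
      have p: "K\<^sup>2 * norm (l 0) + 1 > 0" by (simp add: add_nonneg_pos)
      have "\<sigma> > 0" using e p by (simp add: \<sigma>_def)
      moreover have "\<sigma> * (K\<^sup>2 * norm (l 0)) \<le> e"
        using e p by (simp add: \<sigma>_def divide_simps)
      ultimately show "norm (l T) \<le> C * exp (- \<kappa> * T) * norm (l 0) + e"
        using bound by fastforce
    qed
  qed
qed

text \<open>Liouville's formula: the determinant \<open>q\<close> of the two solutions starting at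
  the unit vectors obeys q' = (trace A) q, so with a nonnegative trace it could not decay. If the
  determinant of \<open>A\<close> were not positive, there would be a nonnegative real eigenvalue,
  whose solution does not decay.\<close>

lemma linear_decay_imp_Hurwitz_2:
  fixes A :: "real^2^2"
  assumes C: "C > 0" "\<kappa> > 0"
    and dec: "\<And>l T. 0 \<le> T \<Longrightarrow> solves_on ((*v) A) l {0..T} \<Longrightarrow> norm (l T) \<le> C * exp (- \<kappa> * T)
        * norm (l 0)"
  shows "trace A < 0" "det A > 0"
proof -
  show "trace A < 0"
  proof (rule ccontr)
    assume tr: "\<not> trace A < 0"
    obtain L where L: "L > 0" "\<And>v. norm (A *v v) \<le> norm v * L"
      using bounded_linear.pos_bounded[OF matrix_vector_mul_bounded_linear] by metis
    have lip: "norm (A *v x - A *v y) \<le> L * norm (x - y)" for x y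
      using L(2)[of "x - y"] by (simp add: matrix_vector_mult_diff_distrib mult.commute)
    have "continuous_on ({0..} \<times> UNIV) (\<lambda>(t::real, x). A *v x)"
      unfolding case_prod_beta by (intro continuous_intros)
    note P = picard_half_line[OF this lip L(1), of 0]
    obtain u where u: "u 0 = axis 1 1" "\<And>t. 0 \<le> t
        \<Longrightarrow> (u has_vector_derivative A *v u t) (at t within {0..})"
      using P[of "axis 1 1"] by auto
    obtain v where v: "v 0 = axis 2 1" "\<And>t. 0 \<le> t
        \<Longrightarrow> (v has_vector_derivative A *v v t) (at t within {0..})"
      using P[of "axis 2 1"] by auto
    define q where "q t = u t $ 1 * v t $ 2 - u t $ 2 * v t $ 1" for t
    \<comment> \<open>At this time the decay bound 2 C^2 exp(-2 \<kappa> T) is at most 2 C^2 / (1 +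
      2 C^2), which is below 1.\<close>
    define T where "T = C\<^sup>2 / \<kappa>"
    have T: "T \<ge> 0" using C by (simp add: T_def)
    have q: "(q has_real_derivative trace A * q t) (at t within {0..})" if "0 \<le> t" for t
    proof -
      have c: "((\<lambda>t. w t $ i) has_real_derivative (A *v w t) $ i) (at t within {0..})"
        if "(w has_vector_derivative A *v w t) (at t within {0..})" for w i
        using bounded_linear.has_vector_derivative[OF bounded_linear_vec_nth that]
        by (simp add: has_real_derivative_iff_has_vector_derivative)
      show ?thesis
        unfolding q_def by (rule derivative_eq_intros c u v that refl)+
          (simp add: trace_def matrix_vector_mult_def sum_2 algebra_simps)
    qed
    have "q 0 \<le> exp (- trace A * (T - 0)) * q T"
    proof (rule gronwall_real_backward[OF T])
      show "continuous_on {0..T} q"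
        using q by (meson DERIV_continuous_on DERIV_subset atLeastAtMost_iff atLeast_iff subsetI)
      fix t assume t: "0 < t" "t < T"
      have "at t within {0..} = at t" using t
        by (intro at_within_interior) (simp add: interior_real_atLeast)
      then show "(q has_real_derivative trace A * q t) (at t)" using q[of t] t by simp
    qed simp
    moreover have "q 0 = 1" by (simp add: q_def u v axis_def)
    moreover have "exp (- trace A * (T - 0)) * q T \<le> exp (- trace A * (T - 0)) * \<bar>q T\<bar>"
      by (intro mult_left_mono) auto
    moreover have "exp (- trace A * (T - 0)) * \<bar>q T\<bar> \<le> 1 * \<bar>q T\<bar>"
      using tr T by (intro mult_right_mono) (auto simp: mult_nonneg_nonneg)
    ultimately have q1: "1 \<le> \<bar>q T\<bar>" by linarith
    have s: "solves_on ((*v) A) u {0..T}" "solves_on ((*v) A) v {0..T}"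
      unfolding solves_on_def using u(2) v(2)
      by (meson atLeastAtMost_iff atLeast_iff has_vector_derivative_within_subset subsetI)+
    define b where "b = C * exp (- \<kappa> * T)"
    have uv: "norm (u T) \<le> b" "norm (v T) \<le> b"
      using dec[OF T s(1)] dec[OF T s(2)] by (auto simp: u v b_def)
    have "\<bar>q T\<bar> \<le> \<bar>u T $ 1\<bar> * \<bar>v T $ 2\<bar> + \<bar>u T $ 2\<bar> * \<bar>v T $ 1\<bar>"
      unfolding q_def abs_mult[symmetric] by (rule abs_triangle_ineq4)
    also have "\<dots> \<le> b * b + b * b"
      using uv component_le_norm_cart[of "u T"] component_le_norm_cart[of "v T"] order_trans[OF norm_ge_zero uv(1)]
      by (intro add_mono mult_mono) (auto intro: order_trans)
    also have "\<dots> = 2 * C\<^sup>2 * exp (- (2 * \<kappa> * T))"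
      by (simp add: b_def power2_eq_square mult_exp_exp algebra_simps)
    also have "\<dots> \<le> 2 * C\<^sup>2 / (1 + 2 * \<kappa> * T)"
      using exp_ge_add_one_self[of "2 * \<kappa> * T"] C T
      by (simp add: exp_minus divide_inverse) (intro mult_left_mono le_imp_inverse_le, auto simp: add_pos_nonneg)
    also have "\<dots> = 2 * C\<^sup>2 / (1 + 2 * C\<^sup>2)" using C by (simp add: T_def)
    also have "\<dots> < 1" using C by (simp add: divide_simps add_pos_pos)
    finally show False using q1 by simp
  qed
  show "det A > 0"
  proof (rule ccontr)
    assume dt: "\<not> det A > 0"
    define s where "s = sqrt ((trace A)\<^sup>2 - 4 * det A)"
    \<comment> \<open>The larger root of the characteristic polynomial. As the determinant is not
      positive, \<open>s\<close> is at least the absolute value of the trace, so the root is real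
      and nonnegative.\<close>
    define \<mu> where "\<mu> = (trace A + s) / 2"
    have "0 \<le> (trace A)\<^sup>2 - 4 * det A" using dt zero_le_power2[of "trace A"] by linarith
    then have s2: "s\<^sup>2 = (trace A)\<^sup>2 - 4 * det A" unfolding s_def by (rule real_sqrt_pow2)
    have "\<bar>trace A\<bar> \<le> s" using dt by (simp add: s_def real_le_rsqrt)
    then have \<mu>: "\<mu> \<ge> 0" by (simp add: \<mu>_def)
    have "det (A - \<mu> *\<^sub>R mat 1) = \<mu>\<^sup>2 - trace A * \<mu> + det A"
      by (simp add: det_2 trace_def sum_2 mat_def power2_eq_square algebra_simps)
    also have "\<dots> = (s\<^sup>2 - (trace A)\<^sup>2) / 4 + det A"
      by (simp add: \<mu>_def power2_eq_square field_simps)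
    also have "\<dots> = 0" by (simp add: s2)
    finally have "\<not> invertible (A - \<mu> *\<^sub>R mat 1)"
      by (simp add: invertible_det_nz)
    then obtain v where v: "v \<noteq> 0" "(A - \<mu> *\<^sub>R mat 1) *v v = 0"
      by (auto simp: invertible_left_inverse matrix_left_invertible_ker)
    then have Av: "A *v v = \<mu> *\<^sub>R v"
      by (simp add: matrix_vector_mult_diff_rdistrib scaleR_matrix_vector_assoc[symmetric])
    \<comment> \<open>Now the decay factor is at most C / (1 + C) < 1, while the eigensolution has
      not shrunk.\<close>
    define T where "T = C / \<kappa>"
    have T: "T \<ge> 0" using C by (simp add: T_def)
    have "solves_on ((*v) A) (\<lambda>t. exp (\<mu> * t) *\<^sub>R v) {0..T}"
      unfolding solves_on_def
      by (auto intro!: derivative_eq_intros simp: matrix_vector_mult_scaleR Av)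
    from dec[OF T this] have "exp (\<mu> * T) * norm v \<le> C * exp (- \<kappa> * T) * norm v" by simp
    then have "exp (\<mu> * T) \<le> C * exp (- \<kappa> * T)" using v(1) by simp
    moreover have "1 \<le> exp (\<mu> * T)" using \<mu> T by simp
    moreover have "C * exp (- \<kappa> * T) \<le> C / (1 + \<kappa> * T)"
      using exp_ge_add_one_self[of "\<kappa> * T"] C T
      by (simp add: exp_minus divide_inverse) (intro le_imp_inverse_le, auto simp: add_pos_nonneg)
    moreover have "C / (1 + \<kappa> * T) < 1" using C by (simp add: T_def divide_simps)
    ultimately show False by linarith
  qed
qed

text \<open>By Cayley--Hamilton the matrix \<open>B = A - trace A\<close> satisfies \<open>B A = - det A\<close>. Therefore the
  equation is solved by \<open>Q = - (det A + B\<^sup>T B) / (2 trace A det A)\<close>.\<close>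
lemma Lyapunov_equation_2:
  fixes A :: "real^2^2"
  assumes tr: "trace A < 0" and dt: "det A > 0"
  obtains Q q where "transpose Q = Q" "transpose A ** Q + Q ** A = - mat 1"
    "q > 0" "\<And>y. q * (norm y)\<^sup>2 \<le> y \<bullet> (Q *v y)"
proof -
  define a b c d where "a = A$1$1" "b = A$1$2" "c = A$2$1" "d = A$2$2"
  note abcd = a_b_c_d_def
  have tr': "trace A = a + d" and dt': "det A = a * d - b * c"
    by (auto simp: trace_def sum_2 det_2 abcd)
  define k where "k = - 1 / (2 * trace A * det A)"
  have k: "k > 0" using tr dt by (simp add: k_def divide_neg_neg mult_neg_pos)
  have kk: "2 * k * trace A * det A = - 1" using tr dt by (simp add: k_def)
  define Q :: "real^2^2" where
    "Q = vector [vector [k * (det A + c\<^sup>2 + d\<^sup>2), - k * (a * c + b * d)],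
                 vector [- k * (a * c + b * d), k * (det A + a\<^sup>2 + b\<^sup>2)]]"
  show ?thesis
  proof
    show "transpose Q = Q" by (simp add: Q_def vec_eq_iff transpose_def forall_2)
    show "transpose A ** Q + Q ** A = - mat 1"
    proof -
      have "(transpose A ** Q + Q ** A) $ i $ j = 2 * k * trace A * det A * (if i
          = j then 1 else 0)" for i j
        using exhaust_2[of i] exhaust_2[of j] unfolding tr' dt'
        by (auto simp: matrix_matrix_mult_def transpose_def sum_2 Q_def abcd[symmetric] dt')
          (simp_all add: algebra_simps power2_eq_square)
      then show ?thesis by (simp add: vec_eq_iff mat_def kk)
    qed
    show "k * det A > 0" using k dt by simp
    fix y :: "real^2"
    \<comment> \<open>The last summand is \<open>k\<close> times the squared norm of B y, which is
      nonnegative; the part with \<open>det A\<close> gives the lower bound.\<close>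
    have "y \<bullet> (Q *v y) = k * det A * (norm y)\<^sup>2 + k * ((- d * y$1 + b * y$2)\<^sup>2 + (c * y$1 - a
        * y$2)\<^sup>2)"
      unfolding power2_norm_eq_inner
      by (simp add: inner_vec_def sum_2 matrix_vector_mult_def Q_def power2_eq_square algebra_simps)
    then show "k * det A * (norm y)\<^sup>2 \<le> y \<bullet> (Q *v y)" using k by simp
  qed
qed

section \<open>The unstable cone\<close>

lemma has_vector_derivative_at_of_atMost:
  assumes "(f has_vector_derivative D) (at t within {..T})" "t < (T::real)"
  shows "(f has_vector_derivative D) (at t)"
  using assms at_within_interior[of t "{..T}"] by simp

lemma transpose_inner: "(transpose A *v a) \<bullet> b = a \<bullet> (A *v b)" for A :: "real^'n^'m"
  by (simp only: transpose_matrix_vector dot_lmul_matrix)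

lemma symmetric_matrix_inner:
  fixes Q :: "real^'n^'n"
  assumes "transpose Q = Q"
  shows "(Q *v a) \<bullet> b = a \<bullet> (Q *v b)"
  using transpose_inner[of Q a b] assms by simp

lemma matrix_vector_minus_left: "(- M) *v v = - (M *v v)" for M :: "real^'n^'m"
  by (simp add: vec_eq_iff matrix_vector_mult_def sum_negf)

lemma has_real_derivative_quadratic_form:
  fixes Q :: "real^'n^'n"
  assumes "transpose Q = Q" "(y has_vector_derivative y') (at t within S)"
  shows "((\<lambda>t. y t \<bullet> (Q *v y t)) has_real_derivative 2 * ((Q *v y t) \<bullet> y')) (at t within S)"
proof -
  have "((\<lambda>t. Q *v y t) has_vector_derivative Q *v y') (at t within S)"
    using bounded_linear.has_vector_derivative[OF matrix_vector_mul_bounded_linear assms(2)] .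
  from bounded_bilinear.has_vector_derivative[OF bounded_bilinear_inner assms(2) this]
  show ?thesis
    using symmetric_matrix_inner[OF assms(1), of "y t" y']
    by (simp add: has_real_derivative_iff_has_vector_derivative inner_commute[of y'])
qed

text \<open>The coordinate \<open>D = u - X v\<close> decouples the linear system \<open>u' = A u + v\<close>, \<open>v' = - A\<^sup>T v\<close> into
  \<open>D' = A D\<close> and \<open>v' = - A\<^sup>T v\<close>. The quadratic form \<open>D \<bullet> Q D - \<eta> (v \<bullet> X v)\<close> decreases exponentially along
  perturbed orbits, so for an orbit that is bounded in the past it cannot be positive.\<close>
lemma unstable_cone:
  fixes A Q X :: "real^'n^'n"
  assumes Q: "transpose Q = Q" "transpose A ** Q + Q ** A = - mat 1"
    "q > 0" "\<And>y. q * (norm y)\<^sup>2 \<le> y \<bullet> (Q *v y)"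
  assumes X: "transpose X = X" "A ** X + X ** transpose A = - mat 1"
    "x > 0" "\<And>y. x * (norm y)\<^sup>2 \<le> y \<bullet> (X *v y)"
  obtains \<sigma> C c where "\<sigma> > 0" "C > 0" "c > 0"
    "\<And>u v u' v' T. (\<And>t. t \<le> T \<Longrightarrow> (u has_vector_derivative u' t) (at t within {..T})) \<Longrightarrow>
      (\<And>t. t \<le> T \<Longrightarrow> (v has_vector_derivative v' t) (at t within {..T})) \<Longrightarrow>
      (\<And>t. t \<le> T \<Longrightarrow> norm (u' t - (A *v u t + v t)) \<le> \<sigma> * (norm (u t) + norm (v t))) \<Longrightarrow>
      (\<And>t. t \<le> T \<Longrightarrow> norm (v' t + transpose A *v v t) \<le> \<sigma> * (norm (u t) + norm (v t))) \<Longrightarrow>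
      bounded (u ` {..T}) \<Longrightarrow> bounded (v ` {..T}) \<Longrightarrow>
      (\<forall>t\<le>T. norm (u t) \<le> C * norm (v t) \<and> norm (v t) \<le> C * norm (u t)) \<and>
      (\<forall>s t. s \<le> t \<and> t \<le> T \<longrightarrow> norm (v s) \<le> C * exp (- c * (t - s)) * norm (v t))"
proof -
  obtain nX0 where nX0: "nX0 > 0" "\<And>v. norm (X *v v) \<le> norm v * nX0"
    using bounded_linear.pos_bounded[OF matrix_vector_mul_bounded_linear] by metis
  obtain nQ where nQ: "nQ > 0" "\<And>v. norm (Q *v v) \<le> norm v * nQ"
    using bounded_linear.pos_bounded[OF matrix_vector_mul_bounded_linear] by metis
  \<comment> \<open>The maximum ensures \<open>nX / x \<ge> 1\<close>, so that this ratio may be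
    replaced by its square before a root is taken.\<close>
  define nX where "nX = max nX0 x"
  have nX: "nX > 0" "x \<le> nX" "norm (X *v v) \<le> nX * norm v" for v
    using nX0(1) mult_right_mono[of nX0 nX "norm v"] order_trans[OF nX0(2)[of v]]
    by (auto simp: nX_def mult.commute)
  have XU: "v \<bullet> (X *v v) \<le> nX * (norm v)\<^sup>2" for v
    using norm_cauchy_schwarz[of v "X *v v"] mult_left_mono[OF nX(3)[of v], of "norm v"]
    by (simp add: power2_eq_square mult.left_commute)
  have QU: "v \<bullet> (Q *v v) \<le> nQ * (norm v)\<^sup>2" for v
    using norm_cauchy_schwarz[of v "Q *v v"] mult_left_mono[OF nQ(2)[of v], of "norm v"]
    by (simp add: power2_eq_square mult_ac)
  \<comment> \<open>Chosen so that a nonpositive value of D \<bullet> Q D - \<eta> (v \<bullet> X v)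
    implies |D| \<le> (x/2) |v|, which is half of what the lower bound of \<open>X\<close> can
    spare.\<close>
  define \<eta> where "\<eta> = q * x\<^sup>2 / (4 * nX)"
  have \<eta>: "\<eta> > 0" using Q(3) X(3) nX by (simp add: \<eta>_def)
  define m where "m = (1 + nX)\<^sup>2"
  have m: "m > 0" "1 \<le> m" "(1 + nX) * (1 + nX) = m" using nX(1) mult_mono[of 1 "1 + nX" 1 "1 + nX"]
    by (auto simp: m_def power2_eq_square)
  define k where "k = 2 * m * (nQ + \<eta> * nX)"
  have k: "k > 0" using m nQ \<eta> nX by (simp add: k_def add_pos_pos)
  define k2 where "k2 = 2 * nX * m * (x / 2 + 1)"
  have k2: "k2 > 0" using nX m X(3) by (simp add: k2_def add_pos_pos)
  \<comment> \<open>With the first bound the perturbation consumes at most half of the decay - |D|^2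
    - \<eta> |v|^2 of the cone form; with the second, at most half of the growth |v|^2 of v
    \<bullet> X v inside the cone.\<close>
  define \<sigma> where "\<sigma> = min (min (1/2) (\<eta>/2) / (2 * k)) (1 / (2 * k2))"
  have \<sigma>: "\<sigma> > 0" "2 * \<sigma> * k \<le> 1/2" "2 * \<sigma> * k \<le> \<eta>/2" "\<sigma> * k2 \<le> 1/2"
  proof -
    show "\<sigma> > 0" using \<eta> k k2 by (simp add: \<sigma>_def)
    have "\<sigma> \<le> min (1/2) (\<eta>/2) / (2 * k)" by (simp add: \<sigma>_def)
    then have "2 * \<sigma> * k \<le> min (1/2) (\<eta>/2)" using k by (simp add: pos_le_divide_eq mult_ac)
    then show "2 * \<sigma> * k \<le> 1/2" "2 * \<sigma> * k \<le> \<eta>/2" by auto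
    have "\<sigma> \<le> 1 / (2 * k2)" by (simp add: \<sigma>_def)
    then show "\<sigma> * k2 \<le> 1/2" using k2 by (simp add: pos_le_divide_eq mult_ac)
  qed
  define C where "C = (x/2 + nX) + 2 / x + nX / x"
  have C: "C > 0" "x/2 + nX \<le> C" "2 / x \<le> C" "nX / x \<le> C" using nX X(3)
    by (auto simp: C_def add_pos_pos)
  \<comment> \<open>Inside the cone v \<bullet> X v grows at least at the rate 1/(2 nX); passing to
    the norm halves it.\<close>
  define c where "c = 1 / (4 * nX)"
  show ?thesis
  proof (rule that[OF \<sigma>(1) C(1), of c])
    show "c > 0" using nX by (simp add: c_def)
    fix u v u' v' :: "real \<Rightarrow> real^'n" and T :: real
    assume du: "\<And>t. t \<le> T \<Longrightarrow> (u has_vector_derivative u' t) (at t within {..T})"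
      and dv: "\<And>t. t \<le> T \<Longrightarrow> (v has_vector_derivative v' t) (at t within {..T})"
      and eu: "\<And>t. t \<le> T \<Longrightarrow> norm (u' t - (A *v u t + v t)) \<le> \<sigma> * (norm (u t) + norm (v t))"
      and ev: "\<And>t. t \<le> T \<Longrightarrow> norm (v' t + transpose A *v v t) \<le> \<sigma> * (norm (u t) + norm (v t))"
      and bu: "bounded (u ` {..T})" and bv: "bounded (v ` {..T})"
    define D where "D t = u t - X *v v t" for t
    define D' where "D' t = u' t - X *v v' t" for t
    define e2 where "e2 t = v' t + transpose A *v v t" for t
    define eD where "eD t = D' t - A *v D t" for t
    have dD: "(D has_vector_derivative D' t) (at t within {..T})" if "t \<le> T" for t
      unfolding D_def D'_def
      by (intro has_vector_derivative_diff du dv that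
          bounded_linear.has_vector_derivative[OF matrix_vector_mul_bounded_linear])
    have uD: "norm (u t) \<le> norm (D t) + nX * norm (v t)" for t
      using norm_triangle_ineq[of "D t" "X *v v t"] nX(3)[of "v t"] by (simp add: D_def)
    have uv: "norm (u t) + norm (v t) \<le> (1 + nX) * (norm (D t) + norm (v t))" for t
      using uD[of t] mult_nonneg_nonneg[OF less_imp_le[OF nX(1)] norm_ge_zero[of "D t"]]
      by (simp add: algebra_simps)
    have s0: "\<sigma> * (norm (u t) + norm (v t)) \<le> \<sigma> * ((1 + nX) * (norm (D t) + norm (v t)))" for t
      using uv \<sigma>(1) by (intro mult_left_mono) auto
    have e2: "norm (e2 t) \<le> \<sigma> * (m * (norm (D t) + norm (v t)))" if "t \<le> T" for t
    proof -
      have "norm (e2 t) \<le> \<sigma> * ((1 + nX) * (norm (D t) + norm (v t)))"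
        using ev[OF that] s0[of t] by (simp add: e2_def)
      also have "\<dots> \<le> \<sigma> * (m * (norm (D t) + norm (v t)))"
        using nX(1) \<sigma>(1)
          by (intro mult_left_mono mult_right_mono) (auto simp: m_def power2_eq_square algebra_simps)
      finally show ?thesis .
    qed
    have eD: "norm (eD t) \<le> \<sigma> * (m * (norm (D t) + norm (v t)))" if "t \<le> T" for t
    proof -
      have "A *v (X *v v t) + X *v (transpose A *v v t) = - v t"
        using arg_cong[OF X(2), of "\<lambda>M. M *v v t"]
        by (simp add: matrix_vector_mult_add_rdistrib matrix_vector_mul_assoc[symmetric] matrix_vector_minus_left
            del: transpose_matrix_vector)
      then have AX: "A *v (X *v v t) = - v t - X *v (transpose A *v v t)"
        by (simp only: eq_diff_eq)
      have "eD t = (u' t - (A *v u t + v t)) - X *v e2 t"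
        by (simp add: eD_def D'_def D_def e2_def matrix_vector_mult_diff_distrib matrix_vector_right_distrib AX
            del: transpose_matrix_vector)
      then have "norm (eD t) \<le> norm (u' t - (A *v u t + v t)) + norm (X *v e2 t)"
        by (simp add: norm_triangle_ineq4)
      also have "\<dots> \<le> \<sigma> * (norm (u t) + norm (v t)) + nX * (\<sigma> * (norm (u t) + norm (v t)))"
        using nX(1) ev[OF that]
        by (intro add_mono eu[OF that] order_trans[OF nX(3)] mult_left_mono) (auto simp: e2_def)
      also have "\<dots> = (1 + nX) * (\<sigma> * (norm (u t) + norm (v t)))" by (simp add: algebra_simps)
      also have "\<dots> \<le> (1 + nX) * (\<sigma> * ((1 + nX) * (norm (D t) + norm (v t))))"
        using nX(1) by (intro mult_left_mono s0) auto
      also have "\<dots> = \<sigma> * (m * (norm (D t) + norm (v t)))"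
        by (simp add: m(3)[symmetric] algebra_simps)
      finally show ?thesis .
    qed
    define VD where "VD t = D t \<bullet> (Q *v D t)" for t
    define Vp where "Vp t = v t \<bullet> (X *v v t)" for t
    define VD' where "VD' t = 2 * ((Q *v D t) \<bullet> D' t)" for t
    define Vp' where "Vp' t = 2 * ((X *v v t) \<bullet> v' t)" for t
    have dVD: "(VD has_real_derivative VD' t) (at t within {..T})" if "t \<le> T" for t
      unfolding VD_def VD'_def by (rule has_real_derivative_quadratic_form[OF Q(1) dD[OF that]])
    have dVp: "(Vp has_real_derivative Vp' t) (at t within {..T})" if "t \<le> T" for t
      unfolding Vp_def Vp'_def by (rule has_real_derivative_quadratic_form[OF X(1) dv[OF that]])
    have VD'le: "VD' t \<le> - (norm (D t))\<^sup>2 + 2 * nQ * m * \<sigma> * (norm (D t) + norm (v t))\<^sup>2"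
      if "t \<le> T" for t
    proof -
      have "D t \<bullet> ((transpose A ** Q + Q ** A) *v D t) = - (norm (D t))\<^sup>2"
        unfolding Q(2) by (simp add: matrix_vector_minus_left power2_norm_eq_inner)
      moreover have "D t \<bullet> (transpose A *v (Q *v D t)) = (Q *v D t) \<bullet> (A *v D t)"
        by (simp only: inner_commute[of "D t"] transpose_inner)
      moreover have "D t \<bullet> (Q *v (A *v D t)) = (Q *v D t) \<bullet> (A *v D t)"
        by (rule symmetric_matrix_inner[OF Q(1), symmetric])
      ultimately have "2 * ((Q *v D t) \<bullet> (A *v D t)) = - (norm (D t))\<^sup>2"
        by (simp add: matrix_vector_mult_add_rdistrib matrix_vector_mul_assoc[symmetric] inner_add_right
            del: transpose_matrix_vector)
      then have "VD' t = - (norm (D t))\<^sup>2 + 2 * ((Q *v D t) \<bullet> eD t)"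
        by (simp add: VD'_def eD_def inner_diff_right del: transpose_matrix_vector)
      moreover have "(Q *v D t) \<bullet> eD t \<le> (norm (D t) * nQ) * (\<sigma> * (m * (norm (D t) + norm (v t))))"
        by (rule order_trans[OF norm_cauchy_schwarz]) (intro mult_mono nQ eD that, auto simp: nQ less_imp_le)
      moreover have "(norm (D t) * nQ) * (\<sigma> * (m * (norm (D t) + norm (v t))))
        \<le> ((norm (D t) + norm (v t)) * nQ) * (\<sigma> * (m * (norm (D t) + norm (v t))))"
        using nQ \<sigma> m by (intro mult_right_mono) auto
      ultimately show ?thesis by (simp add: power2_eq_square algebra_simps)
    qed
    have Xv: "2 * ((X *v v t) \<bullet> (- (transpose A *v v t))) = (norm (v t))\<^sup>2" for t
    proof -
      have "v t \<bullet> ((A ** X + X ** transpose A) *v v t) = - (norm (v t))\<^sup>2"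
        unfolding X(2) by (simp add: matrix_vector_minus_left power2_norm_eq_inner)
      moreover have "v t \<bullet> (A *v (X *v v t)) = (X *v v t) \<bullet> (transpose A *v v t)"
        by (simp only: inner_commute[of "X *v v t"] transpose_inner)
      moreover have "v t \<bullet> (X *v (transpose A *v v t)) = (X *v v t) \<bullet> (transpose A *v v t)"
        by (rule symmetric_matrix_inner[OF X(1), symmetric])
      ultimately show ?thesis
        by (simp add: matrix_vector_mult_add_rdistrib matrix_vector_mul_assoc[symmetric] inner_add_right
            del: transpose_matrix_vector)
    qed
    have Vp'ge: "(norm (v t))\<^sup>2 - 2 * nX * norm (v t) * (\<sigma> * (m * (norm (D t) + norm (v t))))
        \<le> Vp' t" if "t \<le> T" for t
    proof -
      have "Vp' t = (norm (v t))\<^sup>2 + 2 * ((X *v v t) \<bullet> e2 t)"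
        using Xv[of t] by (simp add: Vp'_def e2_def inner_add_right del: transpose_matrix_vector)
      moreover have "- ((X *v v t) \<bullet> e2 t) \<le> (nX * norm (v t)) * (\<sigma> * (m * (norm (D t)
          + norm (v t))))"
        by (rule order_trans[OF abs_le_D2[OF Cauchy_Schwarz_ineq2]]) (intro mult_mono nX e2 that, auto simp: nX less_imp_le)
      ultimately show ?thesis by (simp add: mult_ac)
    qed
    define L where "L t = VD t - \<eta> * Vp t" for t
    have L_VD: "L t \<le> VD t" for t
      using X(4)[of "v t"] X(3) \<eta>
        by (simp add: L_def Vp_def) (meson mult_nonneg_nonneg less_imp_le order_trans zero_le_power2)
    have dL: "(L has_real_derivative VD' t - \<eta> * Vp' t) (at t within {..T})" if "t \<le> T" for t
      unfolding L_def by (intro DERIV_diff DERIV_cmult dVD dVp that)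
    have L': "VD' t - \<eta> * Vp' t \<le> - (1 / (2 * nQ)) * L t" if t: "t \<le> T" for t
    proof -
      let ?a = "norm (D t)" and ?b = "norm (v t)"
      have sq: "(?a + ?b)\<^sup>2 \<le> 2 * (?a\<^sup>2 + ?b\<^sup>2)"
        using sum_squares_bound[of ?a ?b] by (simp add: power2_eq_square algebra_simps)
      have "?b * (?a + ?b) \<le> (?a + ?b)\<^sup>2" unfolding power2_eq_square by (intro mult_right_mono) auto
      then have "(2 * \<eta> * nX * \<sigma> * m) * (?b * (?a + ?b)) \<le> (2 * \<eta> * nX * \<sigma> * m) * (?a + ?b)\<^sup>2"
        using \<eta> nX \<sigma> m by (intro mult_left_mono) auto
      moreover have "\<eta> * (?b\<^sup>2 - 2 * nX * ?b * (\<sigma> * (m * (?a + ?b)))) \<le> \<eta> * Vp' t"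
        using Vp'ge[OF t] \<eta> by (intro mult_left_mono) auto
      ultimately have 1: "VD' t - \<eta> * Vp' t \<le> - ?a\<^sup>2 - \<eta> * ?b\<^sup>2 + \<sigma> * k * (?a + ?b)\<^sup>2"
        using VD'le[OF t] by (simp add: k_def algebra_simps)
      have "\<sigma> * k * (?a + ?b)\<^sup>2 \<le> \<sigma> * k * (2 * (?a\<^sup>2 + ?b\<^sup>2))"
        using \<sigma> k by (intro mult_left_mono sq) auto
      also have "\<dots> = (2 * \<sigma> * k) * ?a\<^sup>2 + (2 * \<sigma> * k) * ?b\<^sup>2" by (simp add: algebra_simps)
      also have "\<dots> \<le> 1/2 * ?a\<^sup>2 + \<eta>/2 * ?b\<^sup>2" using \<sigma> by (intro add_mono mult_right_mono) auto
      finally have "\<sigma> * k * (?a + ?b)\<^sup>2 \<le> 1/2 * ?a\<^sup>2 + \<eta>/2 * ?b\<^sup>2" .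
      moreover have "0 \<le> \<eta>/2 * ?b\<^sup>2" using \<eta> by simp
      ultimately have "VD' t - \<eta> * Vp' t \<le> - (1/2) * ?a\<^sup>2" using 1 by simp
      also have "\<dots> \<le> - (1 / (2 * nQ)) * VD t"
        using QU[of "D t"] nQ by (simp add: VD_def divide_simps mult.commute)
      also have "\<dots> \<le> - (1 / (2 * nQ)) * L t"
        using L_VD[of t] nQ by (simp add: divide_right_mono)
      finally show ?thesis .
    qed
    obtain Bd where Bd: "Bd > 0" "\<And>t. t \<le> T \<Longrightarrow> L t \<le> Bd"
    proof -
      have "bounded (D ` {..T})"
        unfolding D_def using bounded_minus_comp[OF bu bounded_linear_image[OF bv matrix_vector_mul_bounded_linear[of X], unfolded image_image]]
        by simp
      then obtain B where B: "B > 0" "\<And>t. t \<le> T \<Longrightarrow> norm (D t) \<le> B" by (auto simp: bounded_pos)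
      have "L t \<le> nQ * B\<^sup>2 + 1" if "t \<le> T" for t
      proof -
        have "(norm (D t))\<^sup>2 \<le> B\<^sup>2" by (rule power_mono[OF B(2)[OF that] norm_ge_zero])
        then have "nQ * (norm (D t))\<^sup>2 \<le> nQ * B\<^sup>2" by (rule mult_left_mono) (use nQ(1) in simp)
        then show ?thesis using L_VD[of t] QU[of "D t"] unfolding VD_def by linarith
      qed
      then show ?thesis using that[of "nQ * B\<^sup>2 + 1"] nQ B
        by (simp add: add_pos_nonneg add_nonneg_pos)
    qed
    have at: "(f has_real_derivative y) (at t)"
      if "(f has_real_derivative y) (at t within {..T})" "t < T" for f y t
      using that at_within_interior[of t "{..T}"] by simp
    have contI: "continuous_on {s..t} f"
      if "\<And>r. r \<le> T \<Longrightarrow> (f has_real_derivative f' r) (at r within {..T})" "t \<le> T" for f f' s t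
      by (rule continuous_on_subset[OF DERIV_continuous_on[where D = f' and s = "{..T}"]]) (use that in auto)
    have L0: "L t \<le> 0" if t1: "t \<le> T" for t
    proof (rule ccontr)
      assume "\<not> L t \<le> 0"
      then have Lt: "L t > 0" by simp
      define c1 where "c1 = 1 / (2 * nQ)"
      have c1: "c1 > 0" using nQ by (simp add: c1_def)
      \<comment> \<open>A positive value would grow backward at the rate \<open>c1\<close>. At this
        time the linear lower bound 1 + c1 (t - s) of the exponential already pushes it beyond the
        bound \<open>Bd\<close>.\<close>
      define s where "s = t - Bd / (c1 * L t)"
      have s: "s \<le> t" using Bd c1 Lt by (simp add: s_def)
      have "L t \<le> exp (- c1 * (t - s)) * L s"
        using L' t1 by (intro gronwall_real[OF s, where q' = "\<lambda>t. VD' t - \<eta> * Vp' t"] contI[OF dL])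
          (auto simp: c1_def intro!: at dL)
      also have "\<dots> \<le> exp (- c1 * (t - s)) * Bd" using Bd(2)[of s] s t1
        by (intro mult_left_mono) auto
      finally have "exp (c1 * (t - s)) * L t \<le> exp (c1 * (t - s)) * (exp (- c1 * (t - s)) * Bd)"
        by (intro mult_left_mono) auto
      also have "\<dots> = Bd" by (simp only: mult.assoc[symmetric] exp_add[symmetric]) simp
      finally have "exp (c1 * (t - s)) * L t \<le> Bd" .
      moreover have "(1 + c1 * (t - s)) * L t \<le> exp (c1 * (t - s)) * L t"
        using exp_ge_add_one_self[of "c1 * (t - s)"] Lt by (intro mult_right_mono) auto
      moreover have "(1 + c1 * (t - s)) * L t = L t + Bd" using c1 Lt
        by (simp add: s_def field_simps)
      ultimately show False using Lt by simp
    qed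
    have Dv: "norm (D t) \<le> x / 2 * norm (v t)" if "t \<le> T" for t
    proof -
      have "q * (norm (D t))\<^sup>2 \<le> \<eta> * (nX * (norm (v t))\<^sup>2)"
      proof -
        have "\<eta> * (v t \<bullet> (X *v v t)) \<le> \<eta> * (nX * (norm (v t))\<^sup>2)"
          using \<eta> by (intro mult_left_mono XU) auto
        then show ?thesis using L0[OF that] Q(4)[of "D t"] unfolding L_def VD_def Vp_def by linarith
      qed
      also have "\<dots> = q * (x / 2 * norm (v t))\<^sup>2"
        using nX by (simp add: \<eta>_def power_mult_distrib power_divide)
      finally have "(norm (D t))\<^sup>2 \<le> (x / 2 * norm (v t))\<^sup>2" using Q(3) by simp
      then show ?thesis using X(3) by (auto intro: power2_le_imp_le)
    qed
    have Vp'2: "1 / (2 * nX) * Vp t \<le> Vp' t" if "t \<le> T" for t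
    proof -
      have "norm (D t) + norm (v t) \<le> (x/2 + 1) * norm (v t)" using Dv[OF that]
        by (simp add: algebra_simps)
      then have "2 * nX * norm (v t) * (\<sigma> * (m * (norm (D t) + norm (v t)))) \<le> 2 * nX * norm (v t)
          * (\<sigma> * (m * ((x/2 + 1) * norm (v t))))"
        using nX \<sigma> m by (intro mult_left_mono) auto
      also have "\<dots> = (\<sigma> * k2) * (norm (v t))\<^sup>2" by (simp add: k2_def power2_eq_square)
      also have "\<dots> \<le> 1/2 * (norm (v t))\<^sup>2" using \<sigma>(4) by (intro mult_right_mono) auto
      finally have "1/2 * (norm (v t))\<^sup>2 \<le> Vp' t" using Vp'ge[OF that] by simp
      moreover have "1 / (2 * nX) * Vp t \<le> 1/2 * (norm (v t))\<^sup>2"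
        using XU[of "v t"] nX by (simp add: Vp_def divide_simps mult.commute)
      ultimately show ?thesis by simp
    qed
    show "(\<forall>t\<le>T. norm (u t) \<le> C * norm (v t) \<and> norm (v t) \<le> C * norm (u t)) \<and>
      (\<forall>s t. s \<le> t \<and> t \<le> T \<longrightarrow> norm (v s) \<le> C * exp (- c * (t - s)) * norm (v t))"
    proof (intro conjI allI impI; (elim conjE)?)
      fix t assume t: "t \<le> T"
      have "norm (u t) \<le> (x/2 + nX) * norm (v t)" using uD[of t] Dv[OF t]
        by (simp add: algebra_simps)
      also have "\<dots> \<le> C * norm (v t)" using C by (intro mult_right_mono) auto
      finally show "norm (u t) \<le> C * norm (v t)" .
      \<comment> \<open>Since X v = u - D, positivity of \<open>X\<close> bounds |v| by |u| once the
        contribution of D, at most half of the left-hand side, is absorbed.\<close>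
      have "x * (norm (v t))\<^sup>2 \<le> v t \<bullet> (u t - D t)" using X(4)[of "v t"] by (simp add: D_def)
      also have "\<dots> \<le> norm (v t) * (norm (u t) + norm (D t))"
        by (rule order_trans[OF norm_cauchy_schwarz]) (intro mult_left_mono norm_triangle_ineq4, auto)
      also have "\<dots> \<le> norm (v t) * (norm (u t) + x / 2 * norm (v t))"
        using Dv[OF t] by (intro mult_left_mono) auto
      finally have "norm (v t) * (x / 2 * norm (v t)) \<le> norm (v t) * norm (u t)"
        by (simp add: power2_eq_square algebra_simps)
      then have "x / 2 * norm (v t) \<le> norm (u t)"
        by (cases "norm (v t) = 0") (auto dest: mult_left_le_imp_le)
      then have "norm (v t) \<le> 2 / x * norm (u t)" using X(3) by (simp add: field_simps)
      also have "\<dots> \<le> C * norm (u t)" using C by (intro mult_right_mono) auto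
      finally show "norm (v t) \<le> C * norm (u t)" .
    next
      fix s t assume st: "s \<le> t" "t \<le> T"
      have "x * (norm (v s))\<^sup>2 \<le> Vp s" using X(4) by (simp add: Vp_def)
      also have "\<dots> \<le> exp (- (2 * c) * (t - s)) * Vp t"
        using st by (intro gronwall_real_backward[where q' = Vp'] contI[OF dVp] at[OF dVp])
          (auto simp: c_def intro!: order_trans[OF _ Vp'2])
      also have "\<dots> \<le> exp (- (2 * c) * (t - s)) * (nX * (norm (v t))\<^sup>2)"
        using XU[of "v t"] by (intro mult_left_mono) (auto simp: Vp_def)
      finally have "(norm (v s))\<^sup>2 \<le> nX / x * exp (- (2 * c) * (t - s)) * (norm (v t))\<^sup>2"
        using X(3) by (simp add: field_simps)
      also have "\<dots> \<le> (nX / x)\<^sup>2 * exp (- (2 * c) * (t - s)) * (norm (v t))\<^sup>2"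
        using nX(1,2) X(3) self_le_power[of "nX / x" 2] by (intro mult_right_mono) auto
      also have "\<dots> = (nX / x * exp (- c * (t - s)) * norm (v t))\<^sup>2"
      proof -
        have "exp (- (2 * c) * (t - s)) = (exp (- c * (t - s)))\<^sup>2"
          using exp_double[of "- c * (t - s)"] by (simp add: mult_ac)
        then show ?thesis by (simp only: power_mult_distrib)
      qed
      finally have "norm (v s) \<le> nX / x * exp (- c * (t - s)) * norm (v t)"
        using nX X(3) by (auto intro: power2_le_imp_le)
      also have "\<dots> \<le> C * exp (- c * (t - s)) * norm (v t)" using C by (intro mult_right_mono) auto
      finally show "norm (v s) \<le> C * exp (- c * (t - s)) * norm (v t)" .
    qed
  qed
qed

section \<open>Variation of solutions\<close>

lemma has_vector_derivative_imp_continuous_on: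
  assumes "\<And>t. t \<in> S \<Longrightarrow> (f has_vector_derivative f' t) (at t within S)"
  shows "continuous_on S f"
  using has_vector_derivative_continuous[OF assms] by (simp add: continuous_on_eq_continuous_within)

lemma solves_on_continuous_on: "solves_on X z S \<Longrightarrow> continuous_on S z"
  by (rule has_vector_derivative_imp_continuous_on[where f' = "\<lambda>t. X (z t)"]) (simp add: solves_on_def)

lemma C1_lipschitz_cball:
  fixes f :: "'a::euclidean_space \<Rightarrow> 'b::real_normed_vector" and f' :: "'a \<Rightarrow> 'a \<Rightarrow>\<^sub>L 'b"
  assumes der: "\<And>x. (f has_derivative f' x) (at x)" and cont: "continuous_on UNIV f'"
  obtains L where "L > 0" "\<And>x. norm x \<le> r \<Longrightarrow> norm (f' x) \<le> L"
    "\<And>a b. norm a \<le> r \<Longrightarrow> norm b \<le> r \<Longrightarrow> norm (f a - f b) \<le> L * norm (a - b)"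
proof -
  have "compact (f' ` cball 0 r)"
    by (intro compact_continuous_image continuous_on_subset[OF cont]) auto
  then obtain L where L: "L > 0" "\<And>x. norm x \<le> r \<Longrightarrow> norm (f' x) \<le> L"
    by (auto dest!: compact_imp_bounded simp: bounded_pos)
  have "norm (f a - f b) \<le> L * norm (a - b)" if "norm a \<le> r" "norm b \<le> r" for a b
  proof (rule differentiable_bound[where S = "cball 0 r" and f' = "\<lambda>x. blinfun_apply (f' x)"])
    show "onorm (blinfun_apply (f' x)) \<le> L" if "x \<in> cball 0 r" for x
      using L(2)[of x] that by (simp add: norm_blinfun.rep_eq)
  qed (use that in \<open>auto intro: has_derivative_at_withinI[OF der]\<close>)
  then show ?thesis using that L by blast
qed

text \<open>Time reversal reduces the half line \<open>{..T}\<close> to the one of the Picard lemma,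
  so the solution exists on the whole past.\<close>

lemma linear_ode_backward:
  fixes A :: "real \<Rightarrow> 'a::euclidean_space \<Rightarrow>\<^sub>L 'a"
  assumes cont: "continuous_on {..T} A" and L: "L > 0" "\<And>t. t \<le> T \<Longrightarrow> norm (A t) \<le> L"
  obtains \<zeta> where "\<zeta> T = \<xi>" "\<And>t. t \<le> T \<Longrightarrow> (\<zeta> has_vector_derivative A t (\<zeta> t)) (at t within {..T})"
proof -
  have lip: "norm (- A (T - t) x - - A (T - t) y) \<le> L * norm (x - y)" if "0 \<le> t" for t x y
  proof -
    have "norm (- A (T - t) x - - A (T - t) y) = norm (A (T - t) (y - x))"
      by (simp add: blinfun.diff_right)
    also have "\<dots> \<le> norm (A (T - t)) * norm (y - x)" by (rule norm_blinfun)
    also have "\<dots> \<le> L * norm (x - y)"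
      using L(2)[of "T - t"] that by (simp add: norm_minus_commute mult_right_mono)
    finally show ?thesis .
  qed
  have "continuous_on ({0..} \<times> UNIV) (\<lambda>(t, x). - A (T - t) x)"
    unfolding case_prod_beta
    by (intro continuous_intros continuous_on_compose2[OF cont]) auto
  from picard_half_line[OF this lip L(1), of 0 \<xi>]
  obtain y where y: "y 0 = \<xi>" "\<And>t. 0 \<le> t \<Longrightarrow> (y has_vector_derivative - A (T
      - t) (y t)) (at t within {0..})"
    by auto
  show ?thesis
  proof (rule that[of "\<lambda>t. y (T - t)"])
    show "y (T - T) = \<xi>" by (simp add: y)
    fix t assume t: "t \<le> T"
    have im: "(\<lambda>t. T - t) ` {..T} = {0..}" by (auto simp: image_iff intro: exI[of _ "T - _"])
    have "((y \<circ> (\<lambda>t. T - t)) has_vector_derivative (- 1) *\<^sub>R (- A (T - (T - t)) (y (T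
        - t)))) (at t within {..T})"
    proof (rule vector_diff_chain_within)
      show "((\<lambda>t. T - t) has_vector_derivative - 1) (at t within {..T})"
        by (auto intro!: derivative_eq_intros)
      show "(y has_vector_derivative - A (T - (T - t)) (y (T - t))) (at (T - t) within (\<lambda>t. T
          - t) ` {..T})"
        unfolding im by (rule y(2)) (use t in simp)
    qed
    then show "((\<lambda>t. y (T - t)) has_vector_derivative A t (y (T - t))) (at t within {..T})"
      by (simp add: o_def)
  qed
qed

text \<open>The derivative in \<open>s\<close> is assumed at time 0 only and is carried into the
  past. On a compact interval a first Gronwall estimate bounds \<open>Z s - Z 0\<close> by a
  multiple of its value at time 0, and a second one shows that the deviation from
  \<open>s *\<^sub>R \<zeta>\<close> is of smaller order than s. Uniform convergence keeps all
  orbits in one ball, where the derivative of \<open>G\<close> is bounded.\<close>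

lemma variation_of_solutions:
  fixes G :: "'a::euclidean_space \<Rightarrow> 'a" and G' :: "'a \<Rightarrow> 'a \<Rightarrow>\<^sub>L 'a" and Z :: "real \<Rightarrow> real \<Rightarrow> 'a"
  assumes der: "\<And>x. (G has_derivative G' x) (at x)" and cont: "continuous_on UNIV G'"
    and sol: "\<And>s. solves_on G (Z s) {..0}" and unif: "uniform_limit {..0} Z (Z 0) (at 0)"
    and bdd: "bounded (Z 0 ` {..0})"
    and \<xi>: "((\<lambda>s. Z s 0) has_vector_derivative \<xi>) (at 0)"
  obtains \<zeta> where "\<zeta> 0 = \<xi>"
    "\<And>t. t \<le> 0 \<Longrightarrow> (\<zeta> has_vector_derivative G' (Z 0 t) (\<zeta> t)) (at t within {..0})"
    "\<And>t. t \<le> 0 \<Longrightarrow> ((\<lambda>s. Z s t) has_vector_derivative \<zeta> t) (at 0)"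
proof -
  obtain M where M: "\<And>t. t \<le> 0 \<Longrightarrow> norm (Z 0 t) \<le> M" using bdd by (auto simp: bounded_iff)
  obtain L where L: "L > 0" "\<And>x. norm x \<le> M + 1 \<Longrightarrow> norm (G' x) \<le> L"
    "\<And>a b. norm a \<le> M + 1 \<Longrightarrow> norm b \<le> M + 1 \<Longrightarrow> norm (G a - G b) \<le> L * norm (a - b)"
    using C1_lipschitz_cball[OF der cont] by metis
  have near: "\<exists>s0>0. \<forall>s. \<bar>s\<bar> < s0 \<longrightarrow> (\<forall>t\<le>0. norm (Z s t - Z 0 t) < d)" if "d > 0" for d
  proof -
    obtain s0 where s0: "s0 > 0" "\<And>s. s \<noteq> 0 \<Longrightarrow> \<bar>s\<bar> < s0 \<Longrightarrow> \<forall>t\<in>{..0}. dist (Z s t) (Z 0 t) < d"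
      using uniform_limitD[OF unif \<open>d > 0\<close>] unfolding eventually_at by (auto simp: dist_norm)
    have "norm (Z s t - Z 0 t) < d" if "\<bar>s\<bar> < s0" "t \<le> 0" for s t
      using s0(2)[of s] that \<open>d > 0\<close> by (cases "s = 0") (auto simp: dist_norm)
    then show ?thesis using s0(1) by blast
  qed
  obtain s1 where s1: "s1 > 0" "\<And>s t. \<bar>s\<bar> < s1 \<Longrightarrow> t \<le> 0 \<Longrightarrow> norm (Z s t - Z 0 t) < 1"
    using near[of 1] by auto
  have Zb: "norm (Z s t) \<le> M + 1" if "\<bar>s\<bar> < s1" "t \<le> 0" for s t
    using s1(2)[OF that] M[OF that(2)] norm_triangle_sub[of "Z s t" "Z 0 t"] by simp
  have Ac: "continuous_on {..0} (\<lambda>t. G' (Z 0 t))"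
    by (rule continuous_on_compose2[OF cont solves_on_continuous_on[OF sol]]) auto
  obtain \<zeta> where \<zeta>: "\<zeta> 0 = \<xi>"
    "\<And>t. t \<le> 0 \<Longrightarrow> (\<zeta> has_vector_derivative G' (Z 0 t) (\<zeta> t)) (at t within {..0})"
    using linear_ode_backward[OF Ac L(1), of \<xi>] L(2) M
      by (metis add_increasing2 zero_le_one order_trans)
  have Zd: "(Z s has_vector_derivative G (Z s r)) (at r within {t..0})" if "t \<le> r" "r \<le> 0" for s t r
    using sol[of s] that by (auto simp: solves_on_def intro: has_vector_derivative_within_subset)
  show ?thesis
  proof (rule that[OF \<zeta>])
    fix t :: real assume t: "t \<le> 0"
    define K where "K = exp ((2 * L + 1) * (0 - t))"
    have K: "K \<ge> 1" using L(1) t by (simp add: K_def mult_nonneg_nonpos)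
    have Kr: "exp ((2 * L + 1) * (0 - r)) \<le> K" if "t \<le> r" for r
      unfolding K_def using L(1) that by (simp add: mult_left_mono)
    have W: "norm (Z s r - Z 0 r) \<le> K * norm (Z s 0 - Z 0 0)"
      if s: "\<bar>s\<bar> < s1" and r: "t \<le> r" "r \<le> 0" for s r
    proof -
      have "(norm (Z s r - Z 0 r))\<^sup>2 + 0\<^sup>2 \<le> exp ((2 * L + 1) * (0 - r)) * ((norm (Z s 0
          - Z 0 0))\<^sup>2 + 0\<^sup>2)"
      proof (rule gronwall_norm(2))
        fix q assume q: "r \<le> q" "q \<le> 0"
        show "((\<lambda>r. Z s r - Z 0 r) has_vector_derivative G (Z s q)
            - G (Z 0 q)) (at q within {r..0})"
          using q by (intro has_vector_derivative_diff Zd)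
        show "norm (G (Z s q) - G (Z 0 q)) \<le> L * norm (Z s q - Z 0 q) + 0"
          using L(3) Zb[OF s q(2)] Zb[of 0 q] q s1(1) by simp
      qed (use r L in auto)
      also have "\<dots> \<le> K\<^sup>2 * ((norm (Z s 0 - Z 0 0))\<^sup>2 + 0\<^sup>2)"
      proof (rule mult_right_mono)
        have "K \<le> K\<^sup>2" using K by (simp add: self_le_power)
        then show "exp ((2 * L + 1) * (0 - r)) \<le> K\<^sup>2" using Kr[OF r(1)] by linarith
      qed simp
      finally have "(norm (Z s r - Z 0 r))\<^sup>2 \<le> (K * norm (Z s 0 - Z 0 0))\<^sup>2"
        by (simp add: power_mult_distrib)
      then show ?thesis by (rule power2_le_imp_le) (use K in simp)
    qed
    \<comment> \<open>The constant adds up the initial error and the forcing, the latter being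
      \<sigma> times the Lipschitz bound K (|\<xi>| + 1) |s| of the orbits; the outer
      \<open>K\<close> is the Gronwall factor of the second estimate.\<close>
    have est: "\<exists>d>0. \<forall>s. \<bar>s\<bar> < d \<longrightarrow> norm (Z s t - Z 0 t - s *\<^sub>R \<zeta> t) \<le> \<sigma> * \<bar>s\<bar> * (K * (1 + K
        * (norm \<xi> + 1)))"
      if \<sigma>: "\<sigma> > 0" "\<sigma> \<le> 1" for \<sigma>
    proof -
      obtain d where d: "d > 0" "\<And>a b. norm a \<le> M \<Longrightarrow> norm (b - a) < d \<Longrightarrow>
        norm (G b - G a - G' a (b - a)) \<le> \<sigma> * norm (b - a)"
        using C1_remainder_uniform[OF der cont \<sigma>(1)] by metis
      obtain s2 where s2: "s2 > 0" "\<And>s t. \<bar>s\<bar> < s2 \<Longrightarrow> t \<le> 0 \<Longrightarrow> norm (Z s t - Z 0 t) < d"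
        using near[OF d(1)] by auto
      obtain s3 where s3: "s3 > 0" "\<And>s. \<bar>s\<bar> < s3 \<Longrightarrow> norm (Z s 0 - Z 0 0 - s *\<^sub>R \<xi>) \<le> \<sigma> * \<bar>s\<bar>"
        using \<xi> \<sigma>(1) unfolding has_vector_derivative_def has_derivative_at_alt by fastforce
      have "norm (Z s t - Z 0 t - s *\<^sub>R \<zeta> t) \<le> \<sigma> * \<bar>s\<bar> * (K * (1 + K * (norm \<xi> + 1)))"
        if s: "\<bar>s\<bar> < min s1 (min s2 s3)" for s
      proof -
        have "norm (Z s 0 - Z 0 0) \<le> norm (Z s 0 - Z 0 0 - s *\<^sub>R \<xi>) + norm (s *\<^sub>R \<xi>)"
          using norm_triangle_sub[of "Z s 0 - Z 0 0" "s *\<^sub>R \<xi>"] by (simp add: add.commute)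
        also have "\<dots> \<le> 1 * \<bar>s\<bar> + \<bar>s\<bar> * norm \<xi>"
          using s3(2)[of s] s \<sigma> mult_right_mono[of \<sigma> 1 "\<bar>s\<bar>"] by simp
        finally have w0: "norm (Z s 0 - Z 0 0) \<le> (norm \<xi> + 1) * \<bar>s\<bar>" by (simp add: algebra_simps)
        have w: "norm (Z s r - Z 0 r) \<le> K * ((norm \<xi> + 1) * \<bar>s\<bar>)" if "t \<le> r" "r \<le> 0" for r
          by (rule order_trans[OF W[OF _ that] mult_left_mono[OF w0]]) (use s K in auto)
        let ?\<sigma> = "\<sigma> * (K * ((norm \<xi> + 1) * \<bar>s\<bar>))"
        let ?e = "\<lambda>r. Z s r - Z 0 r - s *\<^sub>R \<zeta> r"
        have "(norm (?e t))\<^sup>2 + ?\<sigma>\<^sup>2 \<le> exp ((2 * L + 1) * (0 - t)) * ((norm (?e 0))\<^sup>2 + ?\<sigma>\<^sup>2)"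
        proof (rule gronwall_norm(2)[where e = ?e])
          fix q assume q: "t \<le> q" "q \<le> 0"
          have "(\<zeta> has_vector_derivative G' (Z 0 q) (\<zeta> q)) (at q within {t..0})"
            using \<zeta>(2)[OF q(2)] by (rule has_vector_derivative_within_subset) auto
          then show "(?e has_vector_derivative G (Z s q) - G (Z 0 q)
              - s *\<^sub>R G' (Z 0 q) (\<zeta> q)) (at q within {t..0})"
            using q by (auto intro!: has_vector_derivative_diff Zd derivative_eq_intros)
          have "G (Z s q) - G (Z 0 q) - s *\<^sub>R G' (Z 0 q) (\<zeta> q)
            = G' (Z 0 q) (?e q) + (G (Z s q) - G (Z 0 q) - G' (Z 0 q) (Z s q - Z 0 q))"
            by (simp add: blinfun.diff_right blinfun.scaleR_right)
          also have "norm \<dots> \<le> norm (G' (Z 0 q)) * norm (?e q) + \<sigma> * norm (Z s q - Z 0 q)"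
            using s2(2)[of s q] s q M by (intro norm_triangle_mono norm_blinfun d(2)) auto
          also have "\<dots> \<le> L * norm (?e q) + ?\<sigma>"
            using L(2)[of "Z 0 q"] M[OF q(2)] w[OF q] \<sigma>
              by (intro add_mono mult_right_mono mult_left_mono) auto
          finally show "norm (G (Z s q) - G (Z 0 q) - s *\<^sub>R G' (Z 0 q) (\<zeta> q)) \<le> L * norm (?e q)
              + ?\<sigma>" .
        qed (use t L \<sigma> K in auto)
        then have "(norm (?e t))\<^sup>2 \<le> K * ((norm (?e 0))\<^sup>2 + ?\<sigma>\<^sup>2)"
          using zero_le_power2[of ?\<sigma>] unfolding K_def by linarith
        also have "\<dots> \<le> K\<^sup>2 * (norm (?e 0) + ?\<sigma>)\<^sup>2"
        proof (rule mult_mono)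
          show "K \<le> K\<^sup>2" using K by (simp add: self_le_power)
          have "0 \<le> norm (?e 0) * ?\<sigma>" using \<sigma> K by simp
          then show "(norm (?e 0))\<^sup>2 + ?\<sigma>\<^sup>2 \<le> (norm (?e 0) + ?\<sigma>)\<^sup>2" unfolding power2_sum by linarith
        qed auto
        also have "\<dots> = (K * (norm (?e 0) + ?\<sigma>))\<^sup>2" by (simp add: power_mult_distrib)
        finally have "norm (?e t) \<le> K * (norm (?e 0) + ?\<sigma>)"
          by (rule power2_le_imp_le) (use K \<sigma> in simp)
        also have "\<dots> \<le> K * (\<sigma> * \<bar>s\<bar> + ?\<sigma>)"
          using s3(2)[of s] s K by (intro mult_left_mono add_right_mono) (auto simp: \<zeta>(1))
        also have "\<dots> = \<sigma> * \<bar>s\<bar> * (K * (1 + K * (norm \<xi> + 1)))" by (simp add: algebra_simps)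
        finally show ?thesis .
      qed
      moreover have "min s1 (min s2 s3) > 0" using s1 s2 s3 by simp
      ultimately show ?thesis by blast
    qed
    show "((\<lambda>s. Z s t) has_vector_derivative \<zeta> t) (at 0)"
      unfolding has_vector_derivative_def has_derivative_at_alt
    proof (intro conjI allI impI)
      show "bounded_linear (\<lambda>x. x *\<^sub>R \<zeta> t)" by (rule bounded_linear_scaleR_left)
      fix e :: real assume e: "0 < e"
      define N where "N = K * (1 + K * (norm \<xi> + 1))"
      have N: "N > 0" using K by (simp add: N_def add_pos_nonneg)
      define \<sigma> where "\<sigma> = min 1 (e / N)"
      have \<sigma>: "\<sigma> > 0" "\<sigma> \<le> 1" using e N by (auto simp: \<sigma>_def)
      have "\<sigma> * N \<le> e" using N mult_right_mono[of \<sigma> "e / N" N] by (simp add: \<sigma>_def)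
      then have "\<sigma> * \<bar>s\<bar> * N \<le> e * \<bar>s\<bar>" for s :: real
        using mult_right_mono[of "\<sigma> * N" e "\<bar>s\<bar>"] by (simp add: mult_ac)
      then show "\<exists>d>0. \<forall>y. norm (y - 0) < d \<longrightarrow> norm (Z y t - Z 0 t - (y - 0) *\<^sub>R \<zeta> t) \<le> e * norm (y
          - 0)"
        using est[OF \<sigma>] unfolding N_def[symmetric] by (simp, meson order_trans)
    qed
  qed
qed

section \<open>Absolutely continuous paths\<close>

text \<open>The derivative is a separate argument, so that sums and products carry the derivative
  given by the calculus rules, with no differentiability at any single point to be proved. It
  matters up to null sets only.\<close>

definition ac_on :: "real \<Rightarrow> real \<Rightarrow> (real \<Rightarrow> 'a::euclidean_space) \<Rightarrow> (real \<Rightarrow> 'a) \<Rightarrow> bool" where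
  "ac_on a b u g \<longleftrightarrow> g absolutely_integrable_on {a..b} \<and>
     (\<forall>t\<in>{a..b}. integral {a..t} g = u t - u a)"

lemma ac_on_increment:
  assumes "ac_on a b u g" "a \<le> s" "s \<le> t" "t \<le> b"
  shows "g absolutely_integrable_on {s..t}" "integral {s..t} g = u t - u s"
    "norm (u t - u s) \<le> integral {s..t} (\<lambda>x. norm (g x))"
proof -
  have g: "g absolutely_integrable_on {a..b}" and I: "\<And>t. t \<in> {a..b} \<Longrightarrow> integral {a..t} g = u t
      - u a"
    using assms(1) by (auto simp: ac_on_def)
  show st: "g absolutely_integrable_on {s..t}"
    by (rule absolutely_integrable_on_subinterval[OF g]) (use assms in auto)
  have "g integrable_on {a..t}"
    by (rule integrable_on_subinterval[of _ "{a..b}"]) (use assms g in \<open>auto simp: absolutely_integrable_on_def\<close>)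
  from Henstock_Kurzweil_Integration.integral_combine[OF assms(2,3) this]
  show eq: "integral {s..t} g = u t - u s"
    using I[of s] I[of t] assms by (simp add: algebra_simps)
  have "g integrable_on {s..t}" "(\<lambda>x. norm (g x)) integrable_on {s..t}"
    using st by (auto simp: absolutely_integrable_on_def)
  then show "norm (u t - u s) \<le> integral {s..t} (\<lambda>x. norm (g x))"
    unfolding eq[symmetric] by (intro integral_norm_bound_integral) auto
qed

lemma ac_on_continuous_on:
  assumes "ac_on a b u g"
  shows "continuous_on {a..b} u"
proof -
  have "continuous_on {a..b} (\<lambda>t. u a + integral {a..t} g)"
    using assms by (intro continuous_intros indefinite_integral_continuous_1)
      (auto simp: ac_on_def absolutely_integrable_on_def)
  then show ?thesis
    by (rule continuous_on_cong[THEN iffD1, rotated 2]) (use assms in \<open>auto simp: ac_on_def\<close>)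
qed

text \<open>Steps of length at most \<open>\<delta>\<close> are chained: the triangle inequality on
  the left meets a telescoping sum on the right.\<close>

lemma increment_bound_of_local:
  fixes \<Phi> :: "real \<Rightarrow> 'a::real_normed_vector"
  assumes \<delta>: "\<delta> > 0"
    and loc: "\<And>s t. a \<le> s \<Longrightarrow> s \<le> t \<Longrightarrow> t \<le> b \<Longrightarrow> t - s \<le> \<delta> \<Longrightarrow> norm (\<Phi> t - \<Phi> s) \<le> m t - m s"
    and st: "a \<le> s" "s \<le> t" "t \<le> b"
  shows "norm (\<Phi> t - \<Phi> s) \<le> m t - m s"
proof -
  have "norm (\<Phi> t - \<Phi> s) \<le> m t - m s"
    if "t - s \<le> real n * \<delta>" "a \<le> s" "s \<le> t" "t \<le> b" for n s t
    using that
  proof (induction n arbitrary: s)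
    case 0
    then have "t = s" by simp
    then show ?case using loc[of s s] 0 \<delta> by simp
  next
    case (Suc n)
    show ?case
    proof (cases "t - s \<le> \<delta>")
      case True
      then show ?thesis using loc Suc by blast
    next
      case False
      have "norm (\<Phi> t - \<Phi> (s + \<delta>)) \<le> m t - m (s + \<delta>)"
        using Suc False \<delta> by (intro Suc.IH) (auto simp: algebra_simps)
      moreover have "norm (\<Phi> (s + \<delta>) - \<Phi> s) \<le> m (s + \<delta>) - m s"
        using Suc False \<delta> by (intro loc) auto
      moreover have "norm (\<Phi> t - \<Phi> s) \<le> norm (\<Phi> t - \<Phi> (s + \<delta>)) + norm (\<Phi> (s + \<delta>) - \<Phi> s)"
        using norm_triangle_ineq[of "\<Phi> t - \<Phi> (s + \<delta>)" "\<Phi> (s + \<delta>) - \<Phi> s"] by simp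
      ultimately show ?thesis by simp
    qed
  qed
  moreover obtain n where "t - s < real n * \<delta>" using reals_Archimedean3[OF \<delta>] by blast
  ultimately show ?thesis using st by (meson less_imp_le)
qed

text \<open>The product minus the integral of its candidate derivative is shown to be constant
  without differentiating it anywhere. Freezing the factors at the left end of a short interval
  costs at most a multiple of \<epsilon> times the integral of |g| + |h|; these bounds add up over
  the intervals, and \<epsilon> is arbitrary.\<close>

lemma ac_on_bilinear:
  fixes u :: "real \<Rightarrow> 'a::euclidean_space" and v :: "real \<Rightarrow> 'b::euclidean_space"
    and prod :: "'a \<Rightarrow> 'b \<Rightarrow> 'c::euclidean_space"
  assumes bil: "bounded_bilinear prod" and u: "ac_on a b u g" and v: "ac_on a b v h"
  shows "ac_on a b (\<lambda>t. prod (u t) (v t)) (\<lambda>t. prod (g t) (v t) + prod (u t) (h t))"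
proof (cases "a \<le> b")
  case False
  then show ?thesis by (simp add: ac_on_def)
next
  case ab: True
  interpret bounded_bilinear prod by (rule bil)
  obtain B where B: "B > 0" "\<And>x y. norm (prod x y) \<le> norm x * norm y * B"
    using pos_bounded by blast
  have uc: "continuous_on {a..b} u" and vc: "continuous_on {a..b} v"
    using u v by (auto intro: ac_on_continuous_on)
  have gi: "g absolutely_integrable_on {a..b}" and hi: "h absolutely_integrable_on {a..b}"
    using u v by (auto simp: ac_on_def)
  have bm: "(\<lambda>t. w t) \<in> borel_measurable (lebesgue_on {a..b})" if "continuous_on {a..b} w"
    for w :: "real \<Rightarrow> 'd::euclidean_space"
    using that by (intro continuous_imp_measurable_on_sets_lebesgue) auto
  have bd: "bounded (w ` {a..b})" if "continuous_on {a..b} w" for w :: "real \<Rightarrow> 'd::euclidean_space"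
    using that by (intro compact_imp_bounded compact_continuous_image) auto
  have 1: "(\<lambda>t. prod (u t) (h t)) absolutely_integrable_on {a..b}"
    by (rule absolutely_integrable_bounded_measurable_product[OF bil[folded bilinear_conv_bounded_bilinear] bm[OF uc] _ bd[OF uc] hi]) simp
  have 2: "(\<lambda>t. prod (g t) (v t)) absolutely_integrable_on {a..b}"
    using absolutely_integrable_bounded_measurable_product[OF flip[folded bilinear_conv_bounded_bilinear] bm[OF vc] _ bd[OF vc] gi] by simp
  define \<theta> where "\<theta> t = prod (g t) (v t) + prod (u t) (h t)" for t
  have \<theta>i: "\<theta> absolutely_integrable_on {a..b}"
    unfolding \<theta>_def by (rule set_integral_add(1)[OF 2 1])
  have sub: "k integrable_on {s..t}" if "k integrable_on {a..b}" "a \<le> s" "t \<le> b"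
    for k :: "real \<Rightarrow> 'd::euclidean_space" and s t
    by (rule integrable_on_subinterval[OF that(1)]) (use that in auto)
  define G where "G t = norm (g t) + norm (h t)" for t
  have Gi: "G integrable_on {a..b}"
    unfolding G_def using gi hi by (intro integrable_add) (auto simp: absolutely_integrable_on_def)
  have \<theta>sub: "\<theta> integrable_on {s..t}" and Gsub: "G integrable_on {s..t}" if "a \<le> s" "t \<le> b" for s t
    by (rule sub[OF set_lebesgue_integral_eq_integral(1)[OF \<theta>i]], use that in auto)
      (rule sub[OF Gi], use that in auto)
  define \<Phi> where "\<Phi> t = prod (u t) (v t) - integral {a..t} \<theta>" for t
  have key: "norm (\<Phi> t - \<Phi> a) \<le> 2 * B * \<epsilon> * integral {a..t} G"
    if \<epsilon>: "\<epsilon> > 0" and t: "a \<le> t" "t \<le> b" for \<epsilon> t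
  proof -
    obtain d1 where d1: "d1 > 0" "\<And>s t. s \<in> {a..b} \<Longrightarrow> t \<in> {a..b} \<Longrightarrow> dist t s < d1 \<Longrightarrow> dist (u t) (u s)
        < \<epsilon>"
      using compact_uniformly_continuous[OF uc] \<epsilon> unfolding uniformly_continuous_on_def
        by (metis compact_Icc)
    obtain d2 where d2: "d2 > 0" "\<And>s t. s \<in> {a..b} \<Longrightarrow> t \<in> {a..b} \<Longrightarrow> dist t s < d2 \<Longrightarrow> dist (v t) (v s)
        < \<epsilon>"
      using compact_uniformly_continuous[OF vc] \<epsilon> unfolding uniformly_continuous_on_def
        by (metis compact_Icc)
    define \<delta> where "\<delta> = min d1 d2 / 2"
    have \<delta>: "\<delta> > 0" using d1 d2 by (simp add: \<delta>_def)
    define m where "m t = 2 * B * \<epsilon> * integral {a..t} G" for t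
    have "norm (\<Phi> t - \<Phi> a) \<le> m t - m a"
    proof (rule increment_bound_of_local[OF \<delta> _ order_refl t])
      fix s t assume st: "a \<le> s" "s \<le> t" "t \<le> b" "t - s \<le> \<delta>"
      have us: "norm (u x - u s) \<le> \<epsilon>" and vs: "norm (v x - v s) \<le> \<epsilon>" if "x \<in> {s..t}" for x
        using d1(2)[of s x] d2(2)[of s x] d1(1) d2(1) that st
        by (auto simp: \<delta>_def dist_norm less_imp_le)
      have \<theta>st: "\<theta> integrable_on {s..t}"
        using st by (intro \<theta>sub)
      have \<theta>c: "integral {a..s} \<theta> + integral {s..t} \<theta> = integral {a..t} \<theta>"
        using st by (intro Henstock_Kurzweil_Integration.integral_combine \<theta>sub) auto
      have Gc: "integral {a..s} G + integral {s..t} G = integral {a..t} G"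
        using st by (intro Henstock_Kurzweil_Integration.integral_combine Gsub) auto
      have gst: "g integrable_on {s..t}" "(\<lambda>x. norm (g x)) integrable_on {s..t}"
        and hst: "h integrable_on {s..t}" "(\<lambda>x. norm (h x)) integrable_on {s..t}"
        using ac_on_increment(1)[OF u st(1-3)] ac_on_increment(1)[OF v st(1-3)]
        by (auto simp: absolutely_integrable_on_def)
      have e1: "integral {s..t} (\<lambda>x. prod (g x) (v s)) = prod (u t - u s) (v s)"
        using integral_linear[OF gst(1) bounded_linear_left[of "v s"]] ac_on_increment(2)[OF u st(1-3)]
        by (simp add: o_def)
      have e2: "integral {s..t} (\<lambda>x. prod (u s) (h x)) = prod (u s) (v t - v s)"
        using integral_linear[OF hst(1) bounded_linear_right[of "u s"]] ac_on_increment(2)[OF v st(1-3)]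
        by (simp add: o_def)
      have i1: "(\<lambda>x. prod (g x) (v s)) integrable_on {s..t}" and i2: "(\<lambda>x. prod (u s) (h x)) integrable_on {s..t}"
        using integrable_linear[OF gst(1) bounded_linear_left[of "v s"]]
          integrable_linear[OF hst(1) bounded_linear_right[of "u s"]] by (auto simp: o_def)
      have "\<Phi> t - \<Phi> s = prod (u t) (v t) - prod (u s) (v s) - integral {s..t} \<theta>"
        unfolding \<Phi>_def \<theta>c[symmetric] by simp
      \<comment> \<open>The increment splits into a second-order term and the increments of one
        factor with the other frozen at \<open>s\<close>; the latter are integrals, and the sum of
        their integrands is close to \<theta>.\<close>
      also have "\<dots> = prod (u t - u s) (v t - v s)
          + (integral {s..t} (\<lambda>x. prod (g x) (v s)) + integral {s..t} (\<lambda>x. prod (u s) (h x)) - integral {s..t} \<theta>)"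
        unfolding e1 e2 by (simp add: diff_left diff_right)
      also have "integral {s..t} (\<lambda>x. prod (g x) (v s)) + integral {s..t} (\<lambda>x. prod (u s) (h x))
          - integral {s..t} \<theta>
          = integral {s..t} (\<lambda>x. prod (g x) (v s) + prod (u s) (h x) - \<theta> x)"
        using i1 i2 \<theta>st by (simp add: integral_add integral_diff integrable_add)
      finally have eq: "\<Phi> t - \<Phi> s = prod (u t - u s) (v t - v s)
          + integral {s..t} (\<lambda>x. prod (g x) (v s) + prod (u s) (h x) - \<theta> x)" .
      have "norm (integral {s..t} (\<lambda>x. prod (g x) (v s) + prod (u s) (h x) - \<theta> x))
          \<le> integral {s..t} (\<lambda>x. B * \<epsilon> * G x)"
      proof (rule integral_norm_bound_integral)
        show "(\<lambda>x. prod (g x) (v s) + prod (u s) (h x) - \<theta> x) integrable_on {s..t}"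
          by (intro integrable_diff integrable_add i1 i2 \<theta>st)
        show "(\<lambda>x. B * \<epsilon> * G x) integrable_on {s..t}"
          using st by (intro integrable_on_mult_right Gsub) auto
        fix x assume x: "x \<in> {s..t}"
        have "prod (g x) (v s) + prod (u s) (h x) - \<theta> x = - (prod (g x) (v x - v s) + prod (u x
            - u s) (h x))"
          by (simp add: \<theta>_def diff_left diff_right)
        then have "norm (prod (g x) (v s) + prod (u s) (h x) - \<theta> x)
            \<le> norm (prod (g x) (v x - v s)) + norm (prod (u x - u s) (h x))"
          by (simp only: norm_minus_cancel norm_triangle_ineq)
        also have "\<dots> \<le> norm (g x) * norm (v x - v s) * B + norm (u x - u s) * norm (h x) * B"
          by (intro add_mono B)
        also have "\<dots> \<le> norm (g x) * \<epsilon> * B + \<epsilon> * norm (h x) * B"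
          using us[OF x] vs[OF x] B(1) by (intro add_mono mult_right_mono mult_left_mono) auto
        also have "\<dots> = B * \<epsilon> * G x" by (simp add: G_def algebra_simps)
        finally show "norm (prod (g x) (v s) + prod (u s) (h x) - \<theta> x) \<le> B * \<epsilon> * G x" .
      qed
      also have "\<dots> = B * \<epsilon> * integral {s..t} G" by simp
      finally have n1: "norm (integral {s..t} (\<lambda>x. prod (g x) (v s) + prod (u s) (h x) - \<theta> x)) \<le> B
          * \<epsilon> * integral {s..t} G" .
      have "norm (prod (u t - u s) (v t - v s)) \<le> norm (u t - u s) * norm (v t - v s) * B"
        by (rule B)
      also have "\<dots> \<le> \<epsilon> * integral {s..t} (\<lambda>x. norm (h x)) * B"
        using us[of t] ac_on_increment(3)[OF v st(1-3)] st B(1) \<epsilon>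
          by (intro mult_right_mono mult_mono) auto
      also have "\<dots> \<le> \<epsilon> * integral {s..t} G * B"
        using hst gst \<epsilon> B(1) Gi st unfolding G_def
        by (intro mult_right_mono mult_left_mono integral_le) (auto intro!: integrable_add)
      finally have n2: "norm (prod (u t - u s) (v t - v s)) \<le> B * \<epsilon> * integral {s..t} G"
        by (simp add: mult_ac)
      have "norm (\<Phi> t - \<Phi> s) \<le> B * \<epsilon> * integral {s..t} G + B * \<epsilon> * integral {s..t} G"
        unfolding eq using n1 n2 by (intro norm_triangle_mono)
      then show "norm (\<Phi> t - \<Phi> s) \<le> m t - m s"
        unfolding m_def Gc[symmetric] by (simp add: algebra_simps)
    qed
    then show ?thesis by (simp add: m_def)
  qed
  have const: "\<Phi> t = \<Phi> a" if t: "a \<le> t" "t \<le> b" for t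
  proof -
    have "norm (\<Phi> t - \<Phi> a) \<le> 0 + e" if "e > 0" for e
    proof -
      \<comment> \<open>The added 1 makes \<open>N\<close> positive, and \<open>key\<close> for e /
        N then gives a bound below e.\<close>
      define N where "N = 2 * B * integral {a..t} G + 1"
      have "integral {a..t} G \<ge> 0"
        using t by (intro integral_nonneg Gsub) (auto simp: G_def)
      then have N: "N > 0" using B by (simp add: N_def add_nonneg_pos)
      have "norm (\<Phi> t - \<Phi> a) \<le> 2 * B * (e / N) * integral {a..t} G"
        by (rule key) (use t that N in auto)
      also have "\<dots> = e * ((N - 1) / N)" by (simp add: N_def)
      also have "\<dots> \<le> e * 1" using that N by (intro mult_left_mono) auto
      finally show ?thesis by simp
    qed
    then have "norm (\<Phi> t - \<Phi> a) \<le> 0" by (rule field_le_epsilon)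
    then show ?thesis by simp
  qed
  have "integral {a..t} \<theta> = prod (u t) (v t) - prod (u a) (v a)" if "t \<in> {a..b}" for t
    using const[of t] that by (simp add: \<Phi>_def algebra_simps)
  then show ?thesis using \<theta>i unfolding ac_on_def \<theta>_def by blast
qed

lemma ac_on_C1:
  assumes der: "\<And>t. t \<in> {a..b} \<Longrightarrow> (u has_vector_derivative u' t) (at t within {a..b})"
    and cont: "continuous_on {a..b} u'"
  shows "ac_on a b u u'"
  unfolding ac_on_def
proof (intro conjI ballI)
  show "u' absolutely_integrable_on {a..b}" using cont
    by (rule absolutely_integrable_continuous_real)
  fix t assume t: "t \<in> {a..b}"
  have "(u' has_integral u t - u a) {a..t}"
    using t by (intro fundamental_theorem_of_calculus)
      (auto intro: has_vector_derivative_within_subset[OF der])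
  then show "integral {a..t} u' = u t - u a" by (rule integral_unique)
qed

lemma ac_on_add:
  assumes u: "ac_on a b u g" and v: "ac_on a b v h"
  shows "ac_on a b (\<lambda>t. u t + v t) (\<lambda>t. g t + h t)"
  unfolding ac_on_def
proof (intro conjI ballI)
  show "(\<lambda>t. g t + h t) absolutely_integrable_on {a..b}"
    using u v by (intro set_integral_add(1)) (auto simp: ac_on_def)
  fix t assume t: "t \<in> {a..b}"
  have "g integrable_on {a..t}" "h integrable_on {a..t}"
    using ac_on_increment(1)[OF u, of a t] ac_on_increment(1)[OF v, of a t] t
    by (auto simp: absolutely_integrable_on_def)
  then show "integral {a..t} (\<lambda>t. g t + h t) = u t + v t - (u a + v a)"
    using t u v by (simp add: integral_add ac_on_def)
qed

lemma ac_on_bounded_linear: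
  fixes f :: "'a::euclidean_space \<Rightarrow> 'b::euclidean_space"
  assumes "bounded_linear f" "ac_on a b u g"
  shows "ac_on a b (\<lambda>t. f (u t)) (\<lambda>t. f (g t))"
  unfolding ac_on_def
proof (intro conjI ballI)
  have "g absolutely_integrable_on {a..b}" using assms(2) by (simp add: ac_on_def)
  from absolutely_integrable_linear[OF this assms(1)]
  show "(\<lambda>t. f (g t)) absolutely_integrable_on {a..b}" by (simp add: o_def)
  fix t assume t: "t \<in> {a..b}"
  have "g integrable_on {a..t}"
    using assms(2) t
      by (auto simp: ac_on_def absolutely_integrable_on_def intro: integrable_on_subinterval)
  from integral_linear[OF this assms(1)] assms(2) t
  show "integral {a..t} (\<lambda>t. f (g t)) = f (u t) - f (u a)"
    by (simp add: o_def ac_on_def linear_diff[OF bounded_linear.linear[OF assms(1)]])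
qed

section \<open>The verification function\<close>

context C2_field
begin

lemma F_continuous_on: "continuous_on S F" and J_continuous_on: "continuous_on S J"
proof -
  show "continuous_on S F"
    by (rule has_derivative_continuous_on[OF has_derivative_at_withinI[OF F_der]])
  show "continuous_on S J"
    by (rule has_derivative_continuous_on[OF has_derivative_at_withinI[OF J_der]])
qed

text \<open>With \<open>W(t, y) = p \<bullet> y + y \<bullet> M y / 2\<close> the left-hand side of the conclusion is the derivative of
  \<open>W(t, \<psi> - \<phi>)\<close> along a competitor \<open>\<psi>\<close> with velocity \<open>g\<close>. After completing the square the
  strict inequality has to absorb only the Taylor error.\<close>
lemma verification_pointwise:
  fixes p :: "real \<Rightarrow> real^'n" and M M' :: "real \<Rightarrow> real^'n^'n"
  assumes sym: "\<And>t. t \<le> 0 \<Longrightarrow> transpose (M t) = M t"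
    and \<phi>r: "\<And>t. t \<le> 0 \<Longrightarrow> norm (\<phi> t) \<le> r" and pr: "\<And>t. t \<le> 0 \<Longrightarrow> norm (p t) \<le> r"
    and Mr: "\<And>t y. t \<le> 0 \<Longrightarrow> norm (M t *v y) \<le> r * norm y"
    and \<mu>: "\<mu> > 0" and r: "r > 0"
    and ineq: "\<And>t y. t \<le> 0 \<Longrightarrow> \<mu> * (norm y)\<^sup>2 \<le> - (y \<bullet> (M' t *v y)) - (norm (M t *v y))\<^sup>2
      - 2 * ((M t *v y) \<bullet> (J (\<phi> t) *v y)) - p t \<bullet> (J' (\<phi> t) y *v y)"
  obtains \<delta> where "\<delta> > 0"
    "\<And>t y g. t \<le> 0 \<Longrightarrow> norm y < \<delta> \<Longrightarrow>
      - (p t \<bullet> (J (\<phi> t) *v y)) + (p t + M t *v y) \<bullet> (g - F (\<phi> t) - p t) + (y \<bullet> (M' t *v y)) / 2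
      \<le> (norm (g - F (\<phi> t + y)))\<^sup>2 / 2 - (norm (p t))\<^sup>2 / 2"
proof -
  obtain B where B: "B > 0" "\<And>A v. norm ((A :: real^'n^'n) *v v) \<le> norm A * norm v * B"
    using bounded_bilinear.pos_bounded[OF bounded_bilinear_matrix_vector_mult] by blast
  have "compact (J' ` cball 0 r)"
    by (intro compact_continuous_image continuous_on_subset[OF J'_cont]) auto
  then obtain D where D: "D > 0" "\<And>x. norm x \<le> r \<Longrightarrow> norm (J' x) \<le> D"
    by (auto dest!: compact_imp_bounded simp: bounded_pos)
  have J'b: "norm (J' x y *v y) \<le> D * B * (norm y)\<^sup>2" if "norm x \<le> r" for x y
  proof -
    have "norm (J' x y *v y) \<le> norm (J' x y) * norm y * B" by (rule B)
    also have "\<dots> \<le> (D * norm y) * norm y * B"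
      using norm_blinfun[of "J' x" y] mult_right_mono[OF D(2)[OF that] norm_ge_zero[of y]] B
      by (intro mult_right_mono) auto
    finally show ?thesis by (simp add: power2_eq_square mult_ac)
  qed
  \<comment> \<open>The momentum is bounded by \<open>r\<close>, so its pairing with the
    second-order Taylor remainder costs at most a quarter of \<open>\<mu>\<close>. The second entry
    of \<open>\<delta>\<close> below plays the same role for the cubic term
    \<open>(N *v y) \<bullet> E\<close>.\<close>
  define \<sigma> where "\<sigma> = \<mu> / (4 * r)"
  have \<sigma>: "\<sigma> > 0" using \<mu> r by (simp add: \<sigma>_def)
  obtain d where d: "d > 0" "\<And>x y. norm x \<le> r \<Longrightarrow> norm y < d \<Longrightarrow>
      norm (F (x + y) - F x - J x *v y - (1/2) *\<^sub>R (J' x y *v y)) \<le> \<sigma> * (norm y)\<^sup>2"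
    using taylor2_uniform[OF \<sigma>] by metis
  define K where "K = D * B / 2 + \<sigma>"
  have K: "K > 0" using D B \<sigma> by (simp add: K_def add_pos_pos)
  define \<delta> where "\<delta> = min d (\<mu> / (4 * r * K))"
  show ?thesis
  proof (rule that)
    show "\<delta> > 0" using d \<mu> r K by (simp add: \<delta>_def)
    fix t :: real and y g :: "real^'n" assume t: "t \<le> 0" and y: "norm y < \<delta>"
    define x P N where "x = \<phi> t" "P = p t" "N = M t"
    note xPN = x_P_N_def
    define \<rho> where "\<rho> = F (x + y) - F x - J x *v y - (1/2) *\<^sub>R (J' x y *v y)"
    define E where "E = F (x + y) - F x - J x *v y"
    have xr: "norm x \<le> r" using \<phi>r[OF t] by (simp add: xPN)
    have \<rho>: "norm \<rho> \<le> \<sigma> * (norm y)\<^sup>2"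
      unfolding \<rho>_def using d(2)[OF xr] y by (simp add: \<delta>_def)
    have E: "norm E \<le> K * (norm y)\<^sup>2"
    proof -
      have "E = (1/2) *\<^sub>R (J' x y *v y) + \<rho>" by (simp add: E_def \<rho>_def)
      then have "norm E \<le> (1/2) * norm (J' x y *v y) + norm \<rho>"
        using norm_triangle_ineq[of "(1/2) *\<^sub>R (J' x y *v y)" \<rho>] by simp
      then show ?thesis using J'b[OF xr, of y] \<rho> by (simp add: K_def algebra_simps)
    qed
    have b1: "\<bar>P \<bullet> \<rho>\<bar> \<le> \<mu> / 4 * (norm y)\<^sup>2"
    proof -
      have "\<bar>P \<bullet> \<rho>\<bar> \<le> norm P * norm \<rho>" by (rule Cauchy_Schwarz_ineq2)
      also have "\<dots> \<le> r * (\<sigma> * (norm y)\<^sup>2)"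
        using pr[OF t] \<rho> r by (intro mult_mono) (auto simp: xPN)
      also have "\<dots> = \<mu> / 4 * (norm y)\<^sup>2" using r by (simp add: \<sigma>_def)
      finally show ?thesis .
    qed
    have b2: "\<bar>(N *v y) \<bullet> E\<bar> \<le> \<mu> / 4 * (norm y)\<^sup>2"
    proof -
      have "\<bar>(N *v y) \<bullet> E\<bar> \<le> norm (N *v y) * norm E" by (rule Cauchy_Schwarz_ineq2)
      also have "\<dots> \<le> (r * norm y) * (K * (norm y)\<^sup>2)"
        using Mr[OF t] E r by (intro mult_mono) (auto simp: xPN)
      also have "\<dots> = (r * K * norm y) * (norm y)\<^sup>2" by simp
      also have "\<dots> \<le> \<mu> / 4 * (norm y)\<^sup>2"
      proof (rule mult_right_mono)
        have "norm y \<le> \<mu> / (4 * r * K)" using y by (simp add: \<delta>_def)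
        then show "r * K * norm y \<le> \<mu> / 4" using r K by (simp add: field_simps)
      qed simp
      finally show ?thesis .
    qed
    \<comment> \<open>The residual of the competitor. The square of \<open>a - (P + N *v y)\<close>
      is the one that is completed; half of the strict inequality leaves (\<mu>/2) |y|^2, exactly
      what \<open>b1\<close> and \<open>b2\<close> use up.\<close>
    define a where "a = g - F (x + y)"
    have sq: "0 \<le> (norm (a - (P + N *v y)))\<^sup>2" by simp
    have gE: "g - F x - P = a + (J x *v y + E) - P" by (simp add: a_def E_def)
    have PE: "P \<bullet> E = (P \<bullet> (J' x y *v y)) / 2 + P \<bullet> \<rho>"
      by (simp add: E_def \<rho>_def inner_diff_right inner_scaleR_right)
    have "\<mu> * (norm y)\<^sup>2 \<le> - (y \<bullet> (M' t *v y)) - (norm (N *v y))\<^sup>2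
      - 2 * ((N *v y) \<bullet> (J x *v y)) - P \<bullet> (J' x y *v y)"
      using ineq[OF t, of y] by (simp add: xPN)
    then have "- (P \<bullet> (J x *v y)) + (P + N *v y) \<bullet> (a + (J x *v y + E) - P) + (y \<bullet> (M' t *v y)) / 2
      \<le> (norm a)\<^sup>2 / 2 - (norm P)\<^sup>2 / 2"
      using sq b1 b2 PE unfolding abs_le_iff power2_norm_eq_inner
      by (simp add: algebra_simps inner_commute)
    then show "- (p t \<bullet> (J (\<phi> t) *v y)) + (p t + M t *v y) \<bullet> (g - F (\<phi> t) - p t) + (y
        \<bullet> (M' t *v y)) / 2
      \<le> (norm (g - F (\<phi> t + y)))\<^sup>2 / 2 - (norm (p t))\<^sup>2 / 2"
      unfolding xPN[symmetric] gE a_def[symmetric] .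
  qed
qed

text \<open>The action is an extended nonnegative integral, whereas increments of paths are gauge
  integrals over compact intervals; this lemma passes from one to the other.\<close>

lemma finite_action_integrable:
  fixes \<psi> :: "real \<Rightarrow> real^'n" and k :: "real \<Rightarrow> real"
  defines "k \<equiv> \<lambda>t. (norm (vector_derivative \<psi> (at t) - F (\<psi> t)))\<^sup>2 / 2"
  assumes ac: "ac_on s t \<psi> (\<lambda>t. vector_derivative \<psi> (at t))" and t: "t \<le> 0"
    and fin: "(\<integral>\<^sup>+t\<in>{..0}. ennreal (k t) \<partial>lebesgue) < \<infinity>"
  shows "k integrable_on {s..t}"
    "integral {s..t} k \<le> enn2real (\<integral>\<^sup>+t\<in>{..0}. ennreal (k t) \<partial>lebesgue)"
proof -
  let ?g = "\<lambda>t. vector_derivative \<psi> (at t)"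
  let ?A = "\<integral>\<^sup>+t\<in>{..0}. ennreal (k t) \<partial>lebesgue"
  have "(\<lambda>x. F (\<psi> x)) \<in> borel_measurable (lebesgue_on {s..t})"
    by (intro continuous_imp_measurable_on_sets_lebesgue
        continuous_on_compose2[OF F_continuous_on[of UNIV] ac_on_continuous_on[OF ac]]) auto
  moreover have "?g \<in> borel_measurable (lebesgue_on {s..t})"
    using ac by (intro absolutely_integrable_measurable[THEN iffD1, THEN conjunct1])
      (auto simp: ac_on_def)
  ultimately have "k \<in> borel_measurable (lebesgue_on {s..t})"
    unfolding k_def by measurable
  then have meas: "(\<lambda>x. indicator {s..t} x *\<^sub>R k x) \<in> borel_measurable lebesgue"
    by (subst (asm) borel_measurable_restrict_space_iff) auto
  have le: "(\<integral>\<^sup>+x. ennreal (indicator {s..t} x *\<^sub>R k x) \<partial>lebesgue) \<le> ?A"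
    using t by (intro nn_integral_mono) (auto simp: indicator_def k_def)
  have int: "integrable lebesgue (\<lambda>x. indicator {s..t} x *\<^sub>R k x)"
    using le fin meas
      by (intro integrableI_nonneg) (auto simp: k_def indicator_def intro: le_less_trans)
  then have si: "set_integrable lebesgue {s..t} k" by (simp add: set_integrable_def)
  from set_lebesgue_integral_eq_integral[OF si]
  show "k integrable_on {s..t}" by simp
  have "ennreal (integral\<^sup>L lebesgue (\<lambda>x. indicator {s..t} x *\<^sub>R k x))
      = (\<integral>\<^sup>+x. ennreal (indicator {s..t} x *\<^sub>R k x) \<partial>lebesgue)"
    by (intro nn_integral_eq_integral[symmetric] int) (auto simp: k_def indicator_def)
  then have "ennreal (integral {s..t} k) \<le> ?A"
    using le set_lebesgue_integral_eq_integral(2)[OF si] by (simp add: set_lebesgue_integral_def)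
  also have "?A = ennreal (enn2real ?A)" using fin by (simp add: less_top)
  finally show "integral {s..t} k \<le> enn2real ?A" by (simp add: ennreal_le_iff)
qed

text \<open>Competitors need not converge to the fixed point, but if one of finite action stayed away from
  it, the Lyapunov function would have to decrease by an infinite amount.\<close>
lemma finite_action_approaches_zero:
  assumes F0: "F 0 = 0"
    and Q: "transpose Q = Q" "transpose (J 0) ** Q + Q ** J 0 = - mat 1"
      "q > 0" "\<And>y. q * (norm y)\<^sup>2 \<le> y \<bullet> (Q *v y)"
  obtains \<rho> where "\<rho> > 0"
    "\<And>\<psi> T \<eta>. (\<And>s t. s \<le> t \<Longrightarrow> t \<le> 0 \<Longrightarrow> ac_on s t \<psi> (\<lambda>t. vector_derivative \<psi> (at t))) \<Longrightarrow>
       (\<integral>\<^sup>+t\<in>{..0}. ennreal ((norm (vector_derivative \<psi> (at t) - F (\<psi> t)))\<^sup>2 / 2) \<partial>lebesgue) < \<infinity> \<Longrightarrow>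
       T \<le> 0 \<Longrightarrow> (\<And>t. t \<le> T \<Longrightarrow> norm (\<psi> t) < \<rho>) \<Longrightarrow> \<eta> > 0 \<Longrightarrow> \<exists>t\<le>T. norm (\<psi> t) < \<eta>"
proof -
  obtain n where n: "n > 0" "\<And>v. norm (Q *v v) \<le> norm v * n"
    using bounded_linear.pos_bounded[OF matrix_vector_mul_bounded_linear[of Q]] by blast
  \<comment> \<open>Under the linear flow the Lyapunov function has the rate - |y|^2. By this choice
    the nonlinearity takes at most half of it, and the residual another quarter, at the price of a
    multiple of the action density.\<close>
  define \<sigma> where "\<sigma> = 1 / (4 * n)"
  have \<sigma>: "\<sigma> > 0" using n by (simp add: \<sigma>_def)
  obtain \<rho> where \<rho>: "\<rho> > 0" "\<And>y. norm y < \<rho> \<Longrightarrow> norm (F y - J 0 *v y) \<le> \<sigma> * norm y"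
  proof -
    obtain d where d: "d > 0" "\<forall>y. norm (y - 0) < d \<longrightarrow> norm (F y - F 0 - J 0 *v (y - 0)) \<le> \<sigma>
        * norm (y - 0)"
      using has_derivative_at_alt[THEN iffD1, OF F_der, THEN conjunct2, rule_format, OF \<sigma>] by blast
    show ?thesis by (rule that[OF d(1)]) (use d(2) F0 in simp)
  qed
  show ?thesis
  proof (rule that[OF \<rho>(1)])
    fix \<psi> :: "real \<Rightarrow> real^'n" and T \<eta> :: real
    let ?g = "\<lambda>t. vector_derivative \<psi> (at t)"
    let ?k = "\<lambda>t. (norm (?g t - F (\<psi> t)))\<^sup>2 / 2"
    assume ac: "\<And>s t. s \<le> t \<Longrightarrow> t \<le> 0 \<Longrightarrow> ac_on s t \<psi> ?g"
      and fin: "(\<integral>\<^sup>+t\<in>{..0}. ennreal (?k t) \<partial>lebesgue) < \<infinity>"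
      and T: "T \<le> 0" and small: "\<And>t. t \<le> T \<Longrightarrow> norm (\<psi> t) < \<rho>" and \<eta>: "\<eta> > 0"
    let ?A = "enn2real (\<integral>\<^sup>+t\<in>{..0}. ennreal (?k t) \<partial>lebesgue)"
    show "\<exists>t\<le>T. norm (\<psi> t) < \<eta>"
    proof (rule ccontr)
      assume "\<not> (\<exists>t\<le>T. norm (\<psi> t) < \<eta>)"
      then have big: "\<eta> \<le> norm (\<psi> t)" if "t \<le> T" for t using that by (meson not_le)
      \<comment> \<open>Over this length the decrease by \<eta>^2/4 per unit time exceeds by 1 the
        maximal initial value n \<rho>^2 plus everything the action can give back.\<close>
      define s where "s = T - 4 * (n * \<rho>\<^sup>2 + 8 * n\<^sup>2 * ?A + 1) / \<eta>\<^sup>2"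
      have A0: "?A \<ge> 0" by simp
      have sT: "s \<le> T" using n \<rho> A0 \<eta> by (simp add: s_def add_nonneg_nonneg)
      have len: "\<eta>\<^sup>2 / 4 * (T - s) = n * \<rho>\<^sup>2 + 8 * n\<^sup>2 * ?A + 1"
        using \<eta> by (simp add: s_def)
      note acs = ac[OF sT T]
      have Qac: "ac_on s T (\<lambda>t. Q *v \<psi> t) (\<lambda>t. Q *v ?g t)"
        by (rule ac_on_bounded_linear[OF matrix_vector_mul_bounded_linear acs])
      note V = ac_on_bilinear[OF bounded_bilinear_inner acs Qac]
      have pt: "?g t \<bullet> (Q *v \<psi> t) + \<psi> t \<bullet> (Q *v ?g t) \<le> - \<eta>\<^sup>2 / 4 + 8 * n\<^sup>2 * ?k t"
        if t: "t \<in> {s..T}" for t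
      proof -
        define y a where "y = \<psi> t" "a = ?g t - F (\<psi> t)"
        have Qy: "norm (Q *v y) \<le> n * norm y" using n(2)[of y] by (simp add: mult.commute)
        have "y \<bullet> ((transpose (J 0) ** Q + Q ** J 0) *v y) = - (norm y)\<^sup>2"
          unfolding Q(2) by (simp add: matrix_vector_minus_left power2_norm_eq_inner)
        moreover have "y \<bullet> (transpose (J 0) *v (Q *v y)) = (Q *v y) \<bullet> (J 0 *v y)"
          by (simp only: inner_commute[of y] transpose_inner)
        moreover have "y \<bullet> (Q *v (J 0 *v y)) = (Q *v y) \<bullet> (J 0 *v y)"
          by (rule symmetric_matrix_inner[OF Q(1), symmetric])
        ultimately have AQ: "2 * ((Q *v y) \<bullet> (J 0 *v y)) = - (norm y)\<^sup>2"
          by (simp add: matrix_vector_mult_add_rdistrib matrix_vector_mul_assoc[symmetric] inner_add_right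
              del: transpose_matrix_vector)
        have "norm y < \<rho>" using small t by (simp add: y_a_def)
        then have "norm (Q *v y) * norm (F y - J 0 *v y) \<le> (n * norm y) * (\<sigma> * norm y)"
          using n(1) by (intro mult_mono Qy \<rho>(2)) auto
        then have e1: "(Q *v y) \<bullet> (F y - J 0 *v y) \<le> (norm y)\<^sup>2 / 4"
          using norm_cauchy_schwarz[of "Q *v y" "F y - J 0 *v y"] n(1)
          by (simp add: \<sigma>_def power2_eq_square)
        have "(Q *v y) \<bullet> a \<le> (n * norm y) * norm a"
          using norm_cauchy_schwarz[of "Q *v y" a] mult_right_mono[OF Qy norm_ge_zero[of a]]
            by linarith
        also have "\<dots> \<le> (norm y)\<^sup>2 / 8 + 2 * n\<^sup>2 * (norm a)\<^sup>2"
          using sum_squares_bound[of "norm y / 2" "2 * n * norm a"]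
          by (simp add: power2_eq_square algebra_simps)
        finally have e2: "(Q *v y) \<bullet> a \<le> (norm y)\<^sup>2 / 8 + 2 * n\<^sup>2 * (norm a)\<^sup>2" .
        have "?g t \<bullet> (Q *v \<psi> t) + \<psi> t \<bullet> (Q *v ?g t) = 2 * ((Q *v y) \<bullet> ?g t)"
          using symmetric_matrix_inner[OF Q(1), of y "?g t"] by (simp add: y_a_def inner_commute)
        also have "?g t = J 0 *v y + (F y - J 0 *v y) + a" by (simp add: y_a_def)
        also have "2 * ((Q *v y) \<bullet> (J 0 *v y + (F y - J 0 *v y) + a))
            = 2 * ((Q *v y) \<bullet> (J 0 *v y)) + 2 * ((Q *v y) \<bullet> (F y - J 0 *v y)) + 2 * ((Q *v y) \<bullet> a)"
          by (simp only: inner_add_right distrib_left)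
        also have "\<dots> \<le> - (norm y)\<^sup>2 / 4 + 4 * n\<^sup>2 * (norm a)\<^sup>2" using AQ e1 e2 by simp
        also have "\<dots> \<le> - \<eta>\<^sup>2 / 4 + 4 * n\<^sup>2 * (norm a)\<^sup>2"
        proof -
          have "\<eta>\<^sup>2 \<le> (norm y)\<^sup>2" using big[of t] t \<eta> by (intro power_mono) (auto simp: y_a_def)
          then show ?thesis by simp
        qed
        finally show ?thesis by (simp add: y_a_def)
      qed
      have ki: "?k integrable_on {s..T}" "integral {s..T} ?k \<le> ?A"
        by (rule finite_action_integrable[OF acs T fin])+
      have "\<psi> T \<bullet> (Q *v \<psi> T) - \<psi> s \<bullet> (Q *v \<psi> s) = integral {s..T} (\<lambda>t. ?g t \<bullet> (Q *v \<psi> t) + \<psi> t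
          \<bullet> (Q *v ?g t))"
        using ac_on_increment(2)[OF V order_refl sT order_refl] by simp
      also have "\<dots> \<le> integral {s..T} (\<lambda>t. - \<eta>\<^sup>2 / 4 + 8 * n\<^sup>2 * ?k t)"
      proof (rule integral_le[OF _ _ pt])
        show "(\<lambda>t. ?g t \<bullet> (Q *v \<psi> t) + \<psi> t \<bullet> (Q *v ?g t)) integrable_on {s..T}"
          using V by (simp add: ac_on_def absolutely_integrable_on_def)
        show "(\<lambda>t. - \<eta>\<^sup>2 / 4 + 8 * n\<^sup>2 * ?k t) integrable_on {s..T}"
          by (intro integrable_add integrable_on_mult_right ki) auto
      qed
      also have "\<dots> = - \<eta>\<^sup>2 / 4 * (T - s) + 8 * n\<^sup>2 * integral {s..T} ?k"
        using sT ki by (subst integral_add) (auto intro: integrable_on_mult_right)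
      also have "\<dots> \<le> - \<eta>\<^sup>2 / 4 * (T - s) + 8 * n\<^sup>2 * ?A"
        by (intro add_left_mono mult_left_mono ki) auto
      also have "\<dots> = - n * \<rho>\<^sup>2 - 1" using len by linarith
      finally have "\<psi> T \<bullet> (Q *v \<psi> T) - \<psi> s \<bullet> (Q *v \<psi> s) \<le> - n * \<rho>\<^sup>2 - 1" .
      moreover have "0 \<le> \<psi> T \<bullet> (Q *v \<psi> T)"
        by (rule order_trans[OF _ Q(4)]) (use Q(3) in simp)
      moreover have "\<psi> s \<bullet> (Q *v \<psi> s) \<le> n * \<rho>\<^sup>2"
      proof -
        have "\<psi> s \<bullet> (Q *v \<psi> s) \<le> norm (\<psi> s) * (norm (\<psi> s) * n)"
          by (rule order_trans[OF norm_cauchy_schwarz]) (intro mult_left_mono n norm_ge_zero)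
        also have "\<dots> \<le> \<rho> * (\<rho> * n)"
          using small[OF sT] n \<rho> by (intro mult_mono mult_right_mono) auto
        finally show ?thesis by (simp add: power2_eq_square mult_ac)
      qed
      ultimately show False by simp
    qed
  qed
qed

end

section \<open>From the pointwise inequality to local minimality on the half line\<close>

lemma ac_on_spike:
  assumes "ac_on a b u g" "negligible N" "\<And>t. t \<in> {a..b} - N \<Longrightarrow> h t = g t"
  shows "ac_on a b u h"
proof -
  have g: "g absolutely_integrable_on {a..b}" using assms(1) by (simp add: ac_on_def)
  have "h integrable_on {a..b}" "(\<lambda>t. norm (h t)) integrable_on {a..b}"
    using g assms by (auto simp: absolutely_integrable_on_def intro: integrable_spike[OF _ assms(2)])
  moreover have "integral {a..t} h = integral {a..t} g" if "t \<in> {a..b}" for t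
    using that assms(3) by (intro integral_spike[OF assms(2)]) auto
  ultimately show ?thesis
    using assms(1) by (simp add: ac_on_def absolutely_integrable_on_def)
qed

lemma ac_path_imp_ac_on:
  assumes "ac_path \<psi>" "b \<le> 0"
  shows "ac_on a b \<psi> (\<lambda>t. vector_derivative \<psi> (at t))"
proof (cases "a \<le> b")
  case True
  then show ?thesis using assms unfolding ac_path_def ac_on_def by auto
qed (simp add: ac_on_def)

text \<open>Monotone convergence along the intervals [-n, 0]. The time 0 is discarded as a null set,
  because the two-sided derivative there depends on values at positive times.\<close>

lemma action_le_of_truncated_le:
  fixes \<phi> p :: "real \<Rightarrow> real^2"
  assumes d\<phi>: "\<And>t. t < 0 \<Longrightarrow> vector_derivative \<phi> (at t) = F (\<phi> t) + p t"
    and cont: "continuous_on {..0} p" and A: "0 \<le> A"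
    and le: "\<And>n::nat. integral {- real n..0} (\<lambda>t. (norm (p t))\<^sup>2 / 2) \<le> A"
  shows "action F \<phi> \<le> ennreal A"
proof -
  let ?q = "\<lambda>t. (norm (p t))\<^sup>2 / 2"
  let ?f = "\<lambda>n::nat. \<lambda>t. ennreal (?q t) * indicator {- real n..0} t"
  have qc: "continuous_on {- real n..0} ?q" for n
    by (intro continuous_intros continuous_on_subset[OF cont]) auto
  have "action F \<phi> = (\<integral>\<^sup>+t. ennreal ((norm (vector_derivative \<phi> (at t) - F (\<phi> t)))\<^sup>2 / 2)
      * indicator {..0} t \<partial>lborel)"
    unfolding action_def by (rule nn_integral_completion)
  also have "\<dots> = (\<integral>\<^sup>+t. ennreal (?q t) * indicator {..0} t \<partial>lborel)"
  proof (rule nn_integral_cong_AE)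
    have "AE t in lborel. t \<noteq> (0::real)" by (rule AE_lborel_singleton)
    then show "AE t in lborel. ennreal ((norm (vector_derivative \<phi> (at t) - F (\<phi> t)))\<^sup>2 / 2)
        * indicator {..0} t
        = ennreal (?q t) * indicator {..0} t"
      by eventually_elim (auto simp: indicator_def d\<phi> order_le_less)
  qed
  also have "\<dots> = (\<integral>\<^sup>+t. (SUP n. ?f n t) \<partial>lborel)"
  proof (intro nn_integral_cong)
    fix t :: real
    show "ennreal (?q t) * indicator {..0} t = (SUP n. ?f n t)"
    proof (rule antisym)
      obtain n :: nat where "- t \<le> real n" using real_arch_simple by blast
      then have "ennreal (?q t) * indicator {..0} t \<le> ?f n t" by (auto simp: indicator_def)
      also have "\<dots> \<le> (SUP n. ?f n t)" by (rule SUP_upper) simp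
      finally show "ennreal (?q t) * indicator {..0} t \<le> (SUP n. ?f n t)" .
      show "(SUP n. ?f n t) \<le> ennreal (?q t) * indicator {..0} t"
        by (intro SUP_least mult_left_mono) (auto simp: indicator_def)
    qed
  qed
  also have "\<dots> = (SUP n. integral\<^sup>N lborel (?f n))"
  proof (rule nn_integral_monotone_convergence_SUP)
    show "incseq ?f"
      by (auto simp: incseq_def le_fun_def indicator_def)
    fix n
    have "(\<lambda>t. indicator {- real n..0} t *\<^sub>R ?q t) \<in> borel_measurable borel"
      by (rule borel_measurable_continuous_on_indicator[OF _ qc]) simp
    then have m: "(\<lambda>t. ennreal (indicator {- real n..0} t *\<^sub>R ?q t)) \<in> borel_measurable borel"
      by measurable
    have eq: "?f n = (\<lambda>t. ennreal (indicator {- real n..0} t *\<^sub>R ?q t))"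
      by (auto simp: indicator_def fun_eq_iff)
    show "?f n \<in> borel_measurable lborel" unfolding eq using m by simp
  qed
  also have "\<dots> \<le> ennreal A"
  proof (rule SUP_least)
    fix n
    have "(?q has_integral integral {- real n..0} ?q) {- real n..0}"
      by (intro integrable_integral integrable_continuous_interval qc)
    then have "integral\<^sup>N lborel (?f n) = ennreal (integral {- real n..0} ?q)"
      by (intro nn_integral_has_integral_lebesgue') auto
    also have "\<dots> \<le> ennreal A" by (intro ennreal_leI le)
    finally show "integral\<^sup>N lborel (?f n) \<le> ennreal A" .
  qed
  finally show ?thesis .
qed

text \<open>The verification function vanishes at time 0 because the end points agree. At the other
  end there are only arbitrarily early times T at which it is small, so the inequality is integrated
  over [T, 0], and truncated actions of the trajectory are compared with the full action of the
  competitor.\<close>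

lemma strict_Riccati_local_minimizer:
  fixes F :: "real^2 \<Rightarrow> real^2" and \<phi> p :: "real \<Rightarrow> real^2" and M M' :: "real \<Rightarrow> real^2^2"
  assumes field: "C2_field F J J'" and F0: "F 0 = 0"
    and Q: "transpose Q = Q" "transpose (J 0) ** Q + Q ** J 0 = - mat 1"
      "q > 0" "\<And>y. q * (norm y)\<^sup>2 \<le> y \<bullet> (Q *v y)"
    and d\<phi>: "\<And>t. t \<le> 0 \<Longrightarrow> (\<phi> has_vector_derivative F (\<phi> t) + p t) (at t within {..0})"
    and dp: "\<And>t. t \<le> 0 \<Longrightarrow> (p has_vector_derivative
        - (transpose (J (\<phi> t)) *v p t)) (at t within {..0})"
    and dM: "\<And>t. t \<le> 0 \<Longrightarrow> (M has_vector_derivative M' t) (at t within {..0})"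
    and M'c: "continuous_on {..0} M'"
    and sym: "\<And>t. t \<le> 0 \<Longrightarrow> transpose (M t) = M t"
    and \<phi>r: "\<And>t. t \<le> 0 \<Longrightarrow> norm (\<phi> t) \<le> r" and pr: "\<And>t. t \<le> 0 \<Longrightarrow> norm (p t) \<le> r"
    and Mr: "\<And>t y. t \<le> 0 \<Longrightarrow> norm (M t *v y) \<le> r * norm y"
    and \<mu>: "\<mu> > 0" and r: "r > 0"
    and ineq: "\<And>t y. t \<le> 0 \<Longrightarrow> \<mu> * (norm y)\<^sup>2 \<le> - (y \<bullet> (M' t *v y)) - (norm (M t *v y))\<^sup>2
      - 2 * ((M t *v y) \<bullet> (J (\<phi> t) *v y)) - p t \<bullet> (J' (\<phi> t) y *v y)"
    and lim: "(\<phi> \<longlongrightarrow> 0) at_bot"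
  shows "local_minimizer F \<phi>"
proof -
  interpret C2_field F J J' by (rule field)
  obtain \<delta>1 where \<delta>1: "\<delta>1 > 0" "\<And>t y g. t \<le> 0 \<Longrightarrow> norm y < \<delta>1 \<Longrightarrow>
      - (p t \<bullet> (J (\<phi> t) *v y)) + (p t + M t *v y) \<bullet> (g - F (\<phi> t) - p t) + (y \<bullet> (M' t *v y)) / 2
      \<le> (norm (g - F (\<phi> t + y)))\<^sup>2 / 2 - (norm (p t))\<^sup>2 / 2"
    using verification_pointwise[where \<phi> = \<phi> and p = p and M = M and M' = M', OF sym \<phi>r pr Mr \<mu> r ineq] by metis
  obtain \<rho> where \<rho>: "\<rho> > 0"
    "\<And>\<psi> T \<eta>. (\<And>s t. s \<le> t \<Longrightarrow> t \<le> 0 \<Longrightarrow> ac_on s t \<psi> (\<lambda>t. vector_derivative \<psi> (at t))) \<Longrightarrow>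
       (\<integral>\<^sup>+t\<in>{..0}. ennreal ((norm (vector_derivative \<psi> (at t) - F (\<psi> t)))\<^sup>2 / 2) \<partial>lebesgue) < \<infinity> \<Longrightarrow>
       T \<le> 0 \<Longrightarrow> (\<And>t. t \<le> T \<Longrightarrow> norm (\<psi> t) < \<rho>) \<Longrightarrow> \<eta> > 0 \<Longrightarrow> \<exists>t\<le>T. norm (\<psi> t) < \<eta>"
    using finite_action_approaches_zero[OF F0 Q] by blast
  have \<phi>small: "\<exists>T\<le>0. \<forall>t\<le>T. norm (\<phi> t) < e" if "e > 0" for e
  proof -
    have "eventually (\<lambda>t. norm (\<phi> t) < e) at_bot"
      using tendstoD[OF lim that] by (simp add: dist_norm)
    then obtain T where "\<forall>t\<le>T. norm (\<phi> t) < e" by (auto simp: eventually_at_bot_linorder)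
    then show ?thesis by (intro exI[of _ "min T 0"]) auto
  qed
  have \<phi>c: "continuous_on {..0} \<phi>" and pc: "continuous_on {..0} p"
    by (rule has_vector_derivative_imp_continuous_on[OF d\<phi>], simp)
      (rule has_vector_derivative_imp_continuous_on[OF dp], simp)
  have sub: "(f has_vector_derivative f' t) (at t within {s..b})"
    if "\<And>t. t \<le> 0 \<Longrightarrow> (f has_vector_derivative f' t) (at t within {..0})" "b \<le> 0" "t \<in> {s..b}"
    for f :: "real \<Rightarrow> 'b::real_normed_vector" and f' s b t
    by (rule has_vector_derivative_within_subset[OF that(1)]) (use that in auto)
  let ?\<phi>' = "\<lambda>t. F (\<phi> t) + p t"
  have Jc: "continuous_on {..0} (\<lambda>t. J (\<phi> t))" and Fc: "continuous_on {..0} (\<lambda>t. F (\<phi> t))"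
    by (rule continuous_on_compose2[OF J_continuous_on[of UNIV] \<phi>c], simp)
      (rule continuous_on_compose2[OF F_continuous_on[of UNIV] \<phi>c], simp)
  have transc: "continuous_on {..0} (\<lambda>t. transpose (J (\<phi> t)) *v p t)"
    unfolding transpose_matrix_vector by (intro continuous_intros Jc pc)
  have \<phi>ac: "ac_on s b \<phi> ?\<phi>'" if "b \<le> 0" for s b
  proof (rule ac_on_C1)
    show "(\<phi> has_vector_derivative ?\<phi>' t) (at t within {s..b})" if "t \<in> {s..b}" for t
      using sub[OF d\<phi> \<open>b \<le> 0\<close> that] .
    show "continuous_on {s..b} ?\<phi>'"
      by (rule continuous_on_subset[of "{..0}"]) (use that in \<open>auto intro!: continuous_intros Fc pc\<close>)
  qed
  have pac: "ac_on s 0 p (\<lambda>t. - (transpose (J (\<phi> t)) *v p t))" for s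
  proof (rule ac_on_C1)
    show "(p has_vector_derivative - (transpose (J (\<phi> t)) *v p t)) (at t within {s..0})"
      if "t \<in> {s..0}" for t
      using sub[OF dp order_refl that] .
    show "continuous_on {s..0} (\<lambda>t. - (transpose (J (\<phi> t)) *v p t))"
      by (intro continuous_on_minus continuous_on_subset[OF transc]) auto
  qed
  have Mac: "ac_on s 0 M M'" for s
  proof (rule ac_on_C1)
    show "(M has_vector_derivative M' t) (at t within {s..0})" if "t \<in> {s..0}" for t
      using sub[OF dM order_refl that] .
    show "continuous_on {s..0} M'" by (rule continuous_on_subset[OF M'c]) auto
  qed
  have vd: "vector_derivative \<phi> (at t) = ?\<phi>' t" if "t < 0" for t
    using has_vector_derivative_at_of_atMost[OF d\<phi> that] that by (intro vector_derivative_at) auto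
  have "ac_path \<phi>"
    unfolding ac_path_def
  proof (intro allI impI)
    fix a b :: real assume ab: "a \<le> b \<and> b \<le> 0"
    \<comment> \<open>The exceptional point is 0, where the two-sided derivative is not determined
      by the path on the past.\<close>
    have "ac_on a b \<phi> (\<lambda>t. vector_derivative \<phi> (at t))"
      by (rule ac_on_spike[OF \<phi>ac, where N = "{0}"]) (use ab vd in auto)
    then show "(\<lambda>t. vector_derivative \<phi> (at t)) absolutely_integrable_on {a..b} \<and>
        integral {a..b} (\<lambda>t. vector_derivative \<phi> (at t)) = \<phi> b - \<phi> a"
      using ab by (simp add: ac_on_def)
  qed
  \<comment> \<open>The bound \<open>\<delta>1\<close> serves the pointwise inequality. The bound
    \<rho>/2 keeps the competitor within \<rho> of the origin at early times, where the trajectory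
    is itself within \<rho>/2.\<close>
  moreover have "action F \<phi> \<le> action F \<psi>"
    if ac: "ac_path \<psi>" and end0: "\<psi> 0 = \<phi> 0" and close: "\<forall>t\<le>0. dist (\<psi> t) (\<phi> t) < min \<delta>1 (\<rho> / 2)"
      for \<psi>
  proof (cases "action F \<psi> = \<infinity>")
    case False
    let ?g = "\<lambda>t. vector_derivative \<psi> (at t)"
    let ?k = "\<lambda>t. (norm (?g t - F (\<psi> t)))\<^sup>2 / 2"
    let ?q = "\<lambda>t. (norm (p t))\<^sup>2 / 2"
    define A where "A = enn2real (action F \<psi>)"
    have A: "ennreal A = action F \<psi>" "0 \<le> A" using False by (auto simp: A_def less_top)
    have fin: "(\<integral>\<^sup>+t\<in>{..0}. ennreal (?k t) \<partial>lebesgue) < \<infinity>"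
      using False by (simp add: action_def less_top)
    note \<psi>ac = ac_path_imp_ac_on[OF ac]
    define y where "y t = \<psi> t + - \<phi> t" for t
    define y' where "y' t = ?g t + - ?\<phi>' t" for t
    have ysmall: "norm (y t) < \<delta>1" "norm (y t) < \<rho> / 2" if "t \<le> 0" for t
      using close that by (auto simp: y_def dist_norm)
    have qi: "?q integrable_on {s..t}" if "t \<le> 0" for s t
      by (intro integrable_continuous_interval continuous_intros continuous_on_subset[OF pc]) (use that in auto)
    have main: "integral {T..0} ?q \<le> A + r * norm (y T) + r * (norm (y T))\<^sup>2 / 2" if T: "T \<le> 0"
      for T
    proof -
      have yac: "ac_on T 0 y y'"
        unfolding y_def y'_def
        by (intro ac_on_add \<psi>ac ac_on_bounded_linear[of uminus] \<phi>ac bounded_linear_minus bounded_linear_ident order_refl)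
      note Myac = ac_on_bilinear[OF bounded_bilinear_matrix_vector_mult Mac yac]
      note half = bounded_linear_mult_right[of "1/2 :: real"]
      \<comment> \<open>The product rule for p \<bullet> y + y \<bullet> M y / 2, the verification
        function along the competitor, in the form that absolute continuity of the competitor
        permits.\<close>
      note \<Theta> = ac_on_add[OF ac_on_bilinear[OF bounded_bilinear_inner pac yac]
          ac_on_bounded_linear[OF half ac_on_bilinear[OF bounded_bilinear_inner yac Myac]]]
      let ?\<Theta> = "\<lambda>t. p t \<bullet> y t + 1/2 * (y t \<bullet> (M t *v y t))"
      let ?\<theta> = "\<lambda>t. - (transpose (J (\<phi> t)) *v p t) \<bullet> y t + p t \<bullet> y' t
          + 1/2 * (y' t \<bullet> (M t *v y t) + y t \<bullet> (M' t *v y t + M t *v y' t))"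
      have k: "?k integrable_on {T..0}" "integral {T..0} ?k \<le> A"
        unfolding A_def action_def by (rule finite_action_integrable[OF \<psi>ac order_refl fin], simp)+
      have pt: "?\<theta> t \<le> ?k t - ?q t" if t: "t \<in> {T..0}" for t
      proof -
        have t0: "t \<le> 0" using t by simp
        have a: "\<phi> t + y t = \<psi> t" "?g t - F (\<phi> t) - p t = y' t" by (simp_all add: y_def y'_def)
        have "y t \<bullet> (M t *v y' t) = y' t \<bullet> (M t *v y t)"
          using symmetric_matrix_inner[OF sym[OF t0], of "y t" "y' t"] by (simp add: inner_commute)
        then have "?\<theta> t = - (p t \<bullet> (J (\<phi> t) *v y t)) + (p t + M t *v y t) \<bullet> y' t + (y t
            \<bullet> (M' t *v y t)) / 2"
          by (simp add: transpose_inner inner_add_right inner_add_left inner_commute[of "y' t"] del: transpose_matrix_vector)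
        also have "\<dots> \<le> ?k t - ?q t"
          using \<delta>1(2)[OF t0 ysmall(1)[OF t0], of "?g t"] unfolding a .
        finally show ?thesis .
      qed
      have "?\<Theta> 0 - ?\<Theta> T = integral {T..0} ?\<theta>"
        using ac_on_increment(2)[OF \<Theta> order_refl T order_refl] by simp
      also have "\<dots> \<le> integral {T..0} (\<lambda>t. ?k t - ?q t)"
        using \<Theta> by (intro integral_le[OF _ _ pt] integrable_diff k qi)
          (auto simp: ac_on_def absolutely_integrable_on_def)
      also have "\<dots> = integral {T..0} ?k - integral {T..0} ?q" by (intro integral_diff k qi) simp
      finally have "integral {T..0} ?q \<le> A + ?\<Theta> T - ?\<Theta> 0" using k(2) by simp
      moreover have "?\<Theta> 0 = 0" by (simp add: y_def end0)
      moreover have "p T \<bullet> y T \<le> r * norm (y T)"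
        by (rule order_trans[OF norm_cauchy_schwarz]) (intro mult_right_mono pr T norm_ge_zero)
      moreover have "y T \<bullet> (M T *v y T) \<le> r * (norm (y T))\<^sup>2"
      proof -
        have "y T \<bullet> (M T *v y T) \<le> norm (y T) * (r * norm (y T))"
          by (rule order_trans[OF norm_cauchy_schwarz]) (intro mult_left_mono Mr T norm_ge_zero)
        then show ?thesis by (simp add: power2_eq_square mult_ac)
      qed
      ultimately show ?thesis by simp
    qed
    have "action F \<phi> \<le> ennreal A"
    proof (rule action_le_of_truncated_le[OF vd pc A(2)])
      fix n :: nat
      show "integral {- real n..0} ?q \<le> A"
      proof (rule field_le_epsilon)
        fix e :: real assume e: "e > 0"
        \<comment> \<open>With |y T| \<le> 2 \<eta> \<le> 1 the two boundary terms sum up to at most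
          3 r \<eta>, which is below \<open>e\<close>.\<close>
        define \<eta> where "\<eta> = min (1/2) (e / (4 * r))"
        have \<eta>: "\<eta> > 0" "\<eta> \<le> 1/2" "4 * r * \<eta> \<le> e"
        proof -
          show "\<eta> > 0" "\<eta> \<le> 1/2" using e r by (auto simp: \<eta>_def)
          have "\<eta> \<le> e / (4 * r)" by (simp add: \<eta>_def)
          then show "4 * r * \<eta> \<le> e" using r by (simp add: field_simps)
        qed
        obtain T1 where T1: "T1 \<le> 0" "\<forall>t\<le>T1. norm (\<phi> t) < \<rho> / 2" using \<phi>small[of "\<rho> / 2"] \<rho> by auto
        obtain T2 where T2: "T2 \<le> 0" "\<forall>t\<le>T2. norm (\<phi> t) < \<eta>" using \<phi>small[OF \<eta>(1)] by auto
        define T3 where "T3 = min (min T1 T2) (- real n)"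
        have T3: "T3 \<le> T1" "T3 \<le> T2" "T3 \<le> - real n" "T3 \<le> 0" using T1 by (auto simp: T3_def)
        have "\<exists>t\<le>T3. norm (\<psi> t) < \<eta>"
        proof (rule \<rho>(2)[OF \<psi>ac fin T3(4) _ \<eta>(1)])
          fix t assume t: "t \<le> T3"
          have "norm (\<psi> t) \<le> norm (y t) + norm (\<phi> t)"
            using norm_triangle_ineq[of "y t" "\<phi> t"] by (simp add: y_def)
          moreover have "norm (y t) < \<rho> / 2" using t T3 by (intro ysmall) simp
          moreover have "norm (\<phi> t) < \<rho> / 2" using t T3 T1 by simp
          ultimately show "norm (\<psi> t) < \<rho>" by simp
        qed
        then obtain T where T: "T \<le> T3" "norm (\<psi> T) < \<eta>" by blast
        have "norm (\<phi> T) < \<eta>" using T T3 T2 by simp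
        then have yT: "norm (y T) \<le> 2 * \<eta>"
          using norm_triangle_ineq4[of "\<psi> T" "\<phi> T"] T by (simp add: y_def)
        have "(norm (y T))\<^sup>2 \<le> (2 * \<eta>) * 1"
          unfolding power2_eq_square using yT \<eta> by (intro mult_mono) auto
        then have "r * norm (y T) + r * (norm (y T))\<^sup>2 / 2 \<le> r * (2 * \<eta>) + r * ((2 * \<eta>) * 1) / 2"
          using yT r by (intro add_mono divide_right_mono mult_left_mono) auto
        also have "\<dots> \<le> e" using \<eta>(3) mult_pos_pos[OF r \<eta>(1)] by linarith
        finally have "integral {T..0} ?q \<le> A + e" using main[of T] T T3 by simp
        moreover have "integral {- real n..0} ?q \<le> integral {T..0} ?q"
          using T T3 by (intro integral_subset_le qi) auto
        ultimately show "integral {- real n..0} ?q \<le> A + e" by simp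
      qed
    qed
    then show ?thesis by (simp add: A)
  qed simp
  ultimately show ?thesis
    unfolding local_minimizer_def using \<delta>1(1) \<rho>(1) by (intro conjI exI[of _ "min \<delta>1 (\<rho> / 2)"]) auto
qed

section \<open>The Riccati equation\<close>

lemma has_vector_derivative_matrixI:
  fixes U :: "real \<Rightarrow> real^'n^'m"
  assumes "\<And>c. ((\<lambda>t. U t *v c) has_vector_derivative D *v c) (at t within S)"
  shows "(U has_vector_derivative D) (at t within S)"
proof -
  have "((\<lambda>t. U t $ i $ j) has_derivative (\<lambda>h. h *\<^sub>R D $ i $ j)) (at t within S)" for i j
  proof -
    have "((\<lambda>t. (U t *v axis j 1) $ i) has_vector_derivative (D *v axis j 1) $ i) (at t within S)"
      by (rule bounded_linear.has_vector_derivative[OF bounded_linear_vec_nth assms])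
    then show ?thesis
      by (simp add: matrix_vector_mult_basis column_def has_vector_derivative_def)
  qed
  then show ?thesis
    unfolding has_vector_derivative_def
    by (subst has_derivative_componentwise_within) (auto simp: Basis_vec_def inner_axis)
qed

lemma continuous_on_matrixI:
  fixes U :: "'a::topological_space \<Rightarrow> real^'n^'m"
  assumes "\<And>c. continuous_on S (\<lambda>t. U t *v c)"
  shows "continuous_on S U"
proof -
  have "continuous_on S (\<lambda>t. U t $ i $ j)" for i j
    using continuous_on_component[OF assms[of "axis j 1"], of i]
    by (simp add: matrix_vector_mult_basis column_def)
  then have "continuous_on S (\<lambda>t. \<chi> i j. U t $ i $ j)" by (intro continuous_on_vec_lambda)
  then show ?thesis by simp
qed

lemma bounded_bilinear_matrix_matrix_mult:
  "bounded_bilinear ((**) :: real^'n^'m \<Rightarrow> real^'k^'n \<Rightarrow> real^'k^'m)"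
  by (subst bilinear_conv_bounded_bilinear[symmetric])
    (auto simp: bilinear_def matrix_matrix_mult_def vec_eq_iff sum.distrib sum_distrib_left algebra_simps
      intro!: linearI)

lemma transpose_add: "transpose (A + B) = transpose A + transpose B"
  and transpose_diff: "transpose (A - B) = transpose A - transpose B"
  and transpose_minus: "transpose (- A) = - transpose A" for A B :: "real^'n^'m"
  by (auto simp: transpose_def vec_eq_iff)

lemma matrix_vector_scaleR_left: "(c *\<^sub>R A) *v x = c *\<^sub>R (A *v x)" for A :: "real^'n^'m"
  by (simp add: scaleR_matrix_vector_assoc)

text \<open>The perturbation \<open>R X R\<close> is the quadratic form of \<open>v \<bullet> X v\<close> in terms of \<open>y\<close>, where \<open>v = R y\<close>. It grows
  along the unstable directions near the fixed point. The term \<open>e\<^sup>k\<^sup>t\<close> compensates for it on the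
  remaining compact time interval.\<close>
lemma strict_Riccati_perturbation:
  fixes R R' Jt S :: "real \<Rightarrow> real^'n^'n" and X :: "real^'n^'n"
  assumes dR: "\<And>t. t \<le> 0 \<Longrightarrow> (R has_vector_derivative R' t) (at t within {..0})"
    and R': "\<And>t. t \<le> 0 \<Longrightarrow> R' t = - (transpose (Jt t) ** R t) - S t - R t ** Jt t - R t ** R t"
    and R'c: "continuous_on {..0} R'"
    and symR: "\<And>t. t \<le> 0 \<Longrightarrow> transpose (R t) = R t" and symS: "\<And>t. t \<le> 0 \<Longrightarrow> transpose (S t) = S t"
    and symX: "transpose X = X" and b: "b \<ge> 1"
    and bR: "\<And>t y. t \<le> 0 \<Longrightarrow> norm (R t *v y) \<le> b * norm y"
    and bJ: "\<And>t y. t \<le> 0 \<Longrightarrow> norm (Jt t *v y) \<le> b * norm y"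
    and bJT: "\<And>t y. t \<le> 0 \<Longrightarrow> norm (transpose (Jt t) *v y) \<le> b * norm y"
    and bS: "\<And>t y. t \<le> 0 \<Longrightarrow> norm (S t *v y) \<le> b * norm y"
    and bX: "\<And>y. norm (X *v y) \<le> b * norm y"
    and c0: "c\<^sub>0 > 0"
    and near: "\<And>t y. t \<le> T\<^sub>0 \<Longrightarrow> t \<le> 0 \<Longrightarrow> c\<^sub>0 * (norm y)\<^sup>2
        \<le> 2 * ((X *v (R t *v y)) \<bullet> (- (transpose (Jt t) *v (R t *v y)) - S t *v y))"
  obtains M M' \<mu> r where "\<mu> > 0" "r > 0"
    "\<And>t. t \<le> 0 \<Longrightarrow> (M has_vector_derivative M' t) (at t within {..0})"
    "continuous_on {..0} M'" "\<And>t. t \<le> 0 \<Longrightarrow> transpose (M t) = M t"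
    "\<And>t y. t \<le> 0 \<Longrightarrow> norm (M t *v y) \<le> r * norm y"
    "\<And>t y. t \<le> 0 \<Longrightarrow> \<mu> * (norm y)\<^sup>2 \<le> - (y \<bullet> (M' t *v y)) - (norm (M t *v y))\<^sup>2
      - 2 * ((M t *v y) \<bullet> (Jt t *v y)) - y \<bullet> (S t *v y)"
proof -
  \<comment> \<open>Up to the factor \<Lambda>, the weight e^(kt) |y|^2 contributes e^(kt) (k |y|^2
    + 2 y \<bullet> (Jt y + R y)); as \<open>Jt\<close> and \<open>R\<close> are bounded by
    \<open>b\<close>, this \<open>k\<close> makes it at least e^(kt) |y|^2. \<open>C1\<close> bounds
    the contribution of R X R, \<open>\<Lambda>\<close> outweighs it from \<open>T\<^sub>0\<close>
    on, and \<open>N\<close> bounds \<open>Y\<close>.\<close>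
  define k where "k = 4 * b + 1"
  define C1 where "C1 = 2 * b * b * (b * b + b)"
  define \<Lambda> where "\<Lambda> = (C1 + c\<^sub>0) * exp (- k * T\<^sub>0)"
  define N where "N = b * b * b + \<Lambda>"
  \<comment> \<open>The maximizer of \<epsilon> c - \<epsilon>^2 N^2 for c =
    \<open>c\<^sub>0\<close>; the maximum is the margin
    \<open>c\<^sub>0\<^sup>2 / (4 * N\<^sup>2)\<close> below.\<close>
  define \<epsilon> where "\<epsilon> = c\<^sub>0 / (2 * N\<^sup>2)"
  have C1: "C1 > 0" using b by (simp add: C1_def add_pos_pos)
  have \<Lambda>: "\<Lambda> > 0" using C1 c0 by (simp add: \<Lambda>_def)
  have N: "N > 0" using b \<Lambda> by (simp add: N_def add_pos_pos)
  have \<epsilon>: "\<epsilon> > 0" using c0 N by (simp add: \<epsilon>_def)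
  define Y where "Y t = R t ** (X ** R t) + (\<Lambda> * exp (k * t)) *\<^sub>R mat 1" for t
  define Y' where "Y' t = (R t ** (X ** R' t) + R' t ** (X ** R t)) + (\<Lambda> * k * exp (k
      * t)) *\<^sub>R mat 1" for t
  define M where "M t = R t - \<epsilon> *\<^sub>R Y t" for t
  define M' where "M' t = R' t - \<epsilon> *\<^sub>R Y' t" for t
  note mm = bounded_bilinear.has_vector_derivative[OF bounded_bilinear_matrix_matrix_mult]
  have Yv: "Y t *v y = R t *v (X *v (R t *v y)) + (\<Lambda> * exp (k * t)) *\<^sub>R y" for t y
    by (simp add: Y_def matrix_vector_mult_add_rdistrib matrix_vector_mul_assoc[symmetric] matrix_vector_scaleR_left)
  have dY: "(Y has_vector_derivative Y' t) (at t within {..0})" if "t \<le> 0" for t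
  proof -
    have 1: "((\<lambda>t. X ** R t) has_vector_derivative X ** R' t) (at t within {..0})"
      by (rule bounded_linear.has_vector_derivative[OF
            bounded_bilinear.bounded_linear_right[OF bounded_bilinear_matrix_matrix_mult] dR[OF that]])
    have 2: "((\<lambda>t. (\<Lambda> * exp (k * t)) *\<^sub>R mat 1 :: real^'n^'n) has_vector_derivative (\<Lambda> * k
        * exp (k * t)) *\<^sub>R mat 1) (at t within {..0})"
    proof -
      have "((\<lambda>t. \<Lambda> * exp (k * t)) has_real_derivative \<Lambda> * k * exp (k * t)) (at t within {..0})"
        by (auto intro!: derivative_eq_intros)
      then show ?thesis
        unfolding has_real_derivative_iff_has_vector_derivative
        by (rule bounded_linear.has_vector_derivative[OF bounded_linear_scaleR_left])
    qed
    show ?thesis unfolding Y_def Y'_def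
      by (rule has_vector_derivative_add[OF mm[OF dR[OF that] 1] 2])
  qed
  have Rc: "continuous_on {..0} R"
    by (rule has_vector_derivative_imp_continuous_on[OF dR]) simp
  note mmc = bounded_bilinear.continuous_on[OF bounded_bilinear_matrix_matrix_mult]
  have absb: "\<bar>a \<bullet> c\<bar> \<le> \<alpha> * \<beta>" if "norm a \<le> \<alpha>" "norm c \<le> \<beta>" for a c :: "real^'n" and \<alpha> \<beta>
    using Cauchy_Schwarz_ineq2[of a c] mult_mono[OF that(1) that(2) order_trans[OF norm_ge_zero that(1)] norm_ge_zero]
    by linarith
  have bY: "norm (Y t *v y) \<le> N * norm y" if t: "t \<le> 0" for t y
  proof -
    have "norm (R t *v (X *v (R t *v y))) \<le> b * (b * (b * norm y))"
    proof -
      have "norm (X *v (R t *v y)) \<le> b * (b * norm y)"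
        by (rule order_trans[OF bX mult_left_mono[OF bR[OF t]]]) (use b in simp)
      then show ?thesis
        by (rule order_trans[OF bR[OF t] mult_left_mono]) (use b in simp)
    qed
    moreover have "norm ((\<Lambda> * exp (k * t)) *\<^sub>R y) \<le> \<Lambda> * norm y"
      using \<Lambda> b t by (simp add: mult_right_mono mult_left_le k_def mult_nonneg_nonpos)
    ultimately show ?thesis
      unfolding Yv using norm_triangle_ineq[of "R t *v (X *v (R t *v y))" "(\<Lambda> * exp (k * t)) *\<^sub>R y"]
      by (simp add: N_def algebra_simps)
  qed
  show ?thesis
  proof (rule that[of "c\<^sub>0\<^sup>2 / (4 * N\<^sup>2)" "b + \<epsilon> * N" M M'])
    show "c\<^sub>0\<^sup>2 / (4 * N\<^sup>2) > 0" using c0 N by simp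
    show "b + \<epsilon> * N > 0" using b \<epsilon> N by (simp add: add_pos_pos)
    show "(M has_vector_derivative M' t) (at t within {..0})" if "t \<le> 0" for t
      unfolding M_def M'_def
      by (intro has_vector_derivative_diff dR dY that
          bounded_linear.has_vector_derivative[OF bounded_linear_scaleR_right])
    show "continuous_on {..0} M'"
      unfolding M'_def Y'_def by (intro continuous_intros mmc Rc R'c)
    show "transpose (M t) = M t" if "t \<le> 0" for t
      by (simp add: M_def Y_def transpose_diff transpose_add transpose_scalar matrix_transpose_mul
          symR[OF that] symX matrix_mul_assoc transpose_mat)
    show "norm (M t *v y) \<le> (b + \<epsilon> * N) * norm y" if "t \<le> 0" for t y
    proof -
      have "norm (M t *v y) \<le> norm (R t *v y) + norm (\<epsilon> *\<^sub>R (Y t *v y))"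
        unfolding M_def matrix_vector_mult_diff_rdistrib matrix_vector_scaleR_left
          by (rule norm_triangle_ineq4)
      also have "\<dots> \<le> b * norm y + \<epsilon> * (N * norm y)"
        using bR[OF that] bY[OF that] \<epsilon> by (intro add_mono) auto
      finally show ?thesis by (simp add: algebra_simps)
    qed
    fix t :: real and y :: "real^'n" assume t: "t \<le> 0"
    define v where "v = R t *v y"
    define z where "z = X *v v"
    define j where "j = Jt t *v y"
    define e where "e = \<Lambda> * exp (k * t)"
    define w where "w = - (transpose (Jt t) *v v) - S t *v y - R t *v j - R t *v v"
    have R'y: "R' t *v y = w"
      by (simp add: R'[OF t] w_def v_def j_def matrix_vector_mult_diff_rdistrib matrix_vector_minus_left
          matrix_vector_mul_assoc[symmetric] del: transpose_matrix_vector)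
    have symR': "transpose (R' t) = R' t"
      by (simp add: R'[OF t] transpose_diff transpose_minus matrix_transpose_mul symR[OF t] symS[OF t])
    have Yy: "Y t *v y = R t *v z + e *\<^sub>R y" by (simp add: Yv z_def v_def e_def)
    have My: "M t *v y = v - \<epsilon> *\<^sub>R (Y t *v y)"
      by (simp add: M_def v_def matrix_vector_mult_diff_rdistrib matrix_vector_scaleR_left)
    have yY'y: "y \<bullet> (Y' t *v y) = 2 * (z \<bullet> w) + k * e * (norm y)\<^sup>2"
    proof -
      have "y \<bullet> (R t *v (X *v w)) = z \<bullet> w"
        using symmetric_matrix_inner[OF symR[OF t], of y "X *v w"] symmetric_matrix_inner[OF symX, of v w]
        by (simp add: v_def z_def)
      moreover have "y \<bullet> (R' t *v z) = z \<bullet> w"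
        using symmetric_matrix_inner[OF symR', of y z] by (simp add: R'y inner_commute)
      ultimately show ?thesis
        by (simp add: Y'_def matrix_vector_mult_add_rdistrib matrix_vector_mul_assoc[symmetric]
            matrix_vector_scaleR_left R'y z_def[symmetric] v_def[symmetric] inner_add_right
            power2_norm_eq_inner e_def)
    qed
    have yM'y: "y \<bullet> (M' t *v y) = y \<bullet> w - \<epsilon> * (2 * (z \<bullet> w) + k * e * (norm y)\<^sup>2)"
      by (simp add: M'_def matrix_vector_mult_diff_rdistrib matrix_vector_scaleR_left R'y inner_diff_right yY'y)
    have yw: "y \<bullet> w = - 2 * (v \<bullet> j) - y \<bullet> (S t *v y) - (norm v)\<^sup>2"
    proof -
      have "y \<bullet> (transpose (Jt t) *v v) = v \<bullet> j"
        by (simp only: inner_commute[of y] transpose_inner j_def)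
      moreover have "y \<bullet> (R t *v j) = v \<bullet> j" "y \<bullet> (R t *v v) = v \<bullet> v"
        using symmetric_matrix_inner[OF symR[OF t], of y] by (simp_all add: v_def)
      ultimately show ?thesis
        by (simp add: w_def inner_diff_right power2_norm_eq_inner del: transpose_matrix_vector)
    qed
    have Ryz: "(R t *v z) \<bullet> a = z \<bullet> (R t *v a)" for a
      by (rule symmetric_matrix_inner[OF symR[OF t]])
    define W where "W = - (transpose (Jt t) *v v) - S t *v y"
    have wW: "w = W - R t *v j - R t *v v" by (simp add: w_def W_def)
    \<comment> \<open>Expansion in \<epsilon>. The terms of order zero cancel since \<open>R\<close>
      solves the Riccati equation. In first order the terms z \<bullet> R j and z \<bullet> R v
      cancel as well, and the second order is only the square of \<open>Y t *v y\<close>.\<close>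
    have E: "- (y \<bullet> (M' t *v y)) - (norm (M t *v y))\<^sup>2 - 2 * ((M t *v y) \<bullet> j) - y \<bullet> (S t *v y)
      = \<epsilon> * (2 * (z \<bullet> W) + e * (k * (norm y)\<^sup>2 + 2 * (y \<bullet> (j + v)))) - \<epsilon>\<^sup>2 * (norm (Y t *v y))\<^sup>2"
    proof -
      have "(norm (M t *v y))\<^sup>2 = (norm v)\<^sup>2 - 2 * \<epsilon> * ((Y t *v y) \<bullet> v) + \<epsilon>\<^sup>2 * (norm (Y t *v y))\<^sup>2"
        unfolding My power2_norm_eq_inner
        by (simp add: inner_diff_left inner_diff_right inner_commute power2_eq_square algebra_simps)
      moreover have "(M t *v y) \<bullet> j = v \<bullet> j - \<epsilon> * ((Y t *v y) \<bullet> j)"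
        unfolding My by (simp add: inner_diff_left)
      moreover have "(Y t *v y) \<bullet> v = z \<bullet> (R t *v v) + e * (y \<bullet> v)" "(Y t *v y) \<bullet> j = z
          \<bullet> (R t *v j) + e * (y \<bullet> j)"
        unfolding Yy by (simp_all add: inner_add_left Ryz)
      moreover have "\<epsilon> * (z \<bullet> w) = \<epsilon> * (z \<bullet> W) - \<epsilon> * (z \<bullet> (R t *v j)) - \<epsilon> * (z \<bullet> (R t *v v))"
        unfolding wW by (simp add: inner_diff_right right_diff_distrib)
      ultimately show ?thesis
        unfolding yM'y yw by (simp add: inner_add_right algebra_simps)
    qed
    have e: "e > 0" using \<Lambda> by (simp add: e_def)
    have vn: "norm v \<le> b * norm y" unfolding v_def by (rule bR[OF t])
    have "\<bar>y \<bullet> (j + v)\<bar> \<le> norm y * (b * norm y + b * norm y)"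
      using bJ[OF t, of y] vn by (intro absb norm_triangle_mono) (auto simp: j_def)
    then have k1: "(norm y)\<^sup>2 \<le> k * (norm y)\<^sup>2 + 2 * (y \<bullet> (j + v))"
      by (simp add: k_def abs_le_iff power2_eq_square algebra_simps)
    have key: "c\<^sub>0 * (norm y)\<^sup>2 \<le> 2 * (z \<bullet> W) + e * (k * (norm y)\<^sup>2 + 2 * (y \<bullet> (j + v)))"
    proof (cases "t \<le> T\<^sub>0")
      case True
      have "c\<^sub>0 * (norm y)\<^sup>2 \<le> 2 * (z \<bullet> W)" using near[OF True t, of y]
        by (simp add: z_def v_def W_def)
      moreover have "0 \<le> e * (k * (norm y)\<^sup>2 + 2 * (y \<bullet> (j + v)))"
        using k1 e by (intro mult_nonneg_nonneg) (auto intro: order_trans[OF zero_le_power2])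
      ultimately show ?thesis by linarith
    next
      case False
      have "exp (k * T\<^sub>0) \<le> exp (k * t)" using False b by (simp add: k_def)
      then have "(C1 + c\<^sub>0) * (exp (- k * T\<^sub>0) * exp (k * T\<^sub>0)) \<le> (C1 + c\<^sub>0) * (exp (- k * T\<^sub>0)
          * exp (k * t))"
        using C1 c0 by (intro mult_left_mono) auto
      then have eC: "C1 + c\<^sub>0 \<le> e" by (simp add: e_def \<Lambda>_def exp_minus mult.assoc)
      have bv: "b * norm v \<le> b * (b * norm y)"
        by (rule mult_left_mono[OF vn]) (use b in simp)
      have "norm z \<le> b * (b * norm y)"
        unfolding z_def by (rule order_trans[OF bX bv])
      moreover have "norm W \<le> b * (b * norm y) + b * norm y"
        unfolding W_def diff_conv_add_uminus
        by (intro norm_triangle_mono; simp only: norm_minus_cancel)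
          (rule order_trans[OF bJT[OF t] bv], rule bS[OF t])
      ultimately have "\<bar>z \<bullet> W\<bar> \<le> (b * (b * norm y)) * (b * (b * norm y) + b * norm y)"
        by (rule absb)
      also have "\<dots> = C1 / 2 * (norm y)\<^sup>2" by (simp add: C1_def power2_eq_square algebra_simps)
      finally have "- C1 * (norm y)\<^sup>2 \<le> 2 * (z \<bullet> W)" by (simp add: abs_le_iff)
      moreover have "(C1 + c\<^sub>0) * (norm y)\<^sup>2 \<le> e * (norm y)\<^sup>2" using eC
        by (intro mult_right_mono) auto
      moreover have "e * (norm y)\<^sup>2 \<le> e * (k * (norm y)\<^sup>2 + 2 * (y \<bullet> (j + v)))"
        using k1 e by (intro mult_left_mono) auto
      ultimately show ?thesis by (simp add: algebra_simps)
    qed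
    have "c\<^sub>0\<^sup>2 / (4 * N\<^sup>2) * (norm y)\<^sup>2 = \<epsilon> * (c\<^sub>0 * (norm y)\<^sup>2) - \<epsilon>\<^sup>2 * (N * norm y)\<^sup>2"
      using N c0 by (simp add: \<epsilon>_def power2_eq_square field_simps)
    also have "\<dots> \<le> \<epsilon> * (2 * (z \<bullet> W) + e * (k * (norm y)\<^sup>2 + 2 * (y \<bullet> (j + v)))) - \<epsilon>\<^sup>2
        * (norm (Y t *v y))\<^sup>2"
      using \<epsilon> bY[OF t, of y] by (intro diff_mono mult_left_mono key power_mono) auto
    finally show "c\<^sub>0\<^sup>2 / (4 * N\<^sup>2) * (norm y)\<^sup>2 \<le> - (y \<bullet> (M' t *v y)) - (norm (M t *v y))\<^sup>2
      - 2 * ((M t *v y) \<bullet> (Jt t *v y)) - y \<bullet> (S t *v y)"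
      unfolding j_def[symmetric] E .
  qed
qed

text \<open>In dimension two, trace U - U is the adjugate of U. The inverse is written this way
  because the formula can be differentiated entrywise.\<close>

definition inv2 :: "real^2^2 \<Rightarrow> real^2^2" where
  "inv2 U = (1 / det U) *\<^sub>R (trace U *\<^sub>R mat 1 - U)"

lemma inv2_mult:
  assumes "det U \<noteq> 0"
  shows "U ** inv2 U = mat 1" "inv2 U ** U = mat 1"
proof -
  have "U ** (trace U *\<^sub>R mat 1 - U) = det U *\<^sub>R mat 1" "(trace U *\<^sub>R mat 1 - U) ** U
      = det U *\<^sub>R mat 1"
    by (simp_all add: vec_eq_iff forall_2 matrix_matrix_mult_def sum_2 trace_def det_2 mat_def algebra_simps)
  then show "U ** inv2 U = mat 1" "inv2 U ** U = mat 1"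
    using assms unfolding inv2_def
    by (simp_all add: bounded_bilinear.scaleR_right[OF bounded_bilinear_matrix_matrix_mult]
        bounded_bilinear.scaleR_left[OF bounded_bilinear_matrix_matrix_mult])
qed

lemma inv2_has_vector_derivative:
  fixes U :: "real \<Rightarrow> real^2^2"
  assumes dU: "(U has_vector_derivative U') (at t within S)" and dt: "det (U t) \<noteq> 0"
  shows "((\<lambda>t. inv2 (U t)) has_vector_derivative
      - (inv2 (U t) ** (U' ** inv2 (U t)))) (at t within S)"
proof -
  let ?adj = "\<lambda>A :: real^2^2. trace A *\<^sub>R mat 1 - A"
  define d' where "d' = U' $ 1 $ 1 * U t $ 2 $ 2 + U t $ 1 $ 1 * U' $ 2 $ 2
    - (U' $ 1 $ 2 * U t $ 2 $ 1 + U t $ 1 $ 2 * U' $ 2 $ 1)"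
  have comp: "((\<lambda>t. U t $ i $ j) has_real_derivative U' $ i $ j) (at t within S)" for i j
    using bounded_linear.has_vector_derivative[OF bounded_linear_compose[OF bounded_linear_vec_nth bounded_linear_vec_nth] dU]
    by (simp add: has_real_derivative_iff_has_vector_derivative)
  have dd: "((\<lambda>t. det (U t)) has_real_derivative d') (at t within S)"
    unfolding det_2 d'_def by (rule derivative_eq_intros comp refl)+ (simp add: algebra_simps)
  have dr: "((\<lambda>t. 1 / det (U t)) has_real_derivative - d' / (det (U t))\<^sup>2) (at t within S)"
    using dt by (auto intro!: derivative_eq_intros dd simp: power2_eq_square)
  have "bounded_linear ?adj"
    by (subst linear_conv_bounded_linear[symmetric])
      (auto intro!: linearI simp: trace_def sum_2 algebra_simps)
  from bounded_linear.has_vector_derivative[OF this dU]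
  have "((\<lambda>t. inv2 (U t)) has_vector_derivative (1 / det (U t)) *\<^sub>R ?adj U'
      + (- d' / (det (U t))\<^sup>2) *\<^sub>R ?adj (U t)) (at t within S)"
    unfolding inv2_def by (rule has_vector_derivative_scaleR[OF dr])
  moreover have "?adj (U t) ** (U' ** ?adj (U t)) = d' *\<^sub>R ?adj (U t) - det (U t) *\<^sub>R ?adj U'"
    by (simp add: vec_eq_iff forall_2 matrix_matrix_mult_def sum_2 trace_def det_2 mat_def d'_def algebra_simps)
  then have "inv2 (U t) ** (U' ** inv2 (U t)) = (1 / (det (U t))\<^sup>2) *\<^sub>R (d' *\<^sub>R ?adj (U t)
      - det (U t) *\<^sub>R ?adj U')"
    unfolding inv2_def
    by (simp add: bounded_bilinear.scaleR_right[OF bounded_bilinear_matrix_matrix_mult]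
        bounded_bilinear.scaleR_left[OF bounded_bilinear_matrix_matrix_mult] power2_eq_square)
  then have "- (inv2 (U t) ** (U' ** inv2 (U t))) = (1 / det (U t)) *\<^sub>R ?adj U'
      + (- d' / (det (U t))\<^sup>2) *\<^sub>R ?adj (U t)"
    using dt by (simp add: scaleR_diff_right power2_eq_square)
  ultimately show ?thesis by simp
qed

text \<open>The classical passage from a matrix solution of the linearized Hamiltonian system to the
  Riccati equation of its quotient; the quadratic term arises from differentiating the inverse of
  \<open>U\<close>.\<close>

lemma Riccati_of_Jacobi:
  fixes U P Jt S :: "real \<Rightarrow> real^2^2"
  assumes dU: "(U has_vector_derivative Jt t ** U t + P t) (at t within D)"
    and dP: "(P has_vector_derivative - (transpose (Jt t) ** P t) - S t ** U t) (at t within D)"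
    and dt: "det (U t) \<noteq> 0"
  shows "((\<lambda>t. P t ** inv2 (U t)) has_vector_derivative
    - (transpose (Jt t) ** (P t ** inv2 (U t))) - S t - (P t ** inv2 (U t)) ** Jt t
    - (P t ** inv2 (U t)) ** (P t ** inv2 (U t))) (at t within D)"
proof -
  interpret mm: bounded_bilinear "(**) :: real^2^2 \<Rightarrow> real^2^2 \<Rightarrow> real^2^2"
    by (rule bounded_bilinear_matrix_matrix_mult)
  let ?V = "inv2 (U t)"
  have eq: "P t ** - (?V ** ((Jt t ** U t + P t) ** ?V)) + (- (transpose (Jt t) ** P t)
      - S t ** U t) ** ?V =
    - (transpose (Jt t) ** (P t ** ?V)) - S t - (P t ** ?V) ** Jt t - (P t ** ?V) ** (P t ** ?V)"
  proof -
    have 1: "(Jt t ** U t + P t) ** ?V = Jt t + P t ** ?V"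
      using inv2_mult(1)[OF dt] by (simp add: mm.add_left matrix_mul_assoc[symmetric])
    have 2: "(S t ** U t) ** ?V = S t"
      using inv2_mult(1)[OF dt] by (simp add: matrix_mul_assoc[symmetric])
    show ?thesis
      unfolding 1 mm.diff_left 2
      by (simp add: mm.minus_right mm.minus_left mm.add_right mm.diff_right matrix_mul_assoc)
  qed
  show ?thesis
    using mm.has_vector_derivative[OF dP inv2_has_vector_derivative[OF dU dt]] unfolding eq .
qed

section \<open>Linearized orbits of the Hamiltonian system\<close>

lemma bounded_image_atMost_of_limit:
  fixes z :: "real \<Rightarrow> 'a::real_normed_vector"
  assumes "continuous_on {..T} z" "(z \<longlongrightarrow> l) at_bot"
  shows "bounded (z ` {..T})"
proof -
  obtain N where N: "\<And>t. t \<le> N \<Longrightarrow> dist (z t) l < 1"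
    using tendstoD[OF assms(2), of 1] by (auto simp: eventually_at_bot_linorder)
  have "bounded (z ` {N..T})"
    by (intro compact_imp_bounded compact_continuous_image continuous_on_subset[OF assms(1)]) auto
  moreover have "bounded (z ` {..N})"
    by (rule bounded_subset[OF bounded_ball[of l 1]]) (use N in \<open>auto simp: dist_commute\<close>)
  ultimately have "bounded (z ` ({..N} \<union> {N..T}))" by (simp add: image_Un)
  then show ?thesis by (rule bounded_subset) (intro image_mono, auto)
qed

lemma norm_fst_le_norm: "norm (fst w) \<le> norm w"
  using norm_fst_le[of "fst w" "snd w"] by simp

lemma norm_snd_le_norm: "norm (snd w) \<le> norm w"
  using norm_snd_le[of "snd w" "fst w"] by simp

lemma norm_le_fst_snd: "norm w \<le> norm (fst w) + norm (snd w)"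
  unfolding norm_prod_def by (rule sqrt_sum_squares_le_sum) auto

text \<open>The conclusion of \<open>unstable_cone\<close> for the pair w = (u, v): position and
  momentum control each other, and the momentum decays into the past. The bound of the position by
  the momentum later keeps the slope \<open>R\<close> away from degeneracy.\<close>

definition cone_bound ::
    "real \<Rightarrow> real \<Rightarrow> real \<Rightarrow> (real \<Rightarrow> 'a::real_normed_vector \<times> 'b::real_normed_vector) \<Rightarrow> bool" where
  "cone_bound C c T w \<longleftrightarrow>
     (\<forall>t\<le>T. norm (fst (w t)) \<le> C * norm (snd (w t)) \<and> norm (snd (w t)) \<le> C * norm (fst (w t))) \<and>
     (\<forall>s t. s \<le> t \<and> t \<le> T \<longrightarrow> norm (snd (w s)) \<le> C * exp (- c * (t - s)) * norm (snd (w t)))"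

context C2_field
begin

definition ham :: "(real^'n) \<times> (real^'n) \<Rightarrow> (real^'n) \<times> (real^'n)" where
  "ham z = (F (fst z) + snd z, - (snd z v* J (fst z)))"

definition dham_fun :: "(real^'n) \<times> (real^'n) \<Rightarrow> (real^'n) \<times> (real^'n) \<Rightarrow> (real^'n) \<times> (real^'n)" where
  "dham_fun z w = (J (fst z) *v fst w + snd w, - (snd z v* J' (fst z) (fst w)
      + snd w v* J (fst z)))"

definition dham where "dham z = Blinfun (dham_fun z)"

lemma ham_has_derivative_fun: "(ham has_derivative dham_fun z) (at z)"
proof -
  have 1: "((\<lambda>z. F (fst z)) has_derivative (\<lambda>w. J (fst z) *v fst w)) (at z)"
    by (rule has_derivative_compose[OF _ F_der]) (auto intro!: derivative_eq_intros)
  have 2: "((\<lambda>z. J (fst z)) has_derivative (\<lambda>w. J' (fst z) (fst w))) (at z)"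
    by (rule has_derivative_compose[OF _ J_der]) (auto intro!: derivative_eq_intros)
  show ?thesis
    unfolding ham_def[abs_def] dham_fun_def[abs_def]
    by (intro has_derivative_Pair has_derivative_add has_derivative_minus 1
        vm_has_derivative 2 bounded_linear.has_derivative[OF bounded_linear_snd] has_derivative_ident)
qed

lemma dham_apply: "blinfun_apply (dham z) = dham_fun z"
  unfolding dham_def using has_derivative_bounded_linear[OF ham_has_derivative_fun]
  by (rule bounded_linear_Blinfun_apply)

lemma ham_has_derivative: "(ham has_derivative dham z) (at z)"
  unfolding dham_apply by (rule ham_has_derivative_fun)

lemma dham_continuous: "continuous_on UNIV dham"
proof (rule continuous_on_blinfun_componentwise)
  fix i :: "(real^'n) \<times> (real^'n)"
  have "continuous_on UNIV (\<lambda>z :: (real^'n) \<times> (real^'n). J (fst z))"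
    and "continuous_on UNIV (\<lambda>z :: (real^'n) \<times> (real^'n). J' (fst z))"
    by (auto intro!: continuous_on_compose2[OF J_continuous_on[of UNIV]]
        continuous_on_compose2[OF J'_cont] continuous_intros)
  then show "continuous_on UNIV (\<lambda>x. blinfun_apply (dham x) i)"
    unfolding dham_apply dham_fun_def by (intro continuous_intros)
qed

lemma dham_zero: "dham 0 w = (J 0 *v fst w + snd w, - (transpose (J 0) *v snd w))"
proof -
  have "0 v* B = (0 :: real^'n)" for B :: "real^'n^'n"
    by (simp add: vector_matrix_mult_def vec_eq_iff)
  then show ?thesis by (simp add: dham_apply dham_fun_def)
qed

text \<open>Gronwall backward on a ball containing both orbits. It identifies the central half-orbit
  of a curve in the unstable manifold with the given trajectory.\<close>

lemma ham_unique:
  assumes y: "solves_on ham y {..0}" "bounded (y ` {..0})"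
    and z: "solves_on ham z {..0}" "bounded (z ` {..0})" and eq: "y 0 = z 0" and t: "t \<le> 0"
  shows "y t = z t"
proof -
  obtain M where M: "\<And>t. t \<le> 0 \<Longrightarrow> norm (y t) \<le> M" "\<And>t. t \<le> 0 \<Longrightarrow> norm (z t) \<le> M"
  proof -
    have "bounded (y ` {..0} \<union> z ` {..0})" using y(2) z(2) by simp
    then obtain M where "\<forall>x\<in>y ` {..0} \<union> z ` {..0}. norm x \<le> M" by (auto simp: bounded_iff)
    then show ?thesis using that[of M] by auto
  qed
  obtain L where L: "L > 0"
    "\<And>a b. norm a \<le> M \<Longrightarrow> norm b \<le> M \<Longrightarrow> norm (ham a - ham b) \<le> L * norm (a - b)"
    using C1_lipschitz_cball[OF ham_has_derivative dham_continuous] by metis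
  have "(norm (y t - z t))\<^sup>2 + 0\<^sup>2 \<le> exp ((2 * L + 1) * (0 - t)) * ((norm (y 0 - z 0))\<^sup>2 + 0\<^sup>2)"
  proof (rule gronwall_norm(2))
    fix r assume r: "t \<le> r" "r \<le> 0"
    have sub: "(f has_vector_derivative ham (f r)) (at r within {t..0})"
      if "solves_on ham f {..0}" for f
      using that r by (auto simp: solves_on_def intro: has_vector_derivative_within_subset)
    show "((\<lambda>r. y r - z r) has_vector_derivative ham (y r) - ham (z r)) (at r within {t..0})"
      by (intro has_vector_derivative_diff sub y z)
    show "norm (ham (y r) - ham (z r)) \<le> L * norm (y r - z r) + 0"
      using L(2) M r by simp
  qed (use t L in auto)
  then show ?thesis using eq by simp
qed

text \<open>Boundedness in the past stands for tangency to the unstable manifold. Unlike velocities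
  of curves of half-orbits, these solutions are visibly closed under linear combinations.\<close>

definition lin_orbit ::
    "(real \<Rightarrow> (real^'n) \<times> (real^'n)) \<Rightarrow> real \<Rightarrow> (real \<Rightarrow> (real^'n) \<times> (real^'n)) \<Rightarrow> bool" where
  "lin_orbit z t \<zeta> \<longleftrightarrow>
     (\<forall>r\<le>t. (\<zeta> has_vector_derivative dham (z r) (\<zeta> r)) (at r within {..t})) \<and> bounded (\<zeta> ` {..t})"

lemma lin_orbit_subset:
  assumes "lin_orbit z t \<zeta>" "s \<le> t"
  shows "lin_orbit z s \<zeta>"
  unfolding lin_orbit_def
proof (intro conjI allI impI)
  show "bounded (\<zeta> ` {..s})" using assms by (auto simp: lin_orbit_def intro: bounded_subset)
  fix r assume "r \<le> s"
  then have "(\<zeta> has_vector_derivative dham (z r) (\<zeta> r)) (at r within {..t})"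
    using assms by (simp add: lin_orbit_def)
  then show "(\<zeta> has_vector_derivative dham (z r) (\<zeta> r)) (at r within {..s})"
    by (rule has_vector_derivative_within_subset) (use assms in auto)
qed

lemma lin_orbit_add:
  assumes "lin_orbit z t \<zeta>" "lin_orbit z t \<eta>"
  shows "lin_orbit z t (\<lambda>r. \<zeta> r + \<eta> r)"
  using assms unfolding lin_orbit_def
  by (auto simp: blinfun.add_right intro!: has_vector_derivative_add bounded_plus_comp)

lemma lin_orbit_scaleR:
  assumes "lin_orbit z t \<zeta>"
  shows "lin_orbit z t (\<lambda>r. c *\<^sub>R \<zeta> r)"
  using assms unfolding lin_orbit_def
  by (auto simp: blinfun.scaleR_right bounded_scaleR_comp
      intro!: bounded_linear.has_vector_derivative[OF bounded_linear_scaleR_right])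

text \<open>Coefficients of the linear equation are bounded on compact intervals, so vanishing
  propagates forward. This carries information from near -\<infinity>, where the cone is available,
  up to later times.\<close>

lemma lin_orbit_zero_forward:
  assumes z: "continuous_on {..t} z" and \<zeta>: "lin_orbit z t \<zeta>" and s: "s \<le> t" "\<zeta> s = 0"
  shows "\<zeta> t = 0"
proof -
  have "compact ((\<lambda>r. dham (z r)) ` {s..t})"
    by (intro compact_continuous_image continuous_on_compose2[OF dham_continuous] continuous_on_subset[OF z]) auto
  then obtain L where L: "L > 0" "\<And>r. r \<in> {s..t} \<Longrightarrow> norm (dham (z r)) \<le> L"
    by (auto dest!: compact_imp_bounded simp: bounded_pos)
  have "(norm (\<zeta> t))\<^sup>2 + 0\<^sup>2 \<le> exp ((2 * L + 1) * (t - s)) * ((norm (\<zeta> s))\<^sup>2 + 0\<^sup>2)"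
  proof (rule gronwall_norm(1)[OF s(1)])
    fix r assume r: "s \<le> r" "r \<le> t"
    show "(\<zeta> has_vector_derivative dham (z r) (\<zeta> r)) (at r within {s..t})"
      using \<zeta> r by (auto simp: lin_orbit_def intro: has_vector_derivative_within_subset)
    have "norm (dham (z r) (\<zeta> r)) \<le> norm (dham (z r)) * norm (\<zeta> r)" by (rule norm_blinfun)
    also have "\<dots> \<le> L * norm (\<zeta> r)" using L(2)[of r] r by (intro mult_right_mono) auto
    finally show "norm (dham (z r) (\<zeta> r)) \<le> L * norm (\<zeta> r) + 0" by simp
  qed (use L in auto)
  then show ?thesis using s by simp
qed

end

text \<open>\<open>Q\<close> certifies the decay of u' = A u for the Jacobian matrix A at the
  origin. \<open>X\<close> does the same for the transpose, and its Lyapunov equation says that the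
  plane u = X v is invariant under u' = A u + v, v' = - A^T v.\<close>

locale hyperbolic_field = C2_field F J J' for F :: "real^'n \<Rightarrow> real^'n" and J J' +
  fixes Q X :: "real^'n^'n" and q x :: real
  assumes F0: "F 0 = 0"
    and Q: "transpose Q = Q" "transpose (J 0) ** Q + Q ** J 0 = - mat 1"
      "q > 0" "\<And>y. q * (norm y)\<^sup>2 \<le> y \<bullet> (Q *v y)"
    and X: "transpose X = X" "J 0 ** X + X ** transpose (J 0) = - mat 1"
      "x > 0" "\<And>y. x * (norm y)\<^sup>2 \<le> y \<bullet> (X *v y)"
begin

text \<open>The error is measured against the linearization at the origin, so that both solutions of
  the linearized system and differences of two nonlinear orbits qualify.\<close>

lemma cone_phase:
  obtains \<sigma> C c where "\<sigma> > 0" "C > 0" "c > 0"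
    "\<And>w w' T. (\<And>t. t \<le> T \<Longrightarrow> (w has_vector_derivative w' t) (at t within {..T})) \<Longrightarrow>
      (\<And>t. t \<le> T \<Longrightarrow> norm (w' t - dham 0 (w t)) \<le> \<sigma> * norm (w t)) \<Longrightarrow> bounded (w ` {..T}) \<Longrightarrow>
      cone_bound C c T w"
proof -
  obtain \<sigma> C c where pos: "\<sigma> > 0" "C > 0" "c > 0" and cone:
    "\<And>u v u' v' T. (\<And>t. t \<le> T \<Longrightarrow> (u has_vector_derivative u' t) (at t within {..T})) \<Longrightarrow>
      (\<And>t. t \<le> T \<Longrightarrow> (v has_vector_derivative v' t) (at t within {..T})) \<Longrightarrow>
      (\<And>t. t \<le> T \<Longrightarrow> norm (u' t - (J 0 *v u t + v t)) \<le> \<sigma> * (norm (u t) + norm (v t))) \<Longrightarrow>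
      (\<And>t. t \<le> T \<Longrightarrow> norm (v' t + transpose (J 0) *v v t) \<le> \<sigma> * (norm (u t) + norm (v t))) \<Longrightarrow>
      bounded (u ` {..T}) \<Longrightarrow> bounded (v ` {..T}) \<Longrightarrow>
      (\<forall>t\<le>T. norm (u t) \<le> C * norm (v t) \<and> norm (v t) \<le> C * norm (u t)) \<and>
      (\<forall>s t. s \<le> t \<and> t \<le> T \<longrightarrow> norm (v s) \<le> C * exp (- c * (t - s)) * norm (v t))"
    using unstable_cone[OF Q X] by blast
  show ?thesis
  proof (rule that[OF pos])
    fix w w' :: "real \<Rightarrow> (real^'n) \<times> (real^'n)" and T :: real
    assume dw: "\<And>t. t \<le> T \<Longrightarrow> (w has_vector_derivative w' t) (at t within {..T})"
      and e: "\<And>t. t \<le> T \<Longrightarrow> norm (w' t - dham 0 (w t)) \<le> \<sigma> * norm (w t)" and bd: "bounded (w ` {..T})"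
    have e': "norm (w' t - dham 0 (w t)) \<le> \<sigma> * (norm (fst (w t)) + norm (snd (w t)))" if "t \<le> T"
      for t
      using e[OF that] mult_left_mono[OF norm_le_fst_snd[of "w t"], of \<sigma>] pos(1) by linarith
    show "cone_bound C c T w"
      unfolding cone_bound_def
    proof (rule cone)
      fix t assume t: "t \<le> T"
      show "((\<lambda>t. fst (w t)) has_vector_derivative fst (w' t)) (at t within {..T})"
        and "((\<lambda>t. snd (w t)) has_vector_derivative snd (w' t)) (at t within {..T})"
        by (intro bounded_linear.has_vector_derivative[OF bounded_linear_fst] dw[OF t]
            bounded_linear.has_vector_derivative[OF bounded_linear_snd])+
      have "norm (fst (w' t - dham 0 (w t))) \<le> norm (w' t - dham 0 (w t))"
        by (rule norm_fst_le_norm)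
      then show "norm (fst (w' t) - (J 0 *v fst (w t) + snd (w t))) \<le> \<sigma> * (norm (fst (w t))
          + norm (snd (w t)))"
        using e'[OF t] by (simp add: dham_zero)
      have "norm (snd (w' t - dham 0 (w t))) \<le> norm (w' t - dham 0 (w t))"
        by (rule norm_snd_le_norm)
      then show "norm (snd (w' t) + transpose (J 0) *v snd (w t)) \<le> \<sigma> * (norm (fst (w t))
          + norm (snd (w t)))"
        using e'[OF t] by (simp add: dham_zero)
    next
      show "bounded ((\<lambda>t. fst (w t)) ` {..T})" "bounded ((\<lambda>t. snd (w t)) ` {..T})"
        using bounded_fst[OF bd] bounded_snd[OF bd] by (simp_all add: image_image)
    qed
  qed
qed

text \<open>The difference quotients of \<open>Z\<close> inherit the bounds of the unstable cone, uniformly in \<open>s\<close>.\<close>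
lemma variation_bounded:
  fixes Z :: "real \<Rightarrow> real \<Rightarrow> (real^'n) \<times> (real^'n)"
  assumes sol: "\<And>s. solves_on ham (Z s) {..0}" and lim: "\<And>s. (Z s \<longlongrightarrow> 0) at_bot"
    and unif: "uniform_limit {..0} Z (Z 0) (at 0)"
    and \<xi>: "((\<lambda>s. Z s 0) has_vector_derivative \<xi>) (at 0)"
  obtains \<zeta> where "\<zeta> 0 = \<xi>" "lin_orbit (Z 0) 0 \<zeta>"
proof -
  have bdd: "bounded (Z s ` {..0})" for s
    by (rule bounded_image_atMost_of_limit[OF solves_on_continuous_on[OF sol] lim])
  obtain \<zeta> where \<zeta>: "\<zeta> 0 = \<xi>"
    "\<And>t. t \<le> 0 \<Longrightarrow> (\<zeta> has_vector_derivative dham (Z 0 t) (\<zeta> t)) (at t within {..0})"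
    "\<And>t. t \<le> 0 \<Longrightarrow> ((\<lambda>s. Z s t) has_vector_derivative \<zeta> t) (at 0)"
    using variation_of_solutions[OF ham_has_derivative dham_continuous sol unif bdd \<xi>] by metis
  obtain \<sigma> C c where pos: "\<sigma> > 0" "C > 0" "c > 0" and cone:
    "\<And>w w' T. (\<And>t. t \<le> T \<Longrightarrow> (w has_vector_derivative w' t) (at t within {..T})) \<Longrightarrow>
      (\<And>t. t \<le> T \<Longrightarrow> norm (w' t - dham 0 (w t)) \<le> \<sigma> * norm (w t)) \<Longrightarrow> bounded (w ` {..T}) \<Longrightarrow>
      cone_bound C c T w"
    using cone_phase by metis
  obtain d where d: "d > 0" "\<And>a b. a \<in> ball 0 d \<Longrightarrow> b \<in> ball 0 d \<Longrightarrow>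
      norm (ham b - ham a - dham 0 (b - a)) \<le> \<sigma> * norm (b - a)"
    using C1_linearization_at[OF ham_has_derivative dham_continuous pos(1), of 0] by metis
  \<comment> \<open>Both halves of \<open>d\<close> are used: up to time \<open>T\<close> the
    central orbit is within d/2 of the origin, and its neighbours are within d/2 of it.\<close>
  obtain T where T: "T \<le> 0" "\<And>t. t \<le> T \<Longrightarrow> norm (Z 0 t) < d / 2"
  proof -
    obtain T where "\<And>t. t \<le> T \<Longrightarrow> norm (Z 0 t) < d / 2"
      using tendstoD[OF lim[of 0], of "d / 2"] d(1)
        by (auto simp: eventually_at_bot_linorder dist_norm)
    then show ?thesis using that[of "min T 0"] by simp
  qed
  obtain s0 where s0: "s0 > 0" "\<And>s t. s \<noteq> 0 \<Longrightarrow> \<bar>s\<bar> < s0 \<Longrightarrow> t \<le> 0 \<Longrightarrow> dist (Z s t) (Z 0 t) < d / 2"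
    using uniform_limitD[OF unif, of "d / 2"] d(1) unfolding eventually_at by (auto simp: dist_norm)
  \<comment> \<open>The position is bounded by \<open>C\<close> times the momentum, hence the factor
    \<open>C + 1\<close>; the decay of the momentum into the past gives the other factor,
    independent of the time.\<close>
  define K where "K = (C + 1) * C"
  have K: "K > 0" using pos by (simp add: K_def add_pos_pos)
  have w: "norm (Z s r - Z 0 r) \<le> K * norm (Z s T - Z 0 T)"
    if s: "s \<noteq> 0" "\<bar>s\<bar> < s0" and r: "r \<le> T" for s r
  proof -
    have inb: "Z s t \<in> ball 0 d" "Z 0 t \<in> ball 0 d" if t: "t \<le> T" for t
      using s0(2)[OF s, of t] T(2)[OF t] T(1) t norm_triangle_sub[of "Z s t" "Z 0 t"] d(1)
        by (auto simp: dist_norm)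
    have "cone_bound C c T (\<lambda>t. Z s t - Z 0 t)"
    proof (rule cone)
      fix t assume t: "t \<le> T"
      have sub: "(Z s has_vector_derivative ham (Z s t)) (at t within {..T})" for s
        using sol[of s] t T(1)
          by (auto simp: solves_on_def intro: has_vector_derivative_within_subset)
      show "((\<lambda>t. Z s t - Z 0 t) has_vector_derivative ham (Z s t)
          - ham (Z 0 t)) (at t within {..T})"
        by (intro has_vector_derivative_diff sub)
      show "norm (ham (Z s t) - ham (Z 0 t) - dham 0 (Z s t - Z 0 t)) \<le> \<sigma> * norm (Z s t - Z 0 t)"
        by (rule d(2)) (use inb t in auto)
    next
      have "bounded (Z s ` {..T})" "bounded (Z 0 ` {..T})"
        by (rule bounded_subset[OF bdd], use T in auto)+
      then show "bounded ((\<lambda>t. Z s t - Z 0 t) ` {..T})" by (rule bounded_minus_comp)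
    qed
    then have 1: "norm (fst (Z s r - Z 0 r)) \<le> C * norm (snd (Z s r - Z 0 r))"
      and 2: "norm (snd (Z s r - Z 0 r)) \<le> C * exp (- c * (T - r)) * norm (snd (Z s T - Z 0 T))"
      using r unfolding cone_bound_def by blast+
    have "C * exp (- c * (T - r)) \<le> C * 1"
      using pos r by (intro mult_left_mono) auto
    then have "C * exp (- c * (T - r)) * norm (snd (Z s T - Z 0 T)) \<le> C * norm (Z s T - Z 0 T)"
      using pos norm_snd_le_norm[of "Z s T - Z 0 T"] by (intro mult_mono) auto
    then have 3: "norm (snd (Z s r - Z 0 r)) \<le> C * norm (Z s T - Z 0 T)" using 2 by linarith
    have "norm (Z s r - Z 0 r) \<le> (C + 1) * norm (snd (Z s r - Z 0 r))"
      using norm_le_fst_snd[of "Z s r - Z 0 r"] 1 by (simp add: algebra_simps)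
    also have "\<dots> \<le> (C + 1) * (C * norm (Z s T - Z 0 T))" using 3 pos by (intro mult_left_mono) auto
    finally show ?thesis by (simp add: K_def)
  qed
  have \<zeta>b: "norm (\<zeta> r) \<le> K * norm (\<zeta> T)" if r: "r \<le> T" for r
  proof (rule field_le_epsilon)
    fix e :: real assume e: "e > 0"
    \<comment> \<open>The bound on \<open>Z s - Z 0\<close> passes to \<zeta> by dividing by a small
      \<open>s\<close>; the errors at \<open>r\<close> and at \<open>T\<close> enter with the
      weights 1 and K.\<close>
    define e' where "e' = e / (1 + K)"
    have e': "e' > 0" using e K by (simp add: e'_def)
    have app: "\<exists>d>0. \<forall>s. \<bar>s\<bar> < d \<longrightarrow> norm (Z s t - Z 0 t - s *\<^sub>R \<zeta> t) \<le> e' * \<bar>s\<bar>" if "t \<le> 0" for t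
      using \<zeta>(3)[OF that] e' unfolding has_vector_derivative_def has_derivative_at_alt by fastforce
    have r0: "r \<le> 0" using r T by simp
    obtain d1 where d1: "d1 > 0" "\<And>s. \<bar>s\<bar> < d1 \<Longrightarrow> norm (Z s r - Z 0 r - s *\<^sub>R \<zeta> r) \<le> e' * \<bar>s\<bar>"
      using app[OF r0] by blast
    obtain d2 where d2: "d2 > 0" "\<And>s. \<bar>s\<bar> < d2 \<Longrightarrow> norm (Z s T - Z 0 T - s *\<^sub>R \<zeta> T) \<le> e' * \<bar>s\<bar>"
      using app[OF T(1)] by blast
    define s where "s = min s0 (min d1 d2) / 2"
    have s: "s > 0" "\<bar>s\<bar> < s0" "\<bar>s\<bar> < d1" "\<bar>s\<bar> < d2" using s0(1) d1(1) d2(1) by (auto simp: s_def)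
    have 1: "s * norm (\<zeta> r) \<le> e' * s + norm (Z s r - Z 0 r)"
      using d1(2)[OF s(3)] norm_triangle_sub[of "s *\<^sub>R \<zeta> r" "Z s r - Z 0 r"] s(1)
      by (simp add: norm_minus_commute)
    have 2: "norm (Z s T - Z 0 T) \<le> e' * s + s * norm (\<zeta> T)"
      using d2(2)[OF s(4)] norm_triangle_sub[of "Z s T - Z 0 T" "s *\<^sub>R \<zeta> T"] s(1) by simp
    have "K * norm (Z s T - Z 0 T) \<le> K * (e' * s + s * norm (\<zeta> T))"
      by (rule mult_left_mono[OF 2]) (use K in simp)
    then have "s * norm (\<zeta> r) \<le> s * (K * norm (\<zeta> T) + e' * (1 + K))"
      using 1 w[OF _ s(2) r] s(1) by (simp add: algebra_simps)
    then have "norm (\<zeta> r) \<le> K * norm (\<zeta> T) + e' * (1 + K)" using s(1) by simp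
    also have "e' * (1 + K) = e" using K by (simp add: e'_def)
    finally show "norm (\<zeta> r) \<le> K * norm (\<zeta> T) + e" .
  qed
  have "bounded (\<zeta> ` {..0})"
  proof -
    have "continuous_on {..0} \<zeta>"
      by (rule has_vector_derivative_imp_continuous_on[OF \<zeta>(2)]) simp
    then have "bounded (\<zeta> ` {T..0})"
      by (intro compact_imp_bounded compact_continuous_image) (auto intro: continuous_on_subset)
    moreover have "bounded (\<zeta> ` {..T})" using \<zeta>b by (auto simp: bounded_iff)
    ultimately have "bounded (\<zeta> ` ({..T} \<union> {T..0}))" by (simp add: image_Un)
    then show ?thesis by (rule bounded_subset) (intro image_mono, auto)
  qed
  then show ?thesis using that \<zeta> by (auto simp: lin_orbit_def)
qed

text \<open>Half-orbits in the definition of the tangent space end at time 0, so everything is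
  shifted by \<open>t\<close>. Uniqueness of bounded orbits makes \<open>Z 0\<close> the shifted
  trajectory, along which the linearization is then taken.\<close>

lemma tangent_lin_orbit:
  fixes Z :: "real \<Rightarrow> real \<Rightarrow> (real^'n) \<times> (real^'n)"
  assumes z: "solves_on ham z {..0}" "(z \<longlongrightarrow> 0) at_bot" and t: "t \<le> 0"
    and sol: "\<And>s. solves_on ham (Z s) {..0}" and lim: "\<And>s. (Z s \<longlongrightarrow> 0) at_bot"
    and unif: "uniform_limit {..0} Z (Z 0) (at 0)" and Z0: "Z 0 0 = z t"
    and \<xi>: "((\<lambda>s. Z s 0) has_vector_derivative \<xi>) (at 0)"
  obtains \<zeta> where "\<zeta> t = \<xi>" "lin_orbit z t \<zeta>"
proof -
  obtain \<zeta> where \<zeta>: "\<zeta> 0 = \<xi>" "lin_orbit (Z 0) 0 \<zeta>"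
    using variation_bounded[OF sol lim unif \<xi>] by metis
  have im: "(\<lambda>r. r + a) ` {..b} = {..b + a}" for a b :: real
    by (auto simp: image_iff intro!: bexI[of _ "_ - a"])
  have shift: "((f \<circ> (\<lambda>r. r + a)) has_vector_derivative D) (at r within {..b})"
    if "(f has_vector_derivative D) (at (r + a) within {..b + a})"
    for f :: "real \<Rightarrow> (real^'n) \<times> (real^'n)" and D a b r
  proof -
    have "((\<lambda>r. r + a) has_vector_derivative 1) (at r within {..b})"
      by (auto intro!: derivative_eq_intros)
    from vector_diff_chain_within[OF this, of f D] that show ?thesis by (simp add: im)
  qed
  have zt: "solves_on ham (\<lambda>r. z (r + t)) {..0}"
    unfolding solves_on_def
  proof
    fix r :: real assume r: "r \<in> {..0}"
    have "(z has_vector_derivative ham (z (r + t))) (at (r + t) within {..0 + t})"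
      using z(1) r t by (auto simp: solves_on_def intro: has_vector_derivative_within_subset)
    from shift[OF this] show "((\<lambda>r. z (r + t)) has_vector_derivative ham (z (r
        + t))) (at r within {..0})"
      by (simp add: o_def)
  qed
  have "bounded (z ` {..0})"
    by (rule bounded_image_atMost_of_limit[OF solves_on_continuous_on[OF z(1)] z(2)])
  then have bz: "bounded ((\<lambda>r. z (r + t)) ` {..0})"
    by (rule bounded_subset) (use t in auto)
  have bZ: "bounded (Z 0 ` {..0})"
    by (rule bounded_image_atMost_of_limit[OF solves_on_continuous_on[OF sol] lim])
  have eq: "Z 0 r = z (r + t)" if "r \<le> 0" for r
    by (rule ham_unique[OF sol bZ zt bz _ that]) (simp add: Z0)
  show ?thesis
  proof (rule that[of "\<lambda>r. \<zeta> (r + - t)"])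
    show "\<zeta> (t + - t) = \<xi>" by (simp add: \<zeta>)
    show "lin_orbit z t (\<lambda>r. \<zeta> (r + - t))"
      unfolding lin_orbit_def
    proof (intro conjI allI impI)
      fix r assume r: "r \<le> t"
      have "(\<zeta> has_vector_derivative dham (Z 0 (r + - t)) (\<zeta> (r + - t))) (at (r + - t) within {..t
          + - t})"
        using \<zeta>(2) r by (auto simp: lin_orbit_def)
      from shift[OF this] show "((\<lambda>r. \<zeta> (r + - t)) has_vector_derivative dham (z r) (\<zeta> (r +
          - t))) (at r within {..t})"
        using eq[of "r + - t"] r by (simp add: o_def)
    next
      have "bounded (\<zeta> ` {..0})" using \<zeta>(2) by (simp add: lin_orbit_def)
      then show "bounded ((\<lambda>r. \<zeta> (r + - t)) ` {..t})" by (rule bounded_subset) auto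
    qed
  qed
qed

end

section \<open>Minimality of trajectories without conjugate points\<close>

lemma transpose_eqI:
  fixes R :: "real^'n^'n"
  assumes "\<And>a b. (R *v a) \<bullet> b = a \<bullet> (R *v b)"
  shows "transpose R = R"
proof -
  have "transpose R *v a = R *v a" for a
  proof (rule vector_eq_rdot[THEN iffD1], rule allI)
    fix b show "(transpose R *v a) \<bullet> b = (R *v a) \<bullet> b"
      by (simp only: transpose_inner assms)
  qed
  then show ?thesis by (simp only: matrix_eq) simp
qed

lemma zero_of_exp_decay:
  fixes a :: real
  assumes "c > 0" "\<And>r. r \<le> T \<Longrightarrow> \<bar>a\<bar> \<le> K * exp (- c * (T - r))"
  shows "a = 0"
proof (rule ccontr)
  assume "a \<noteq> 0"
  then have a: "\<bar>a\<bar> > 0" by simp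
  have K: "K > 0" using assms(2)[of T] a by simp
  define r where "r = T - K / (c * \<bar>a\<bar>)"
  have r: "r \<le> T" using K a assms(1) by (simp add: r_def)
  have "exp (c * (T - r)) * \<bar>a\<bar> \<le> exp (c * (T - r)) * (K * exp (- c * (T - r)))"
    by (rule mult_left_mono[OF assms(2)[OF r]]) simp
  also have "\<dots> = K" by (simp add: exp_minus)
  finally have "exp (c * (T - r)) * \<bar>a\<bar> \<le> K" .
  moreover have "(1 + c * (T - r)) * \<bar>a\<bar> \<le> exp (c * (T - r)) * \<bar>a\<bar>"
    using exp_ge_add_one_self[of "c * (T - r)"] a by (intro mult_right_mono) auto
  moreover have "(1 + c * (T - r)) * \<bar>a\<bar> = \<bar>a\<bar> + K" using a assms(1)
    by (simp add: r_def field_simps)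
  ultimately show False using a by simp
qed

text \<open>Hypothesis \<open>full\<close> is the absence of conjugate points: every vector of the
  plane is the position at time \<open>t\<close> of a bounded solution. The matrices
  \<open>U\<close> and \<open>P\<close> are built from solutions chosen at time 0 only; fullness at
  earlier times makes \<open>U\<close> invertible there.\<close>

lemma full_tangent_imp_local_minimizer:
  fixes F :: "real^2 \<Rightarrow> real^2" and z :: "real \<Rightarrow> (real^2) \<times> (real^2)"
  assumes hyp: "hyperbolic_field F J J' Q X q x"
    and z: "solves_on (C2_field.ham F J) z {..0}" "(z \<longlongrightarrow> 0) at_bot"
    and full: "\<And>t u. t \<le> 0 \<Longrightarrow> \<exists>\<zeta>. C2_field.lin_orbit J J' z t \<zeta> \<and> fst (\<zeta> t) = u"
  shows "local_minimizer F (\<lambda>t. fst (z t))"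
proof -
  interpret hyperbolic_field F J J' Q X q x by (rule hyp)
  define \<phi> p where "\<phi> t = fst (z t)" and "p t = snd (z t)" for t
  have zc: "continuous_on {..0} z" by (rule solves_on_continuous_on[OF z(1)])
  obtain r0 where r0: "r0 > 0" "\<And>t. t \<le> 0 \<Longrightarrow> norm (z t) \<le> r0"
    using bounded_image_atMost_of_limit[OF zc z(2)] by (auto simp: bounded_pos)
  obtain L where L: "L > 0" "\<And>a. norm a \<le> r0 \<Longrightarrow> norm (dham a) \<le> L"
    using C1_lipschitz_cball[OF ham_has_derivative dham_continuous] by metis
  have zder: "(z has_vector_derivative ham (z t)) (at t within {..0})" if "t \<le> 0" for t
    using z(1) that by (simp add: solves_on_def)
  have d\<phi>: "(\<phi> has_vector_derivative F (\<phi> t) + p t) (at t within {..0})" if "t \<le> 0" for t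
    using bounded_linear.has_vector_derivative[OF bounded_linear_fst zder[OF that]]
    by (simp add: \<phi>_def[abs_def] p_def ham_def)
  have dp: "(p has_vector_derivative - (transpose (J (\<phi> t)) *v p t)) (at t within {..0})"
    if "t \<le> 0" for t
    using bounded_linear.has_vector_derivative[OF bounded_linear_snd zder[OF that]]
    by (simp add: \<phi>_def p_def[abs_def] ham_def)
  define Jt where "Jt t = J (\<phi> t)" for t
  \<comment> \<open>The Hessian of x \<mapsto> p \<bullet> F(x) along the trajectory, through which
    the variation of the position drives that of the momentum.\<close>
  define S where "S t = matrix (\<lambda>u. p t v* J' (\<phi> t) u)" for t
  have Sv: "S t *v u = p t v* J' (\<phi> t) u" for t u
  proof -
    have "bounded_linear (\<lambda>u. p t v* J' (\<phi> t) u)"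
      by (rule bounded_linear_compose[OF bounded_bilinear.bounded_linear_right[OF bounded_bilinear_vector_matrix_mult]
            blinfun.bounded_linear_right])
    then show ?thesis
      unfolding S_def using bounded_linear.linear
        by (intro matrix_works) (auto simp: linear_matrix_vector_mul_eq)
  qed
  have Sinner: "u \<bullet> (S t *v w) = p t \<bullet> (J' (\<phi> t) w *v u)" for t u w
    by (simp add: Sv inner_commute[of u] vm_inner)
  have symS: "transpose (S t) = S t" for t
    by (rule transpose_eqI) (simp add: Sinner inner_commute[of "S t *v _"] J'_symmetric)
  have dhamv: "dham (z t) w = (Jt t *v fst w + snd w, - (transpose (Jt t) *v snd w)
      - S t *v fst w)" for t w
    by (simp add: dham_apply dham_fun_def Jt_def Sv \<phi>_def p_def)
  have bJ: "norm (Jt t *v y) \<le> L * norm y" and bJT: "norm (transpose (Jt t) *v y) \<le> L * norm y"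
    and bS: "norm (S t *v y) \<le> L * norm y" if t: "t \<le> 0" for t y
  proof -
    have D: "norm (dham (z t) w) \<le> L * norm w" for w
      using norm_blinfun[of "dham (z t)" w] mult_right_mono[OF L(2)[OF r0(2)[OF t]] norm_ge_zero[of w]] by linarith
    show "norm (Jt t *v y) \<le> L * norm y"
      using norm_fst_le_norm[of "dham (z t) (y, 0)"] D[of "(y, 0)"] by (simp add: dhamv)
    show "norm (S t *v y) \<le> L * norm y"
      using norm_snd_le_norm[of "dham (z t) (y, 0)"] D[of "(y, 0)"] by (simp add: dhamv)
    show "norm (transpose (Jt t) *v y) \<le> L * norm y"
      using norm_snd_le_norm[of "dham (z t) (0, y)"] D[of "(0, y)"]
      by (simp add: dhamv del: transpose_matrix_vector)
  qed
  obtain nX where nX: "nX > 0" "\<And>v. norm (X *v v) \<le> norm v * nX"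
    using bounded_linear.pos_bounded[OF matrix_vector_mul_bounded_linear[of X]] by blast
  obtain \<sigma> C c where pos: "\<sigma> > 0" "C > 0" "c > 0" and cone:
    "\<And>w w' T. (\<And>t. t \<le> T \<Longrightarrow> (w has_vector_derivative w' t) (at t within {..T})) \<Longrightarrow>
      (\<And>t. t \<le> T \<Longrightarrow> norm (w' t - dham 0 (w t)) \<le> \<sigma> * norm (w t)) \<Longrightarrow> bounded (w ` {..T}) \<Longrightarrow>
      cone_bound C c T w"
    using cone_phase by metis
  \<comment> \<open>Chosen so that, near the origin, replacing the linearization along the
    trajectory by the one at the origin costs at most |v|^2 / 4 in the pairing with X v.\<close>
  define \<sigma>' where "\<sigma>' = 1 / (4 * nX * (1 + C))"
  have \<sigma>': "\<sigma>' > 0" using nX pos by (simp add: \<sigma>'_def add_pos_pos)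
  obtain T0 where T0: "T0 \<le> 0" "\<And>t. t \<le> T0 \<Longrightarrow> norm (dham (z t) - dham 0) \<le> min \<sigma> \<sigma>'"
  proof -
    have "isCont dham 0"
      using dham_continuous continuous_on_eq_continuous_at[OF open_UNIV, of dham] by blast
    from isCont_tendsto_compose[OF this z(2)]
    have "((\<lambda>t. dham (z t)) \<longlongrightarrow> dham 0) at_bot" .
    from tendstoD[OF this, of "min \<sigma> \<sigma>'"] obtain T where "\<And>t. t \<le> T \<Longrightarrow> dist (dham (z t)) (dham 0)
        < min \<sigma> \<sigma>'"
      using pos \<sigma>' by (auto simp: eventually_at_bot_linorder)
    then show ?thesis using that[of "min T 0"] by (auto simp: dist_norm intro: less_imp_le)
  qed
  have lcone: "cone_bound C c T \<zeta>" if \<zeta>: "lin_orbit z T \<zeta>" and T: "T \<le> T0" for \<zeta> T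
  proof (rule cone)
    fix r assume r: "r \<le> T"
    show "(\<zeta> has_vector_derivative dham (z r) (\<zeta> r)) (at r within {..T})"
      using \<zeta> r by (simp add: lin_orbit_def)
    have "norm ((dham (z r) - dham 0) (\<zeta> r)) \<le> norm (dham (z r) - dham 0) * norm (\<zeta> r)"
      by (rule norm_blinfun)
    also have "\<dots> \<le> \<sigma> * norm (\<zeta> r)" using T0(2)[of r] r T by (intro mult_right_mono) auto
    finally show "norm (dham (z r) (\<zeta> r) - dham 0 (\<zeta> r)) \<le> \<sigma> * norm (\<zeta> r)"
      by (simp add: blinfun.diff_left)
  qed (use \<zeta> in \<open>simp add: lin_orbit_def\<close>)
  have "\<forall>i :: 2. \<exists>\<zeta>. lin_orbit z 0 \<zeta> \<and> fst (\<zeta> 0) = axis i 1"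
    using full[OF order_refl] by blast
  then obtain \<zeta> where \<zeta>: "\<And>i :: 2. lin_orbit z 0 (\<zeta> i)" "\<And>i. fst (\<zeta> i 0) = axis i 1"
    by metis
  \<comment> \<open>The columns of \<open>(U, P)\<close> are bounded solutions whose positions at
    time 0 are the unit vectors, so \<open>U 0\<close> is the identity and \<open>\<zeta>' c\<close>
    has the position \<open>c\<close> at time 0.\<close>
  define U where "U t = (\<chi> i j. fst (\<zeta> j t) $ i)" for t
  define P where "P t = (\<chi> i j. snd (\<zeta> j t) $ i)" for t
  define \<zeta>' where "\<zeta>' c t = c $ 1 *\<^sub>R \<zeta> 1 t + c $ 2 *\<^sub>R \<zeta> 2 t" for c :: "real^2" and t
  have \<zeta>'_eq: "\<zeta>' c t = (U t *v c, P t *v c)" for c t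
    by (rule prod_eqI)
      (simp_all add: \<zeta>'_def U_def P_def vec_eq_iff matrix_vector_mult_def sum_2 mult.commute)
  have \<zeta>': "lin_orbit z 0 (\<zeta>' c)" for c
    unfolding \<zeta>'_def by (intro lin_orbit_add lin_orbit_scaleR \<zeta>)
  have U0: "U 0 = mat 1"
    by (simp add: U_def \<zeta>(2) vec_eq_iff mat_def axis_def eq_commute)
  have \<zeta>'d: "(\<zeta>' c has_vector_derivative dham (z t) (\<zeta>' c t)) (at t within {..0})" if "t \<le> 0"
    for c t
    using \<zeta>'[of c] that by (simp add: lin_orbit_def)
  have dUc: "((\<lambda>t. U t *v c) has_vector_derivative Jt t *v (U t *v c)
      + P t *v c) (at t within {..0})"
    and dPc: "((\<lambda>t. P t *v c) has_vector_derivative - (transpose (Jt t) *v (P t *v c))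
        - S t *v (U t *v c)) (at t within {..0})"
    if "t \<le> 0" for c t
    using bounded_linear.has_vector_derivative[OF bounded_linear_fst \<zeta>'d[OF that, of c]]
      bounded_linear.has_vector_derivative[OF bounded_linear_snd \<zeta>'d[OF that, of c]]
    by (simp_all add: \<zeta>'_eq[abs_def] dhamv del: transpose_matrix_vector)
  have dU: "(U has_vector_derivative Jt t ** U t + P t) (at t within {..0})" if "t \<le> 0" for t
    by (rule has_vector_derivative_matrixI)
      (use dUc[OF that] in \<open>simp add: matrix_vector_mult_add_rdistrib matrix_vector_mul_assoc[symmetric]\<close>)
  have dP: "(P has_vector_derivative - (transpose (Jt t) ** P t)
      - S t ** U t) (at t within {..0})" if "t \<le> 0" for t
    by (rule has_vector_derivative_matrixI)
      (use dPc[OF that] in \<open>simp add: matrix_vector_mult_diff_rdistrib matrix_vector_minus_left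
        matrix_vector_mul_assoc[symmetric] del: transpose_matrix_vector\<close>)
  have inj0: "c = 0" if t: "t \<le> T0" and c: "P t *v c = 0" for t c
  proof -
    have "lin_orbit z t (\<zeta>' c)" by (rule lin_orbit_subset[OF \<zeta>']) (use t T0 in simp)
    from lcone[OF this t] have "norm (fst (\<zeta>' c t)) \<le> C * norm (snd (\<zeta>' c t))"
      by (simp add: cone_bound_def)
    then have "\<zeta>' c t = 0" using c by (simp add: \<zeta>'_eq zero_prod_def)
    from lin_orbit_zero_forward[OF zc \<zeta>' _ this] have "\<zeta>' c 0 = 0" using t T0 by simp
    then show "c = 0" by (simp add: \<zeta>'_eq U0 zero_prod_def)
  qed
  \<comment> \<open>near \<open>-\<infinity>\<close> the momentum determines a bounded solution, so these solutions form a space of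
    dimension two, which is spanned by the columns of \<open>(U, P)\<close>\<close>
  have detU: "det (U t) \<noteq> 0" if t: "t \<le> 0" for t
  proof -
    have "\<exists>c. U t *v c = u" for u
    proof -
      obtain \<eta> where \<eta>: "lin_orbit z t \<eta>" "fst (\<eta> t) = u" using full[OF t] by blast
      define T1 where "T1 = min t T0"
      have T1: "T1 \<le> t" "T1 \<le> T0" by (auto simp: T1_def)
      have "\<exists>B. B ** P T1 = mat 1"
        unfolding matrix_left_invertible_ker using inj0[OF T1(2)] by blast
      then have "\<exists>B. P T1 ** B = mat 1" by (simp add: matrix_left_right_inverse)
      then obtain B where B: "P T1 ** B = mat 1" by blast
      define c where "c = B *v snd (\<eta> T1)"
      have Pc: "P T1 *v c = snd (\<eta> T1)" by (simp add: c_def matrix_vector_mul_assoc B)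
      \<comment> \<open>By the choice of \<open>c\<close> the difference has no momentum at
        \<open>T1\<close>; the cone then forces its position to vanish there as well, and uniqueness
        forward in time carries this to \<open>t\<close>.\<close>
      define \<omega> where "\<omega> r = \<eta> r + (- 1) *\<^sub>R \<zeta>' c r" for r
      have \<omega>: "lin_orbit z t \<omega>"
        unfolding \<omega>_def by (intro lin_orbit_add lin_orbit_scaleR \<eta> lin_orbit_subset[OF \<zeta>'] t)
      have "lin_orbit z T1 \<omega>" by (rule lin_orbit_subset[OF \<omega> T1(1)])
      from lcone[OF this T1(2)] have "norm (fst (\<omega> T1)) \<le> C * norm (snd (\<omega> T1))"
        by (simp add: cone_bound_def)
      moreover have "snd (\<omega> T1) = 0" by (simp add: \<omega>_def \<zeta>'_eq Pc)
      ultimately have "\<omega> T1 = 0" by (simp add: prod_eq_iff)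
      from lin_orbit_zero_forward[OF continuous_on_subset[OF zc] \<omega> T1(1) this]
      have "\<omega> t = 0" using t by simp
      then have "fst (\<eta> t) = fst (\<zeta>' c t)" by (simp add: \<omega>_def)
      then show ?thesis using \<eta> by (auto simp: \<zeta>'_eq)
    qed
    then have "surj ((*v) (U t))" unfolding surj_def by metis
    then have "\<exists>B. U t ** B = mat 1" by (simp add: matrix_right_invertible_surjective)
    then show ?thesis by (simp add: invertible_right_inverse[symmetric] invertible_det_nz)
  qed
  \<comment> \<open>the symplectic form is constant along the flow and vanishes at \<open>-\<infinity>\<close>\<close>
  have lagr: "(U t *v a) \<bullet> (P t *v b) = (P t *v a) \<bullet> (U t *v b)" if t: "t \<le> 0" for t a b
  proof -
    define \<omega> where "\<omega> t = (U t *v a) \<bullet> (P t *v b) - (P t *v a) \<bullet> (U t *v b)" for t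
    have d\<omega>: "(\<omega> has_vector_derivative 0) (at t within {..0})" if t: "t \<le> 0" for t
    proof -
      note ip = bounded_bilinear.has_vector_derivative[OF bounded_bilinear_inner]
      have "(\<omega> has_vector_derivative
          ((U t *v a) \<bullet> (- (transpose (Jt t) *v (P t *v b)) - S t *v (U t *v b)) + (Jt t *v (U t *v a) + P t *v a) \<bullet> (P t *v b))
        - ((P t *v a) \<bullet> (Jt t *v (U t *v b) + P t *v b) + (- (transpose (Jt t) *v (P t *v a)) - S t *v (U t *v a)) \<bullet> (U t *v b)))
        (at t within {..0})"
        unfolding \<omega>_def by (intro has_vector_derivative_diff ip dUc dPc t)
      moreover have "(U t *v a) \<bullet> (transpose (Jt t) *v (P t *v b)) = (P t *v b)
          \<bullet> (Jt t *v (U t *v a))"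
        by (simp only: inner_commute[of "U t *v a"] transpose_inner)
      moreover have "(transpose (Jt t) *v (P t *v a)) \<bullet> (U t *v b) = (P t *v a)
          \<bullet> (Jt t *v (U t *v b))"
        by (rule transpose_inner)
      moreover have "(S t *v (U t *v a)) \<bullet> (U t *v b) = (U t *v a) \<bullet> (S t *v (U t *v b))"
        by (rule symmetric_matrix_inner[OF symS])
      ultimately show ?thesis
        by (simp add: inner_diff_left inner_diff_right inner_add_left inner_add_right
            inner_commute[of "P t *v b"] del: transpose_matrix_vector)
    qed
    have "\<exists>k. \<forall>t\<in>{..0}. \<omega> t = k"
      by (rule has_field_derivative_zero_constant)
        (use d\<omega> in \<open>auto simp: has_real_derivative_iff_has_vector_derivative\<close>)
    then obtain k where k: "\<And>t. t \<le> 0 \<Longrightarrow> \<omega> t = k" by auto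
    define K where "K = 2 * C * (C * norm (P T0 *v a)) * (C * norm (P T0 *v b))"
    have "k = 0"
    proof (rule zero_of_exp_decay[OF pos(3)])
      fix r assume r: "r \<le> T0"
      define E where "E = exp (- c * (T0 - r))"
      have E: "E \<ge> 0" "E \<le> 1" using r pos by (auto simp: E_def)
      have est: "norm (U r *v a) \<le> C * norm (P r *v a)" "norm (P r *v a) \<le> C * E
          * norm (P T0 *v a)" for a
      proof -
        have "lin_orbit z T0 (\<zeta>' a)" by (rule lin_orbit_subset[OF \<zeta>' T0(1)])
        from lcone[OF this order_refl] r
        have "norm (fst (\<zeta>' a r)) \<le> C * norm (snd (\<zeta>' a r))" "norm (snd (\<zeta>' a r)) \<le> C * E
            * norm (snd (\<zeta>' a T0))"
          unfolding E_def cone_bound_def by blast+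
        then show "norm (U r *v a) \<le> C * norm (P r *v a)" "norm (P r *v a) \<le> C * E
            * norm (P T0 *v a)"
          by (simp_all add: \<zeta>'_eq)
      qed
      let ?a = "norm (P r *v a)" and ?b = "norm (P r *v b)"
      have "\<bar>\<omega> r\<bar> \<le> \<bar>(U r *v a) \<bullet> (P r *v b)\<bar> + \<bar>(P r *v a) \<bullet> (U r *v b)\<bar>"
        unfolding \<omega>_def by (rule abs_triangle_ineq4)
      also have "\<dots> \<le> norm (U r *v a) * ?b + ?a * norm (U r *v b)"
        by (intro add_mono Cauchy_Schwarz_ineq2)
      also have "\<dots> \<le> (C * ?a) * ?b + ?a * (C * ?b)"
        using est(1) by (intro add_mono mult_right_mono mult_left_mono) auto
      also have "\<dots> = 2 * C * (?a * ?b)" by simp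
      also have "\<dots> \<le> 2 * C * ((C * E * norm (P T0 *v a)) * (C * 1 * norm (P T0 *v b)))"
      proof (rule mult_left_mono)
        have "?b \<le> C * E * norm (P T0 *v b)" by (rule est)
        also have "\<dots> \<le> C * 1 * norm (P T0 *v b)" using E pos
          by (intro mult_right_mono mult_left_mono) auto
        finally show "?a * ?b \<le> (C * E * norm (P T0 *v a)) * (C * 1 * norm (P T0 *v b))"
          using est(2) E pos by (intro mult_mono) auto
      qed (use pos in simp)
      also have "\<dots> = K * exp (- c * (T0 - r))" by (simp add: K_def E_def)
      finally show "\<bar>k\<bar> \<le> K * exp (- c * (T0 - r))" using k[of r] r T0 by simp
    qed
    then show ?thesis using k[OF t] by (simp add: \<omega>_def)
  qed
  define R where "R t = P t ** inv2 (U t)" for t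
  define R' where "R' t = - (transpose (Jt t) ** R t) - S t - R t ** Jt t - R t ** R t" for t
  have dR: "(R has_vector_derivative R' t) (at t within {..0})" if "t \<le> 0" for t
    unfolding R_def R'_def
      by (rule Riccati_of_Jacobi[where U = U and P = P and Jt = Jt and S = S and t = t, OF dU[OF that] dP[OF that] detU[OF that]])
  have Rv: "R t *v y = P t *v (inv2 (U t) *v y)" for t y
    by (simp add: R_def matrix_vector_mul_assoc)
  have Uinv: "U t *v (inv2 (U t) *v y) = y" if "t \<le> 0" for t y
    by (simp add: matrix_vector_mul_assoc inv2_mult(1)[OF detU[OF that]])
  \<comment> \<open>The vanishing of the symplectic form on the columns, expressed in terms of
    positions, is the symmetry of \<open>R\<close>.\<close>
  have symR: "transpose (R t) = R t" if t: "t \<le> 0" for t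
  proof (rule transpose_eqI)
    fix a b
    show "(R t *v a) \<bullet> b = a \<bullet> (R t *v b)"
      using lagr[OF t, of "inv2 (U t) *v a" "inv2 (U t) *v b"] by (simp add: Rv Uinv[OF t])
  qed
  have Rcone: "norm (R t *v y) \<le> C * norm y" "norm y \<le> C * norm (R t *v y)" if t: "t \<le> T0" for t y
  proof -
    have t0: "t \<le> 0" using t T0 by simp
    have "lin_orbit z t (\<zeta>' (inv2 (U t) *v y))" by (rule lin_orbit_subset[OF \<zeta>' t0])
    from lcone[OF this t]
    show "norm (R t *v y) \<le> C * norm y" "norm y \<le> C * norm (R t *v y)"
      by (auto simp: cone_bound_def \<zeta>'_eq Rv Uinv[OF t0])
  qed
  have \<phi>c: "continuous_on {..0} \<phi>" and pc: "continuous_on {..0} p" and Rc: "continuous_on {..0} R"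
    by (rule has_vector_derivative_imp_continuous_on[OF d\<phi>], simp)
      (rule has_vector_derivative_imp_continuous_on[OF dp], simp,
       rule has_vector_derivative_imp_continuous_on[OF dR], simp)
  have Jtc: "continuous_on {..0} Jt"
    unfolding Jt_def by (rule continuous_on_compose2[OF J_continuous_on[of UNIV] \<phi>c]) simp
  have J'c: "continuous_on {..0} (\<lambda>t. J' (\<phi> t))"
    by (rule continuous_on_compose2[OF J'_cont \<phi>c]) simp
  have Sc: "continuous_on {..0} S"
    by (rule continuous_on_matrixI) (unfold Sv, intro continuous_intros pc J'c)
  have JTc: "continuous_on {..0} (\<lambda>t. transpose (Jt t))"
    by (rule continuous_on_matrixI) (simp, intro continuous_intros Jtc)
  have R'c: "continuous_on {..0} R'"
    unfolding R'_def
    by (intro continuous_on_diff continuous_on_minus JTc Sc Rc Jtc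
        bounded_bilinear.continuous_on[OF bounded_bilinear_matrix_matrix_mult])
  \<comment> \<open>Near -\<infinity> the cone bounds \<open>R\<close>; the remaining interval is
    compact.\<close>
  obtain bR where bR: "bR > 0" "\<And>t y. t \<le> 0 \<Longrightarrow> norm (R t *v y) \<le> bR * norm y"
  proof -
    obtain B where B: "B > 0" "\<And>A v. norm ((A :: real^2^2) *v v) \<le> norm A * norm v * B"
      using bounded_bilinear.pos_bounded[OF bounded_bilinear_matrix_vector_mult] by blast
    have "bounded (R ` {T0..0})"
      by (intro compact_imp_bounded compact_continuous_image continuous_on_subset[OF Rc]) auto
    then obtain N where N: "N > 0" "\<And>t. t \<in> {T0..0} \<Longrightarrow> norm (R t) \<le> N" by (auto simp: bounded_pos)
    have "norm (R t *v y) \<le> (C + N * B) * norm y" if t: "t \<le> 0" for t y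
    proof (cases "t \<le> T0")
      case True
      have "0 \<le> N * B * norm y" using N B by simp
      then show ?thesis using Rcone(1)[OF True, of y] by (simp add: distrib_right)
    next
      case False
      then have "norm (R t) \<le> N" using t by (intro N) simp
      then have "norm (R t) * norm y * B \<le> N * norm y * B" using B by (intro mult_right_mono) auto
      moreover have "0 \<le> C * norm y" using pos by simp
      moreover have "(C + N * B) * norm y = C * norm y + N * norm y * B"
        by (simp add: algebra_simps)
      ultimately show ?thesis using B(2)[of "R t" y] by linarith
    qed
    then show ?thesis using that[of "C + N * B"] pos N B by (simp add: add_pos_pos)
  qed
  define b where "b = 1 + bR + L + nX"
  have b: "b \<ge> 1" "bR \<le> b" "L \<le> b" "nX \<le> b" using bR L nX by (auto simp: b_def)
  have le_b: "norm v \<le> b * norm y" if "norm v \<le> k * norm y" "k \<le> b" for v y :: "real^2" and k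
    using that mult_right_mono[OF that(2) norm_ge_zero[of y]] by linarith
  \<comment> \<open>For v = R y and the linearization at the origin, the Lyapunov equation of
    \<open>X\<close> makes the right-hand side equal to |v|^2. The deviation takes at most half, and
    |y| \<le> C |v| converts the rest.\<close>
  have near: "1 / (2 * C\<^sup>2) * (norm y)\<^sup>2 \<le> 2 * ((X *v (R t *v y))
      \<bullet> (- (transpose (Jt t) *v (R t *v y)) - S t *v y))"
    if t: "t \<le> T0" for t y
  proof -
    define v where "v = R t *v y"
    define e where "e = snd ((dham (z t) - dham 0) (y, v))"
    have eq: "- (transpose (Jt t) *v v) - S t *v y = - (transpose (J 0) *v v) + e"
      by (simp add: e_def blinfun.diff_left dhamv dham_zero del: transpose_matrix_vector)
    have yv: "norm y \<le> C * norm v" unfolding v_def by (rule Rcone(2)[OF t])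
    have "norm e \<le> norm (dham (z t) - dham 0) * norm (y, v)"
      unfolding e_def by (rule order_trans[OF norm_snd_le_norm norm_blinfun])
    also have "\<dots> \<le> \<sigma>' * ((1 + C) * norm v)"
      using T0(2)[OF t] norm_le_fst_snd[of "(y, v)"] yv \<sigma>'
        by (intro mult_mono) (auto simp: algebra_simps)
    finally have e: "norm e \<le> \<sigma>' * ((1 + C) * norm v)" .
    have "2 * ((X *v v) \<bullet> (- (transpose (J 0) *v v))) = (norm v)\<^sup>2"
    proof -
      have "v \<bullet> ((J 0 ** X + X ** transpose (J 0)) *v v) = - (norm v)\<^sup>2"
        unfolding X(2) by (simp add: matrix_vector_minus_left power2_norm_eq_inner)
      moreover have "v \<bullet> (J 0 *v (X *v v)) = (X *v v) \<bullet> (transpose (J 0) *v v)"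
        by (simp only: inner_commute[of "X *v v"] transpose_inner)
      moreover have "v \<bullet> (X *v (transpose (J 0) *v v)) = (X *v v) \<bullet> (transpose (J 0) *v v)"
        by (rule symmetric_matrix_inner[OF X(1), symmetric])
      ultimately show ?thesis
        by (simp add: matrix_vector_mult_add_rdistrib matrix_vector_mul_assoc[symmetric] inner_add_right
            del: transpose_matrix_vector)
    qed
    moreover have "\<bar>(X *v v) \<bullet> e\<bar> \<le> (norm v)\<^sup>2 / 4"
    proof -
      have "\<bar>(X *v v) \<bullet> e\<bar> \<le> norm (X *v v) * norm e" by (rule Cauchy_Schwarz_ineq2)
      also have "\<dots> \<le> (norm v * nX) * (\<sigma>' * ((1 + C) * norm v))"
        using nX by (intro mult_mono nX e) auto
      also have "\<dots> = (norm v)\<^sup>2 / 4"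
      proof -
        have "nX * \<sigma>' * (1 + C) = 1 / 4" using nX(1) pos(2) by (simp add: \<sigma>'_def)
        moreover have "(norm v * nX) * (\<sigma>' * ((1 + C) * norm v)) = (nX * \<sigma>' * (1 + C)) * (norm v)\<^sup>2"
          by (simp add: power2_eq_square)
        ultimately show ?thesis by (simp only:)
      qed
      finally show ?thesis .
    qed
    ultimately have "(norm v)\<^sup>2 / 2 \<le> 2 * ((X *v v) \<bullet> (- (transpose (Jt t) *v v) - S t *v y))"
      unfolding eq inner_add_right abs_le_iff distrib_left by linarith
    moreover have "1 / (2 * C\<^sup>2) * (norm y)\<^sup>2 \<le> (norm v)\<^sup>2 / 2"
    proof -
      have "(norm y)\<^sup>2 \<le> (C * norm v)\<^sup>2" using yv by (intro power_mono) auto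
      then show ?thesis using pos by (simp add: power_mult_distrib field_simps)
    qed
    ultimately show ?thesis unfolding v_def by linarith
  qed
  have bX: "norm (X *v y) \<le> b * norm y" for y
    by (rule le_b[of _ nX]) (use nX(2)[of y] b in \<open>simp_all add: mult.commute\<close>)
  have c0: "1 / (2 * C\<^sup>2) > 0" using pos by simp
  obtain M M' \<mu> r where M: "\<mu> > 0" "r > 0"
    "\<And>t. t \<le> 0 \<Longrightarrow> (M has_vector_derivative M' t) (at t within {..0})"
    "continuous_on {..0} M'" "\<And>t. t \<le> 0 \<Longrightarrow> transpose (M t) = M t"
    "\<And>t y. t \<le> 0 \<Longrightarrow> norm (M t *v y) \<le> r * norm y"
    "\<And>t y. t \<le> 0 \<Longrightarrow> \<mu> * (norm y)\<^sup>2 \<le> - (y \<bullet> (M' t *v y)) - (norm (M t *v y))\<^sup>2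
      - 2 * ((M t *v y) \<bullet> (Jt t *v y)) - y \<bullet> (S t *v y)"
    using strict_Riccati_perturbation[where R = R and R' = R' and Jt = Jt and S = S and X = X and T\<^sub>0 = T0,
        OF dR R'_def R'c symR symS X(1) b(1) le_b[OF bR(2) b(2)] le_b[OF bJ b(3)] le_b[OF bJT b(3)]
          le_b[OF bS b(3)] bX c0 near] by metis
  define r' where "r' = r + r0"
  have "local_minimizer F \<phi>"
  proof (rule strict_Riccati_local_minimizer[OF _ F0 Q d\<phi> dp M(3,4,5), where r = r' and \<mu> = \<mu> and J' = J'])
    show "C2_field F J J'" by unfold_locales
    show "norm (\<phi> t) \<le> r'" if "t \<le> 0" for t
      using norm_fst_le_norm[of "z t"] r0(2)[OF that] M(2) by (simp add: \<phi>_def r'_def)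
    show "norm (p t) \<le> r'" if "t \<le> 0" for t
      using norm_snd_le_norm[of "z t"] r0(2)[OF that] M(2) by (simp add: p_def r'_def)
    show "norm (M t *v y) \<le> r' * norm y" if "t \<le> 0" for t y
      using M(6)[OF that, of y] mult_nonneg_nonneg[OF less_imp_le[OF r0(1)] norm_ge_zero[of y]]
      by (simp add: r'_def distrib_right)
    show "\<mu> > 0" by (rule M)
    show "r' > 0" using M(2) r0(1) by (simp add: r'_def)
    show "\<mu> * (norm y)\<^sup>2 \<le> - (y \<bullet> (M' t *v y)) - (norm (M t *v y))\<^sup>2
      - 2 * ((M t *v y) \<bullet> (J (\<phi> t) *v y)) - p t \<bullet> (J' (\<phi> t) y *v y)" if "t \<le> 0" for t y
      using M(7)[OF that, of y] by (simp add: Jt_def Sinner)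
    show "(\<phi> \<longlongrightarrow> 0) at_bot"
      unfolding \<phi>_def using tendsto_fst[OF z(2)] by simp
  qed
  then show ?thesis by (simp add: \<phi>_def[abs_def])
qed

section \<open>Hyperbolicity from attraction, and full tangent projections from index zero\<close>

lemma exp_attracting_imp_Hurwitz_2:
  fixes F :: "real^2 \<Rightarrow> real^2"
  assumes "C2_field F J J'" and F0: "F 0 = 0" and att: "exp_attracting F {0}"
  shows "trace (J 0) < 0" "det (J 0) > 0"
proof -
  interpret C2_field F J J' by (rule assms)
  define F' where "F' x = Blinfun ((*v) (J x))" for x
  have F': "blinfun_apply (F' x) = (*v) (J x)" for x
    unfolding F'_def by (rule bounded_linear_Blinfun_apply) simp
  have der: "(F has_derivative F' x) (at x)" for x using F_der by (simp add: F')
  have "continuous_on UNIV F'"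
    by (rule continuous_on_blinfun_componentwise) (unfold F', intro continuous_intros J_continuous_on)
  from exp_attracting_linear_decay[OF der this F0 att]
  obtain C \<kappa> where "C > 0" "\<kappa> > 0"
    "\<And>l T. 0 \<le> T \<Longrightarrow> solves_on ((*v) (J 0)) l {0..T} \<Longrightarrow> norm (l T) \<le> C * exp (- \<kappa> * T) * norm (l 0)"
    unfolding F' by metis
  from linear_decay_imp_Hurwitz_2[OF this] show "trace (J 0) < 0" "det (J 0) > 0" by auto
qed

text \<open>An index of zero does not exclude conjugate points of degeneracy zero, since the set \<open>tangent_Wu\<close> is
  not known to be a linear subspace.\<close>
lemma maslov_index_zero_span:
  assumes "maslov_index F I z = 0" "t \<in> I"
  shows "span (fst ` tangent_Wu F (z t)) = UNIV"
proof (cases "conjugate_point F z t")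
  case False
  then show ?thesis by (simp add: conjugate_point_def)
next
  case True
  let ?C = "{\<tau>\<in>I. conjugate_point F z \<tau>}"
  have fin: "finite ?C" and "(\<Sum>\<tau>\<in>?C. degeneracy F z \<tau>) = 0"
    using assms(1) by (auto simp: maslov_index_def Let_def zero_enat_def split: if_splits)
  then have "degeneracy F z t = 0"
    using True assms(2) by (simp add: sum_eq_0_iff[OF fin])
  \<comment> \<open>\<open>degeneracy\<close> is a truncated difference of natural numbers, so its
    vanishing gives only the lower bound for the dimension.\<close>
  then have "dim (fst ` tangent_Wu F (z t)) = 2"
    using dim_subset_UNIV[of "fst ` tangent_Wu F (z t)"] by (simp add: degeneracy_def)
  then show ?thesis by (simp add: dim_eq_full[symmetric])
qed

theorem theorem5p2:
  fixes F :: "real^2 \<Rightarrow> real^2" and \<Gamma> :: "(real^2) set" and M :: "phase set"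
    and h\<^sub>1 h\<^sub>2 K :: "real \<Rightarrow> phase" and \<theta>\<^sub>1 \<theta>\<^sub>2 :: real
  assumes smooth: "smooth F"
    and A1: "exp_attracting F {0}" "\<And>x. F x = 0 \<longleftrightarrow> x = 0"
    and A2: "periodic_orbit F \<Gamma>" "exp_repelling F \<Gamma>" "0 \<in> inside \<Gamma>"
      "\<And>\<Gamma>'. periodic_orbit F \<Gamma>' \<Longrightarrow> \<not> \<Gamma>' \<subseteq> inside \<Gamma>"
    and A3: "heteroclinic F \<Gamma> h\<^sub>1" "heteroclinic F \<Gamma> h\<^sub>2"
      "transversal_along F \<Gamma> h\<^sub>1" "transversal_along F \<Gamma> h\<^sub>2"
    and A4: "maslov_index F UNIV h\<^sub>1 = 0" "maslov_index F UNIV h\<^sub>2 = 1"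
    and K: "local_unstable_manifold F M" "surrounding_curve M K" "angle_param F K"
    and angles: "0 \<le> \<theta>\<^sub>1" "\<theta>\<^sub>1 < \<theta>\<^sub>2" "\<theta>\<^sub>2 < 2 * pi" "K \<theta>\<^sub>1 \<in> range h\<^sub>1" "K \<theta>\<^sub>2 \<in> range h\<^sub>2"
    and A5: "\<And>\<theta>. \<theta>\<^sub>1 < \<theta> \<Longrightarrow> \<theta> < \<theta>\<^sub>2 \<Longrightarrow> crosses F \<Gamma> K \<theta>"
  shows "\<forall>z \<in> sub_river F \<Gamma> K \<theta>\<^sub>1 \<theta>\<^sub>2. local_minimizer F (\<lambda>t. fst (z t))"
proof
  fix z assume z: "z \<in> sub_river F \<Gamma> K \<theta>\<^sub>1 \<theta>\<^sub>2"
  define J where "J x = jacobian F (at x)" for x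
  obtain J' where field: "C2_field F J J'"
    unfolding J_def by (rule smooth_imp_C2_field[OF smooth])
  have F0: "F 0 = 0" by (simp add: A1(2))
  note H = exp_attracting_imp_Hurwitz_2[OF field F0 A1(1)]
  obtain Q q where Q: "transpose Q = Q" "transpose (J 0) ** Q + Q ** J 0 = - mat 1"
      "q > 0" "\<And>y. q * (norm y)\<^sup>2 \<le> y \<bullet> (Q *v y)"
    using Lyapunov_equation_2[OF H] by metis
  \<comment> \<open>The transposed matrix has the same trace and determinant, so the same explicit
    formula provides \<open>X\<close>.\<close>
  have "trace (transpose (J 0)) < 0" "det (transpose (J 0)) > 0"
    using H by (simp_all add: trace_def transpose_def det_2 mult.commute)
  then obtain X x where X: "transpose X = X" "J 0 ** X + X ** transpose (J 0) = - mat 1"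
      "x > 0" "\<And>y. x * (norm y)\<^sup>2 \<le> y \<bullet> (X *v y)"
    using Lyapunov_equation_2[of "transpose (J 0)"] unfolding transpose_transpose by metis
  have hyp: "hyperbolic_field F J J' Q X q x"
    using field F0 Q X by (simp add: hyperbolic_field_def hyperbolic_field_axioms_def)
  interpret hyperbolic_field F J J' Q X q x by (rule hyp)
  have ham: "ham_field F = ham"
    by (simp add: fun_eq_iff ham_field_def ham_def J_def split: prod.split)
  have orbit: "solves_on ham z {..0}" "(z \<longlongrightarrow> 0) at_bot" and m0: "maslov_index F {..0} z = 0"
    using z by (auto simp: sub_river_def river_def unstable_orbit_def ham)
  have full: "\<exists>\<zeta>. lin_orbit z t \<zeta> \<and> fst (\<zeta> t) = u" if t: "t \<le> 0" for t u
  proof -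
    \<comment> \<open>\<open>E\<close> is a subspace because bounded solutions can be combined
      linearly. It contains the projected tangent set and hence its span, which is the whole plane
      when the index is zero.\<close>
    define E where "E = {u. \<exists>\<zeta>. lin_orbit z t \<zeta> \<and> fst (\<zeta> t) = u}"
    have "subspace E"
      unfolding subspace_def
    proof (intro conjI ballI allI)
      have "lin_orbit z t (\<lambda>_. 0)"
        by (simp add: lin_orbit_def blinfun.zero_right image_constant_conv)
      then show "0 \<in> E" unfolding E_def by (force intro: exI[of _ "\<lambda>_. 0"])
    next
      fix a b assume "a \<in> E" "b \<in> E"
      then obtain \<zeta> \<eta> where "lin_orbit z t \<zeta>" "fst (\<zeta> t) = a" "lin_orbit z t \<eta>" "fst (\<eta> t) = b"
        by (auto simp: E_def)
      then show "a + b \<in> E" unfolding E_def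
        by (auto intro!: exI[of _ "\<lambda>r. \<zeta> r + \<eta> r"] lin_orbit_add)
    next
      fix c a assume "a \<in> E"
      then obtain \<zeta> where "lin_orbit z t \<zeta>" "fst (\<zeta> t) = a" by (auto simp: E_def)
      then show "c *\<^sub>R a \<in> E" unfolding E_def
        by (auto intro!: exI[of _ "\<lambda>r. c *\<^sub>R \<zeta> r"] lin_orbit_scaleR)
    qed
    moreover have "fst ` tangent_Wu F (z t) \<subseteq> E"
    proof safe
      fix v w assume "(v, w) \<in> tangent_Wu F (z t)"
      then obtain Z where Z: "\<And>s::real. unstable_orbit F {..0} (Z s)" "Z 0 0 = z t"
        "uniform_limit {..0} Z (Z 0) (at 0)" "((\<lambda>s. Z s 0) has_vector_derivative (v, w)) (at 0)"
        by (auto simp: tangent_Wu_def)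
      have "solves_on ham (Z s) {..0}" "(Z s \<longlongrightarrow> 0) at_bot" for s
        using Z(1)[of s] by (auto simp: unstable_orbit_def ham)
      from tangent_lin_orbit[OF orbit t this Z(3,2,4)]
      obtain \<zeta> where "\<zeta> t = (v, w)" "lin_orbit z t \<zeta>" by metis
      then show "fst (v, w) \<in> E" by (auto simp: E_def)
    qed
    ultimately have "span (fst ` tangent_Wu F (z t)) \<subseteq> E" by (intro span_minimal)
    then have "u \<in> E" using maslov_index_zero_span[OF m0, of t] t by auto
    then show ?thesis by (simp add: E_def)
  qed
  show "local_minimizer F (\<lambda>t. fst (z t))"
    by (rule full_tangent_imp_local_minimizer[OF hyp orbit full])
qed

end
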